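(* Let $g\ge2$. For all admissible module labels $\boldsymbol\alpha,\boldsymbol\beta$, the genus $g$ Virasoro $1$-point differential is given by $$\mathcal F_{\boldsymbol{\alpha\beta}}(\omega,x)=\nabla(x)Z_{\boldsymbol{\alpha\beta}},$$ where $\omega\in V_2$ is the Virasoro conformal vector.
   Context: **VOA.** $V=(V,Y,\mathbf{1},\omega)$ is a simple vertex operator algebra over $\mathbb{C}$ of strong CFT type ($V=\bigoplus_{n\ge0}V_n$, $\dim V_n<\infty$, $V_0=\mathbb{C}\mathbf{1}$, $L(1)V_1=0$), isomorphic to its contragredient module; $Y(\omega,z)=\sum_nL(n)z^{-n-2}$. $\langle\cdot,\cdot\rangle$ is the unique non-degenerate invariant bilinear form on $V$ with $\langle\mathbf 1,\mathbf 1\rangle=1$: $\langle Y(u,z)v,w\rangle=\langle v,Y(e^{zL(1)}(-z^{-2})^{L(0)}u,z^{-1})w\rangle$. **Modules and intertwiners.** $\{(Y_\alpha,\mathcal W_\alpha)\}_{\alpha\in\mathcal A}$ are the inequivalent irreducible ordinary $V$-modules, $\mathcal W_0=V$, $\mathcal W_\alpha=\bigoplus_{n\ge0}\mathcal W_{\alpha,n+h_\alpha}$ with finite-dimensional $L(0)$-eigenspaces of weight $n+h_\alpha$, $h_\alpha\in\mathbb C$. $\mathcal W_{\alpha'}$ is the contragredient module; $\langle\cdot,\cdot\rangle$ also denotes the canonical pairing. $\mathcal Y^\gamma_{\alpha\beta}$ is an intertwining operator of type $\binom{\gamma}{\alpha\ \beta}$ (Frenkel–Huang–Lepowsky), $N^\gamma_{\alpha\beta}$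 the dimension of the space of these. It is assumed that $N^\gamma_{\alpha0}=\delta_{\alpha\gamma}$, $N^0_{\alpha\beta}=\delta_{\alpha\beta'}$. Normalizations: $\mathcal Y^\beta_{0\beta}=Y_\beta$; $\mathcal Y^\alpha_{\alpha0}(v_\alpha,z)u=e^{zL(-1)}Y_\alpha(u,-z)v_\alpha$; $\langle u,\mathcal Y^0_{\alpha\alpha'}(v_\alpha,z)v_{\alpha'}\rangle=\langle\mathcal Y^\alpha_{\alpha0}(e^{zL(1)}(-z^{-2})^{L(0)}v_\alpha,z^{-1})u,v_{\alpha'}\rangle$; for other types an intertwining operator is fixed. **Partition and 1-point functions.** $\mathcal I=\{\pm1,\ldots,\pm g\}$, with formal variables $w_a$ ($a\in\mathcal I$), $\rho_a=\rho_{-a}$. For labels $\boldsymbol\alpha=\alpha_1,\ldots,\alpha_g$ let $\{b_a\}$ be a homogeneous basis of $\mathcal W_{\alpha_a}$, $\{b_a'\}$ the dual basis of $\mathcal W_{\alpha_a'}$, $b_{-a}:=\rho_a^{\mathrm{wt}(b_a)}b_a'$. For labels $\boldsymbol\beta=\beta_1,\ldots,\beta_{2g-1}$ with $\beta_1=\alpha_1'$, $\beta_{2g-1}=\alpha_g'$, $$\mathcal Y^{\boldsymbol\beta}_{\boldsymbol{\alpha\alpha'}}(\boldsymbol b,\boldsymbol w)=\mathcal Y^0_{\alpha_1\beta_1}(b_1,w_1)\mathcal Y^{\beta_1}_{\alpha_1'\beta_2}(b_{-1},w_{-1})\cdots\mathcal Y^{\beta_{2g-2}}_{\alpha_g\beta_{2g-1}}(b_g,w_g)\mathcal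 Y^{\beta_{2g-1}}_{\alpha_g'0}(b_{-g},w_{-g}),$$ $$Z_{\boldsymbol{\alpha\beta}}=\sum_{b_1,\ldots,b_g}\langle\mathbf 1,\mathcal Y^{\boldsymbol\beta}_{\boldsymbol{\alpha\alpha'}}(\boldsymbol b,\boldsymbol w)\mathbf 1\rangle,\qquad\mathcal F_{\boldsymbol{\alpha\beta}}(\omega,x)=\sum_{b_1,\ldots,b_g}\langle\mathbf 1,Y(\omega,x)\mathcal Y^{\boldsymbol\beta}_{\boldsymbol{\alpha\alpha'}}(\boldsymbol b,\boldsymbol w)\mathbf 1\rangle dx^2.$$ **The operator $\nabla(x)$.** For Schottky parameters satisfying $|w_a-w_b|>|\rho_a|^{1/2}+|\rho_b|^{1/2}$ for $a\ne b$ in $\mathcal I$, $\Gamma$ is the free (Schottky) group generated by $\gamma_az=w_{-a}+\rho_a/(z-w_a)$, $a=1,\ldots,g$, with limit set $\Lambda(\Gamma)$. The Bers quasiform is $\Psi_2(x,y)=\sum_{\gamma\in\Gamma}\Pi_2(\gamma x,y)$, $\Pi_2(x,y)=\pi_2(x,y)dx^2dy^{-1}$, $\pi_2(x,y)=\frac1{x-y}\prod_{\ell=0}^2\frac{y-A_\ell}{x-A_\ell}$ with $A_0,A_1,A_2$ distinct points of $\Lambda(\Gamma)$. The holomorphic $2$-forms $\Theta_{2,a}^\ell(x)$ ($a=1,\ldots,g$; $\ell=0,1,2$) are defined by $\Psi_2(x,\gamma_ay)-\Psi_2(x,y)=-\sum_{\ell=0}^2\Theta_{2,a}^\ell(x)(y-w_a)^\ell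 dy^{-1}$. With $\partial_a^0=\partial_{w_a}$, $\partial_a^1=\rho_a\partial_{\rho_a}$, $\partial_a^2=\rho_a\partial_{w_{-a}}$, $$\nabla(x)=\sum_{a=1}^g\sum_{\ell=0}^2\Theta_{2,a}^\ell(x)\partial_a^\ell.$$ **Expansions in $\rho$.** The identity is formal, $\Theta_{2,a}^\ell$ being represented by the following expansion in the $\rho_a$ ($N=2$, $f^{(i)}=\frac1{i!}\partial^if$, $h^{(i,j)}=\frac1{i!j!}\partial_x^i\partial_y^jh$). Write $\pi_2(x,y)=\frac1{x-y}+\sum_{\ell=0}^2f_\ell(x)y^\ell$. For $a,b\in\mathcal I$, $m,n\ge0$ let $L_b^n(x)=\rho_b^{n/2}\pi_2^{(0,n)}(x,w_b)dx^2$, $A_{ab}^{mn}=\rho_a^{(m+1)/2}\rho_b^{n/2}\pi_2^{(m,n)}(w_{-a},w_b)$ if $a\ne-b$, $A_{a,-a}^{mn}=\rho_a^{(m+n+1)/2}\sum_{\ell=0}^2\binom{\ell}{n}f_\ell^{(m)}(w_{-a})w_{-a}^{\ell-n}$, $\Delta_{ab}^{mn}=\delta_{m,n+3}\delta_{ab}$, $\widetilde L=L\Delta$, $\widetilde A=A\Delta$, $(I-\widetilde A)^{-1}=\sum_{k\ge0}\widetilde A^k$. Then $\Theta_{2,a}^\ell(x)=T_a^\ell(x)+\rho_a^{1-\ell}T_{-a}^{2-\ell}(x)$ with $T_a^\ell(x)=\rho_a^{-\ell/2}\big(L(x)+\widetilde L(x)(I-\widetilde A)^{-1}A\big)_a^\ell$.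 *)

theory Defs
  imports Complex_Main "HOL-Library.Function_Algebras" "HOL-Library.Groups_Big_Fun"
    "HOL-Library.Extended_Nat" "HOL-Library.FuncSet"
begin

section \<open>Vertex operator algebras and their modules\<close>

text \<open>
  All spaces are subspaces (carriers) of a complex vector space given by a type of class
  \<open>ab_group_add\<close> with a scalar multiplication. Fields are given by their modes:
  \<open>vop V u n v\<close> is \<open>u\<^sub>(\<^sub>n\<^sub>) v\<close> in \<open>Y(u,z)v = \<Sum>\<^sub>n u\<^sub>(\<^sub>n\<^sub>) v z^(-n-1)\<close>, and likewise for modules
  and intertwining operators.
  Sums written with \<open>Sum_any\<close> have finitely many non-zero terms wherever they are used.
\<close>

record 'v voa =
  vcarrier :: "'v set"
  vsmult :: "complex \<Rightarrow> 'v \<Rightarrow> 'v"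
  vop :: "'v \<Rightarrow> int \<Rightarrow> 'v \<Rightarrow> 'v"
  vac :: 'v
  conf :: 'v

record ('v, 'm) vmod =
  mcarrier :: "'m set"
  msmult :: "complex \<Rightarrow> 'm \<Rightarrow> 'm"
  mop :: "'v \<Rightarrow> int \<Rightarrow> 'm \<Rightarrow> 'm"

definition adjoint_mod :: "'v voa \<Rightarrow> ('v, 'v) vmod" where
  "adjoint_mod V = \<lparr>mcarrier = vcarrier V, msmult = vsmult V, mop = vop V\<rparr>"

definition Lop :: "'v voa \<Rightarrow> ('v, 'm) vmod \<Rightarrow> int \<Rightarrow> 'm \<Rightarrow> 'm" where
  "Lop V M n w = mop M (conf V) (n + 1) w"

definition wt_space :: "'v voa \<Rightarrow> ('v, 'm) vmod \<Rightarrow> complex \<Rightarrow> 'm set" where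
  "wt_space V M l = {w \<in> mcarrier M. Lop V M 0 w = msmult M l w}"

definition wt :: "'v voa \<Rightarrow> ('v, 'm) vmod \<Rightarrow> 'm \<Rightarrow> complex" where
  "wt V M w = (THE l. w \<in> wt_space V M l)"

definition fin_dim :: "(complex \<Rightarrow> 'm \<Rightarrow> 'm) \<Rightarrow> 'm::ab_group_add set \<Rightarrow> bool" where
  "fin_dim sc S \<longleftrightarrow> (\<exists>B. finite B \<and> B \<subseteq> S \<and> S \<subseteq> module.span sc B)"

definition lin_on :: "(complex \<Rightarrow> 'm \<Rightarrow> 'm) \<Rightarrow> (complex \<Rightarrow> 'n \<Rightarrow> 'n) \<Rightarrow> 'm::ab_group_add set
    \<Rightarrow> ('m \<Rightarrow> 'n::ab_group_add) \<Rightarrow> bool" where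
  "lin_on s t S f \<longleftrightarrow> (\<forall>x\<in>S. \<forall>y\<in>S. f (x + y) = f x + f y) \<and> (\<forall>c. \<forall>x\<in>S. f (s c x) = t c (f x))"

text \<open>
  The Jacobi identity in components (Borcherds identity). The three actions of \<open>u\<close> are those on
  the spaces containing \<open>v\<close>, \<open>w\<close> and \<open>v\<^sub>(\<^sub>n\<^sub>) w\<close>; \<open>Y\<close> has modes indexed by complex numbers, so that
  the same formula serves for algebras, modules and intertwining operators.
\<close>

definition jacobi_at ::
  "(complex \<Rightarrow> 'c \<Rightarrow> 'c) \<Rightarrow> (int \<Rightarrow> 'a \<Rightarrow> 'a) \<Rightarrow> (int \<Rightarrow> 'b \<Rightarrow> 'b) \<Rightarrow> (int \<Rightarrow> 'c \<Rightarrow> 'c)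
    \<Rightarrow> ('a \<Rightarrow> complex \<Rightarrow> 'b \<Rightarrow> 'c::ab_group_add) \<Rightarrow> 'a \<Rightarrow> 'b \<Rightarrow> int \<Rightarrow> int \<Rightarrow> complex \<Rightarrow> bool" where
  "jacobi_at sc ua ub uc Y v w l m n \<longleftrightarrow>
     (Sum_any (\<lambda>i::nat. sc (of_int m gchoose i) (Y (ua (l + int i) v) (of_int m + n - of_nat i) w))) =
     (Sum_any (\<lambda>i::nat. sc ((-1) ^ i * (of_int l gchoose i))
         (uc (m + l - int i) (Y v (n + of_nat i) w)
          - sc ((-1) powi l) (Y v (n + of_int l - of_nat i) (ub (m + int i) w)))))"

text \<open>A field with integer modes, viewed as one with complex modes.\<close>

definition cmodes :: "('a \<Rightarrow> int \<Rightarrow> 'b \<Rightarrow> 'c) \<Rightarrow> 'a \<Rightarrow> complex \<Rightarrow> 'b \<Rightarrow> 'c::zero" where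
  "cmodes Y v n w = (if n \<in> \<int> then Y v \<lfloor>Re n\<rfloor> w else 0)"

definition weak_module :: "'v::ab_group_add voa \<Rightarrow> ('v, 'm::ab_group_add) vmod \<Rightarrow> bool" where
  "weak_module V M \<longleftrightarrow>
     vector_space (msmult M) \<and> module.subspace (msmult M) (mcarrier M) \<and>
     (\<forall>u\<in>vcarrier V. \<forall>n. \<forall>w\<in>mcarrier M. mop M u n w \<in> mcarrier M) \<and>
     (\<forall>u\<in>vcarrier V. \<forall>n. lin_on (msmult M) (msmult M) (mcarrier M) (mop M u n)) \<and>
     (\<forall>w\<in>mcarrier M. \<forall>n. lin_on (vsmult V) (msmult M) (vcarrier V) (\<lambda>u. mop M u n w)) \<and>
     (\<forall>u\<in>vcarrier V. \<forall>w\<in>mcarrier M. \<exists>N. \<forall>n\<ge>N. mop M u n w = 0) \<and>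
     (\<forall>w\<in>mcarrier M. \<forall>n. mop M (vac V) n w = (if n = -1 then w else 0)) \<and>
     (\<forall>u\<in>vcarrier V. \<forall>v\<in>vcarrier V. \<forall>w\<in>mcarrier M. \<forall>l m n.
        jacobi_at (msmult M) (vop V u) (mop M u) (mop M u) (cmodes (mop M)) v w l m (of_int n)) \<and>
     (\<forall>u\<in>vcarrier V. \<forall>w\<in>mcarrier M. \<forall>n.
        mop M (vop V (conf V) 0 u) n w = msmult M (- of_int n) (mop M u (n - 1) w))"

definition is_voa :: "'v::ab_group_add voa \<Rightarrow> bool" where
  "is_voa V \<longleftrightarrow>
     weak_module V (adjoint_mod V) \<and>
     vac V \<in> vcarrier V \<and> conf V \<in> vcarrier V \<and>
     (\<forall>u\<in>vcarrier V. vop V u (-1) (vac V) = u \<and> (\<forall>n\<ge>0. vop V u n (vac V) = 0)) \<and>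
     (\<exists>c. \<forall>m n. \<forall>v\<in>vcarrier V. let L = Lop V (adjoint_mod V) in
        L m (L n v) - L n (L m v) = vsmult V (of_int (m - n)) (L (m + n) v)
          + vsmult V (if m + n = 0 then of_int (m ^ 3 - m) / 12 * c else 0) v) \<and>
     vcarrier V = module.span (vsmult V) (\<Union>n::int. wt_space V (adjoint_mod V) (of_int n)) \<and>
     (\<forall>n::int. fin_dim (vsmult V) (wt_space V (adjoint_mod V) (of_int n))) \<and>
     (\<exists>N::int. \<forall>n<N. wt_space V (adjoint_mod V) (of_int n) = {0})"

definition strong_CFT_type :: "'v::ab_group_add voa \<Rightarrow> bool" where
  "strong_CFT_type V \<longleftrightarrow>
     (\<forall>n::int. n < 0 \<longrightarrow> wt_space V (adjoint_mod V) (of_int n) = {0}) \<and>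
     wt_space V (adjoint_mod V) 0 = module.span (vsmult V) {vac V} \<and>
     (\<forall>v\<in>wt_space V (adjoint_mod V) 1. Lop V (adjoint_mod V) 1 v = 0)"

definition ordinary_module :: "'v::ab_group_add voa \<Rightarrow> ('v, 'm::ab_group_add) vmod \<Rightarrow> bool" where
  "ordinary_module V M \<longleftrightarrow>
     weak_module V M \<and>
     mcarrier M = module.span (msmult M) (\<Union>l. wt_space V M l) \<and>
     (\<forall>l. fin_dim (msmult M) (wt_space V M l)) \<and>
     (\<forall>l. \<exists>N::nat. \<forall>n\<ge>N. wt_space V M (l - of_nat n) = {0})"

definition submodule :: "'v voa \<Rightarrow> ('v, 'm::ab_group_add) vmod \<Rightarrow> 'm set \<Rightarrow> bool" where
  "submodule V M S \<longleftrightarrow> S \<subseteq> mcarrier M \<and> module.subspace (msmult M) S \<and>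
     (\<forall>u\<in>vcarrier V. \<forall>n. \<forall>w\<in>S. mop M u n w \<in> S)"

definition irreducible_mod :: "'v voa \<Rightarrow> ('v, 'm::ab_group_add) vmod \<Rightarrow> bool" where
  "irreducible_mod V M \<longleftrightarrow> mcarrier M \<noteq> {0} \<and>
     (\<forall>S. submodule V M S \<longrightarrow> S = {0} \<or> S = mcarrier M)"

definition module_iso :: "'v voa \<Rightarrow> ('v, 'm::ab_group_add) vmod \<Rightarrow> ('v, 'n::ab_group_add) vmod
    \<Rightarrow> ('m \<Rightarrow> 'n) \<Rightarrow> bool" where
  "module_iso V M N f \<longleftrightarrow> bij_betw f (mcarrier M) (mcarrier N) \<and>
     lin_on (msmult M) (msmult N) (mcarrier M) f \<and>
     (\<forall>u\<in>vcarrier V. \<forall>n. \<forall>w\<in>mcarrier M. f (mop M u n w) = mop N u n (f w))"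

definition hcomp :: "'v::ab_group_add voa \<Rightarrow> 'v \<Rightarrow> int \<Rightarrow> 'v" where
  "hcomp V u = (SOME f. (\<forall>k. f k \<in> wt_space V (adjoint_mod V) (of_int k)) \<and>
     finite {k. f k \<noteq> 0} \<and> u = Sum_any f)"

text \<open>
  The coefficient of \<open>z^(-n-1)\<close> in \<open>Y(e^(zL(1)) (-z^(-2))^L(0) u, z^(-1)) w\<close>: on the component of \<open>u\<close>
  of weight \<open>k\<close> the summand with \<open>L(1)^j / j!\<close> carries the power \<open>z^(-2k+j)\<close>.
\<close>

definition adj_mode :: "'v::ab_group_add voa \<Rightarrow> ('v, 'm::ab_group_add) vmod
    \<Rightarrow> 'v \<Rightarrow> int \<Rightarrow> 'm \<Rightarrow> 'm" where
  "adj_mode V M u n w = (Sum_any (\<lambda>k::int. Sum_any (\<lambda>j::nat. msmult M ((-1) powi k / fact j)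
     (mop M ((Lop V (adjoint_mod V) 1 ^^ j) (hcomp V u k)) (2 * k - int j - n - 2) w))))"

text \<open>The contragredient module lives on the graded dual; functionals are extended by \<open>0\<close>.\<close>

definition contragredient :: "'v::ab_group_add voa \<Rightarrow> ('v, 'm::ab_group_add) vmod
    \<Rightarrow> ('v, 'm \<Rightarrow> complex) vmod" where
  "contragredient V M =
     \<lparr>mcarrier = {\<phi>. lin_on (msmult M) (*) (mcarrier M) \<phi> \<and> (\<forall>w. w \<notin> mcarrier M \<longrightarrow> \<phi> w = 0) \<and>
                   finite {l. \<exists>w\<in>wt_space V M l. \<phi> w \<noteq> 0}},
      msmult = (\<lambda>c \<phi> w. c * \<phi> w),
      mop = (\<lambda>u n \<phi> w. if w \<in> mcarrier M then \<phi> (adj_mode V M u n w) else 0)\<rparr>"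

definition invariant_form :: "'v::ab_group_add voa \<Rightarrow> ('v \<Rightarrow> 'v \<Rightarrow> complex) \<Rightarrow> bool" where
  "invariant_form V form \<longleftrightarrow>
     (\<forall>v\<in>vcarrier V. lin_on (vsmult V) (*) (vcarrier V) (form v) \<and>
        lin_on (vsmult V) (*) (vcarrier V) (\<lambda>u. form u v)) \<and>
     (\<forall>v\<in>vcarrier V. (\<forall>w\<in>vcarrier V. form v w = 0) \<longrightarrow> v = 0) \<and>
     (\<forall>w\<in>vcarrier V. (\<forall>v\<in>vcarrier V. form v w = 0) \<longrightarrow> w = 0) \<and>
     (\<forall>u\<in>vcarrier V. \<forall>v\<in>vcarrier V. \<forall>w\<in>vcarrier V. \<forall>n.
        form (vop V u n v) w = form v (adj_mode V (adjoint_mod V) u n w))"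


section \<open>Intertwining operators\<close>

type_synonym 'w intw_op = "'w \<Rightarrow> complex \<Rightarrow> 'w \<Rightarrow> 'w"

text \<open>\<open>intertwining V M3 M1 M2 Y\<close>: \<open>Y\<close> has type \<open>M3\<close> over \<open>M1 M2\<close>, i.e. maps \<open>M1 \<times> M2\<close> to \<open>M3\<close>.\<close>

definition intertwining :: "'v::ab_group_add voa \<Rightarrow> ('v, 'w::ab_group_add) vmod \<Rightarrow> ('v, 'w) vmod
    \<Rightarrow> ('v, 'w) vmod \<Rightarrow> 'w intw_op \<Rightarrow> bool" where
  "intertwining V M3 M1 M2 Y \<longleftrightarrow>
     (\<forall>v\<in>mcarrier M1. \<forall>n. \<forall>w\<in>mcarrier M2. Y v n w \<in> mcarrier M3) \<and>
     (\<forall>v\<in>mcarrier M1. \<forall>n. lin_on (msmult M2) (msmult M3) (mcarrier M2) (Y v n)) \<and>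
     (\<forall>w\<in>mcarrier M2. \<forall>n. lin_on (msmult M1) (msmult M3) (mcarrier M1) (\<lambda>v. Y v n w)) \<and>
     (\<forall>v\<in>mcarrier M1. \<forall>w\<in>mcarrier M2. \<exists>N. \<forall>n. N \<le> Re n \<longrightarrow> Y v n w = 0) \<and>
     (\<forall>u\<in>vcarrier V. \<forall>v\<in>mcarrier M1. \<forall>w\<in>mcarrier M2. \<forall>l m n.
        jacobi_at (msmult M3) (mop M1 u) (mop M2 u) (mop M3 u) Y v w l m n) \<and>
     (\<forall>v\<in>mcarrier M1. \<forall>w\<in>mcarrier M2. \<forall>n.
        Y (Lop V M1 (-1) v) n w = msmult M3 (- n) (Y v (n - 1) w))"

text \<open>Operators are extended by \<open>0\<close> so that distinct functions are distinct operators.\<close>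

definition intertwiners :: "'v::ab_group_add voa \<Rightarrow> ('v, 'w::ab_group_add) vmod \<Rightarrow> ('v, 'w) vmod
    \<Rightarrow> ('v, 'w) vmod \<Rightarrow> 'w intw_op set" where
  "intertwiners V M3 M1 M2 = {Y. intertwining V M3 M1 M2 Y \<and>
     (\<forall>v n w. v \<notin> mcarrier M1 \<or> w \<notin> mcarrier M2 \<longrightarrow> Y v n w = 0)}"

text \<open>The library's \<open>dim\<close> is \<open>0\<close> on infinite-dimensional spaces, hence the extended naturals.\<close>

definition fusion_rule :: "'v::ab_group_add voa \<Rightarrow> ('v, 'w::ab_group_add) vmod \<Rightarrow> ('v, 'w) vmod
    \<Rightarrow> ('v, 'w) vmod \<Rightarrow> enat" where
  "fusion_rule V M3 M1 M2 = (let sc = (\<lambda>c Y v n w. msmult M3 c (Y v n w)); S = intertwiners V M3 M1 M2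
     in if fin_dim sc S then enat (vector_space.dim sc S) else \<infinity>)"


section \<open>The standing data\<close>

text \<open>
  \<open>irr D \<alpha>\<close> is the irreducible module labelled \<open>\<alpha>\<close>, \<open>lab0 D\<close> the label of \<open>V\<close>, \<open>dual D \<alpha>\<close> the
  label \<open>\<alpha>'\<close>. The map \<open>to_dual D \<alpha>\<close> identifies the module labelled \<open>\<alpha>'\<close> with the contragredient
  of the one labelled \<open>\<alpha>\<close>; the canonical pairing of \<open>v\<close> with \<open>v'\<close> is \<open>to_dual D \<alpha> v' v\<close>.
  \<open>intw D \<gamma> \<alpha> \<beta>\<close> is the fixed intertwining operator of type \<open>\<gamma>\<close> over \<open>\<alpha> \<beta>\<close>.
\<close>

record ('w, 'i) rep_data =
  alg :: "'w voa"
  form :: "'w \<Rightarrow> 'w \<Rightarrow> complex"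
  labels :: "'i set"
  lab0 :: 'i
  irr :: "'i \<Rightarrow> ('w, 'w) vmod"
  dual :: "'i \<Rightarrow> 'i"
  to_dual :: "'i \<Rightarrow> 'w \<Rightarrow> 'w \<Rightarrow> complex"
  intw :: "'i \<Rightarrow> 'i \<Rightarrow> 'i \<Rightarrow> 'w intw_op"

definition voa_assms :: "('w::ab_group_add, 'i) rep_data \<Rightarrow> bool" where
  "voa_assms D \<longleftrightarrow> (let V = alg D in
     is_voa V \<and> strong_CFT_type V \<and> irreducible_mod V (adjoint_mod V) \<and>
     (\<exists>f. module_iso V (adjoint_mod V) (contragredient V (adjoint_mod V)) f) \<and>
     invariant_form V (form D) \<and> form D (vac V) (vac V) = 1)"

definition irr_assms :: "('w::ab_group_add, 'i) rep_data \<Rightarrow> bool" where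
  "irr_assms D \<longleftrightarrow> (let V = alg D; A = labels D; W = irr D in
     lab0 D \<in> A \<and> W (lab0 D) = adjoint_mod V \<and>
     (\<forall>\<alpha>\<in>A. ordinary_module V (W \<alpha>) \<and> irreducible_mod V (W \<alpha>) \<and>
        (\<exists>h. mcarrier (W \<alpha>) = module.span (msmult (W \<alpha>)) (\<Union>n::nat. wt_space V (W \<alpha>) (of_nat n + h)))) \<and>
     (\<forall>\<alpha>\<in>A. \<forall>\<beta>\<in>A. (\<exists>f. module_iso V (W \<alpha>) (W \<beta>) f) \<longrightarrow> \<alpha> = \<beta>) \<and>
     (\<forall>M :: ('w, 'w) vmod. ordinary_module V M \<and> irreducible_mod V M \<longrightarrow>
        (\<exists>\<alpha>\<in>A. \<exists>f. module_iso V (W \<alpha>) M f)) \<and>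
     (\<forall>\<alpha>\<in>A. dual D \<alpha> \<in> A \<and>
        module_iso V (W (dual D \<alpha>)) (contragredient V (W \<alpha>)) (to_dual D \<alpha>)) \<and>
     (\<forall>v\<in>vcarrier V. \<forall>v'\<in>vcarrier V. to_dual D (lab0 D) v' v = form D v v') \<and>
     (\<forall>\<alpha>\<in>A. \<forall>\<gamma>\<in>A. fusion_rule V (W \<gamma>) (W \<alpha>) (W (lab0 D)) = (if \<alpha> = \<gamma> then 1 else 0)) \<and>
     (\<forall>\<alpha>\<in>A. \<forall>\<beta>\<in>A. fusion_rule V (W (lab0 D)) (W \<alpha>) (W \<beta>) = (if \<alpha> = dual D \<beta> then 1 else 0)))"

text \<open>
  The normalizations in components. The second one extracts the coefficient of \<open>z^(-n-1)\<close> in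
  \<open>e^(zL(-1)) Y(u,-z) v\<close>. In the third one \<open>v\<close> has weight \<open>l\<close>, and \<open>(-z^(-2))^L(0) v\<close> is
  \<open>e^(\<pi> i l) z^(-2l) v\<close>.
\<close>

definition intw_assms :: "('w::ab_group_add, 'i) rep_data \<Rightarrow> bool" where
  "intw_assms D \<longleftrightarrow> (let V = alg D; A = labels D; W = irr D; o0 = lab0 D in
     (\<forall>\<alpha>\<in>A. \<forall>\<beta>\<in>A. \<forall>\<gamma>\<in>A. intertwining V (W \<gamma>) (W \<alpha>) (W \<beta>) (intw D \<gamma> \<alpha> \<beta>)) \<and>
     (\<forall>\<beta>\<in>A. \<forall>u\<in>vcarrier V. \<forall>w\<in>mcarrier (W \<beta>). \<forall>n.
        intw D \<beta> o0 \<beta> u n w = cmodes (mop (W \<beta>)) u n w) \<and>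
     (\<forall>\<alpha>\<in>A. \<forall>v\<in>mcarrier (W \<alpha>). \<forall>u\<in>vcarrier V. \<forall>n.
        intw D \<alpha> \<alpha> o0 v n u = cmodes (\<lambda>v n u. Sum_any (\<lambda>k::nat. msmult (W \<alpha>) ((-1) powi (n + int k + 1) / fact k)
          ((Lop V (W \<alpha>) (-1) ^^ k) (mop (W \<alpha>) u (n + int k) v)))) v n u) \<and>
     (\<forall>\<alpha>\<in>A. \<forall>l. \<forall>v\<in>wt_space V (W \<alpha>) l. \<forall>v'\<in>mcarrier (W (dual D \<alpha>)). \<forall>u\<in>vcarrier V. \<forall>n.
        form D u (intw D o0 \<alpha> (dual D \<alpha>) v n v') =
          (Sum_any (\<lambda>k::nat. exp (of_real pi * \<i> * l) / fact k *
             to_dual D \<alpha> v' (intw D \<alpha> \<alpha> o0 ((Lop V (W \<alpha>) 1 ^^ k) v) (2 * l - of_nat k - n - 2) u)))))"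

definition rep_theory :: "('w::ab_group_add, 'i) rep_data \<Rightarrow> bool" where
  "rep_theory D \<longleftrightarrow> voa_assms D \<and> irr_assms D \<and> intw_assms D"

definition hom_basis :: "('w::ab_group_add, 'i) rep_data \<Rightarrow> 'i \<Rightarrow> 'w set \<Rightarrow> bool" where
  "hom_basis D \<alpha> B \<longleftrightarrow> (let W = irr D \<alpha> in
     B \<subseteq> (\<Union>l. wt_space (alg D) W l) \<and> \<not> module.dependent (msmult W) B \<and>
     module.span (msmult W) B = mcarrier W)"

definition dual_basis :: "('w::ab_group_add, 'i) rep_data \<Rightarrow> 'i \<Rightarrow> 'w set \<Rightarrow> ('w \<Rightarrow> 'w) \<Rightarrow> bool" where
  "dual_basis D \<alpha> B d \<longleftrightarrow> (\<forall>b\<in>B. d b \<in> mcarrier (irr D (dual D \<alpha>)) \<and>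
     (\<forall>c\<in>B. to_dual D \<alpha> (d b) c = (if c = b then 1 else 0)))"


section \<open>Formal series with complex exponents\<close>

text \<open>
  The variables are \<open>x\<close>, \<open>w\<^sub>a\<close>, \<open>\<rho>\<^sub>a\<close> (\<open>a > 0\<close>; \<open>\<rho>\<^sub>a = \<rho>\<^sub>-\<^sub>a\<close> is \<open>VR \<bar>a\<bar>\<close>) and the points \<open>A\<^sub>\<ell>\<close>;
  \<open>VY\<close> is auxiliary. A series maps an exponent vector to the coefficient of that monomial.
  The differential \<open>dx\<^sup>2\<close> is suppressed: a formal 2-differential is represented by its coefficient.
\<close>

datatype var = VX | VY | VW int | VR int | VA nat

type_synonym fseries = "(var \<Rightarrow> complex) \<Rightarrow> complex"

definition fmonom :: "(var \<Rightarrow> complex) \<Rightarrow> fseries" where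
  "fmonom d = (\<lambda>e. if e = d then 1 else 0)"

definition vpow :: "var \<Rightarrow> complex \<Rightarrow> fseries" where
  "vpow v s = fmonom (\<lambda>u. if u = v then s else 0)"

definition fscale :: "complex \<Rightarrow> fseries \<Rightarrow> fseries" where
  "fscale c f = (\<lambda>e. c * f e)"

text \<open>
  Products and infinite sums are formed coefficientwise and are meaningful when each coefficient
  is a finite sum, which is the case for all those below. (Addition is pointwise; the pointwise
  \<open>*\<close> on functions is not the product of series.)
\<close>

definition fmul :: "fseries \<Rightarrow> fseries \<Rightarrow> fseries" (infixl "\<star>" 70) where
  "f \<star> h = (\<lambda>e. Sum_any (\<lambda>d. f d * h (e - d)))"

definition fsum :: "('j \<Rightarrow> fseries) \<Rightarrow> 'j set \<Rightarrow> fseries" where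
  "fsum F J = (\<lambda>e. Sum_any (\<lambda>j. if j \<in> J then F j e else 0))"

definition fderiv :: "var \<Rightarrow> fseries \<Rightarrow> fseries" where
  "fderiv v f = (\<lambda>e. (e v + 1) * f (e(v := e v + 1)))"

text \<open>\<open>1/(i! j!) \<partial>\<^sub>u\<^sup>i \<partial>\<^sub>v\<^sup>j\<close>\<close>

definition dderiv :: "var \<Rightarrow> nat \<Rightarrow> var \<Rightarrow> nat \<Rightarrow> fseries \<Rightarrow> fseries" where
  "dderiv u i v j f = fscale (1 / (fact i * fact j)) ((fderiv u ^^ i) ((fderiv v ^^ j) f))"


section \<open>The operator \<open>\<nabla>(x)\<close>\<close>

text \<open>
  Rational functions are expanded in a region \<open>\<bar>u\<bar> > \<bar>v\<bar> > \<dots>\<close> prescribed by a ranking \<open>r\<close> of the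
  variables. The ranking has to be compatible with the order of the vertex operators, but leaves
  free the position of the points \<open>A\<^sub>\<ell>\<close>, which are independent formal variables.
  The forms \<open>\<Theta>\<close> are defined by their expansions in the \<open>\<rho>\<^sub>a\<close>; half-integral powers of \<open>\<rho>\<^sub>a\<close> occur only
  in intermediate expressions.
\<close>

definition expansion_order :: "nat \<Rightarrow> (var \<Rightarrow> real) \<Rightarrow> bool" where
  "expansion_order g r \<longleftrightarrow> inj r \<and> r VX > r (VW 1) \<and>
     (\<forall>a. 1 \<le> a \<and> a \<le> int g \<longrightarrow> r (VW a) > r (VW (- a))) \<and>
     (\<forall>a. 1 \<le> a \<and> a < int g \<longrightarrow> r (VW (- a)) > r (VW (a + 1)))"

definition inv_diff :: "(var \<Rightarrow> real) \<Rightarrow> var \<Rightarrow> var \<Rightarrow> fseries" where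
  "inv_diff r u v =
     (if r u > r v then fsum (\<lambda>k::nat. vpow u (- 1 - of_nat k) \<star> vpow v (of_nat k)) UNIV
      else - fsum (\<lambda>k::nat. vpow v (- 1 - of_nat k) \<star> vpow u (of_nat k)) UNIV)"

definition pi2_factor :: "(var \<Rightarrow> real) \<Rightarrow> var \<Rightarrow> var \<Rightarrow> nat \<Rightarrow> fseries" where
  "pi2_factor r x y l = (vpow y 1 - vpow (VA l) 1) \<star> inv_diff r x (VA l)"

definition pi2 :: "(var \<Rightarrow> real) \<Rightarrow> var \<Rightarrow> var \<Rightarrow> fseries" where
  "pi2 r x y = inv_diff r x y \<star> pi2_factor r x y 0 \<star> pi2_factor r x y 1 \<star> pi2_factor r x y 2"

text \<open>The coefficient of \<open>y\<^sup>l\<close> in \<open>\<pi>\<^sub>2(x,y) - 1/(x-y)\<close>, which is polynomial in \<open>y\<close> of degree 2.\<close>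

definition fl :: "(var \<Rightarrow> real) \<Rightarrow> nat \<Rightarrow> var \<Rightarrow> fseries" where
  "fl r l x = (\<lambda>e. if e VY = 0 then (pi2 r x VY - inv_diff r x VY) (e(VY := of_nat l)) else 0)"

definition Iset :: "nat \<Rightarrow> int set" where
  "Iset g = {a. a \<noteq> 0 \<and> \<bar>a\<bar> \<le> int g}"

definition rho :: "int \<Rightarrow> complex \<Rightarrow> fseries" where
  "rho a s = vpow (VR \<bar>a\<bar>) s"

type_synonym frow = "int \<Rightarrow> nat \<Rightarrow> fseries"
type_synonym fmat = "int \<Rightarrow> int \<Rightarrow> nat \<Rightarrow> nat \<Rightarrow> fseries"

definition row_mul :: "nat \<Rightarrow> frow \<Rightarrow> fmat \<Rightarrow> frow" where
  "row_mul g R M b n = fsum (\<lambda>(c, k). R c k \<star> M c b k n) (Iset g \<times> UNIV)"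

definition mat_mul :: "nat \<Rightarrow> fmat \<Rightarrow> fmat \<Rightarrow> fmat" where
  "mat_mul g M N a b m n = fsum (\<lambda>(c, k). M a c m k \<star> N c b k n) (Iset g \<times> UNIV)"

definition mat_id :: fmat where
  "mat_id a b m n = (if a = b \<and> m = n then fmonom 0 else 0)"

definition Lrow :: "(var \<Rightarrow> real) \<Rightarrow> frow" where
  "Lrow r b n = rho b (of_nat n / 2) \<star> dderiv VX 0 (VW b) n (pi2 r VX (VW b))"

definition Amat :: "(var \<Rightarrow> real) \<Rightarrow> fmat" where
  "Amat r a b m n =
     (if b \<noteq> - a
      then rho a ((of_nat m + 1) / 2) \<star> rho b (of_nat n / 2)
             \<star> dderiv (VW (- a)) m (VW b) n (pi2 r (VW (- a)) (VW b))
      else rho a ((of_nat m + of_nat n + 1) / 2)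
             \<star> (\<Sum>l\<le>2. fscale (of_nat (l choose n))
                  (fscale (1 / fact m) ((fderiv (VW (- a)) ^^ m) (fl r l (VW (- a))))
                   \<star> vpow (VW (- a)) (of_nat l - of_nat n))))"

definition Dmat :: fmat where
  "Dmat a b m n = (if m = n + 3 \<and> a = b then fmonom 0 else 0)"

definition Ltilde :: "nat \<Rightarrow> (var \<Rightarrow> real) \<Rightarrow> frow" where
  "Ltilde g r = row_mul g (Lrow r) Dmat"

definition Atilde :: "nat \<Rightarrow> (var \<Rightarrow> real) \<Rightarrow> fmat" where
  "Atilde g r = mat_mul g (Amat r) Dmat"

definition neumann :: "nat \<Rightarrow> fmat \<Rightarrow> fmat" where
  "neumann g M a b m n = fsum (\<lambda>k::nat. (mat_mul g M ^^ k) mat_id a b m n) UNIV"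

definition Tcoef :: "nat \<Rightarrow> (var \<Rightarrow> real) \<Rightarrow> int \<Rightarrow> nat \<Rightarrow> fseries" where
  "Tcoef g r a l = rho a (- of_nat l / 2)
     \<star> (Lrow r a l + row_mul g (row_mul g (Ltilde g r) (neumann g (Atilde g r))) (Amat r) a l)"

definition Theta :: "nat \<Rightarrow> (var \<Rightarrow> real) \<Rightarrow> int \<Rightarrow> nat \<Rightarrow> fseries" where
  "Theta g r a l = Tcoef g r a l + rho a (1 - of_nat l) \<star> Tcoef g r (- a) (2 - l)"

definition dpar :: "int \<Rightarrow> nat \<Rightarrow> fseries \<Rightarrow> fseries" where
  "dpar a l f = (if l = 0 then fderiv (VW a) f
     else if l = 1 then rho a 1 \<star> fderiv (VR \<bar>a\<bar>) f
     else rho a 1 \<star> fderiv (VW (- a)) f)"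

definition nabla :: "nat \<Rightarrow> (var \<Rightarrow> real) \<Rightarrow> fseries \<Rightarrow> fseries" where
  "nabla g r f = (\<Sum>a\<in>{1..int g}. \<Sum>l\<le>2. Theta g r a l \<star> dpar a l f)"


section \<open>Genus \<open>g\<close> partition and 1-point functions\<close>

text \<open>
  Labels \<open>\<alpha>\<^sub>a\<close> are \<open>\<alpha> a\<close> for \<open>1 \<le> a \<le> g\<close>, labels \<open>\<beta>\<^sub>k\<close> are \<open>\<beta> k\<close> for \<open>1 \<le> k \<le> 2g-1\<close>; the outer
  labels of the chain of intertwining operators, here with indices \<open>0\<close> and \<open>2g\<close>, are that of \<open>V\<close>.
\<close>

definition admissible_labels :: "('w, 'i) rep_data \<Rightarrow> nat \<Rightarrow> (nat \<Rightarrow> 'i) \<Rightarrow> (nat \<Rightarrow> 'i) \<Rightarrow> bool" where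
  "admissible_labels D g \<alpha> \<beta> \<longleftrightarrow> (\<forall>a\<in>{1..g}. \<alpha> a \<in> labels D) \<and> (\<forall>k\<in>{1..2*g-1}. \<beta> k \<in> labels D) \<and>
     \<beta> 1 = dual D (\<alpha> 1) \<and> \<beta> (2*g-1) = dual D (\<alpha> g)"

definition ext_label :: "('w, 'i) rep_data \<Rightarrow> nat \<Rightarrow> (nat \<Rightarrow> 'i) \<Rightarrow> nat \<Rightarrow> 'i" where
  "ext_label D g \<beta> k = (if k = 0 \<or> k = 2*g then lab0 D else \<beta> k)"

text \<open>
  Here \<open>b a\<close> and \<open>b' a\<close> are the vectors inserted at \<open>w\<^sub>a\<close> and \<open>w\<^sub>-\<^sub>a\<close>; the coefficient of
  \<open>\<Prod>w\<^sub>c^(e\<^sub>c)\<close> is obtained from the modes with index \<open>-e\<^sub>c-1\<close>.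
\<close>

definition intw_chain :: "('w, 'i) rep_data \<Rightarrow> nat \<Rightarrow> (nat \<Rightarrow> 'i) \<Rightarrow> (nat \<Rightarrow> 'i)
    \<Rightarrow> (nat \<Rightarrow> 'w) \<Rightarrow> (nat \<Rightarrow> 'w) \<Rightarrow> (var \<Rightarrow> complex) \<Rightarrow> 'w" where
  "intw_chain D g \<alpha> \<beta> b b' e = (let \<beta>x = ext_label D g \<beta> in
     foldr (\<lambda>a s.
         intw D (\<beta>x (2*a-2)) (\<alpha> a) (\<beta>x (2*a-1)) (b a) (- e (VW (int a)) - 1)
           (intw D (\<beta>x (2*a-1)) (dual D (\<alpha> a)) (\<beta>x (2*a)) (b' a) (- e (VW (- int a)) - 1) s))
       [1..<Suc g] (vac (alg D)))"

definition corr0 :: "('w, 'i) rep_data \<Rightarrow> nat \<Rightarrow> (nat \<Rightarrow> 'i) \<Rightarrow> (nat \<Rightarrow> 'i)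
    \<Rightarrow> (nat \<Rightarrow> 'w) \<Rightarrow> (nat \<Rightarrow> 'w) \<Rightarrow> fseries" where
  "corr0 D g \<alpha> \<beta> b b' = (\<lambda>e. if \<forall>v. v \<notin> VW ` Iset g \<longrightarrow> e v = 0
     then form D (vac (alg D)) (intw_chain D g \<alpha> \<beta> b b' e) else 0)"

definition corr1 :: "('w::ab_group_add, 'i) rep_data \<Rightarrow> nat \<Rightarrow> (nat \<Rightarrow> 'i) \<Rightarrow> (nat \<Rightarrow> 'i)
    \<Rightarrow> 'w \<Rightarrow> (nat \<Rightarrow> 'w) \<Rightarrow> (nat \<Rightarrow> 'w) \<Rightarrow> fseries" where
  "corr1 D g \<alpha> \<beta> u b b' = (\<lambda>e. if \<forall>v. v \<notin> insert VX (VW ` Iset g) \<longrightarrow> e v = 0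
     then form D (vac (alg D))
            (cmodes (vop (alg D)) u (- e VX - 1) (intw_chain D g \<alpha> \<beta> b b' e)) else 0)"

definition rho_wt :: "('w, 'i) rep_data \<Rightarrow> nat \<Rightarrow> (nat \<Rightarrow> 'i) \<Rightarrow> (nat \<Rightarrow> 'w) \<Rightarrow> fseries" where
  "rho_wt D g \<alpha> b = fmonom (\<lambda>v. case v of
     VR a \<Rightarrow> if 1 \<le> a \<and> a \<le> int g then wt (alg D) (irr D (\<alpha> (nat a))) (b (nat a)) else 0
   | _ \<Rightarrow> 0)"

text \<open>
  \<open>B a\<close> is the basis used at the \<open>a\<close>-th handle, \<open>d a\<close> the passage to its dual basis; the factors
  \<open>\<rho>\<^sub>a^(wt b\<^sub>a)\<close> of the vectors \<open>b\<^sub>-\<^sub>a\<close> are collected in \<open>rho_wt\<close>.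
\<close>

definition partition_fun :: "('w, 'i) rep_data \<Rightarrow> nat \<Rightarrow> (nat \<Rightarrow> 'i) \<Rightarrow> (nat \<Rightarrow> 'i)
    \<Rightarrow> (nat \<Rightarrow> 'w set) \<Rightarrow> (nat \<Rightarrow> 'w \<Rightarrow> 'w) \<Rightarrow> fseries" where
  "partition_fun D g \<alpha> \<beta> B d =
     fsum (\<lambda>b. rho_wt D g \<alpha> b \<star> corr0 D g \<alpha> \<beta> b (\<lambda>a. d a (b a))) (PiE {1..g} B)"

definition one_point_fun :: "('w::ab_group_add, 'i) rep_data \<Rightarrow> nat \<Rightarrow> (nat \<Rightarrow> 'i) \<Rightarrow> (nat \<Rightarrow> 'i)
    \<Rightarrow> (nat \<Rightarrow> 'w set) \<Rightarrow> (nat \<Rightarrow> 'w \<Rightarrow> 'w) \<Rightarrow> 'w \<Rightarrow> fseries" where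
  "one_point_fun D g \<alpha> \<beta> B d u =
     fsum (\<lambda>b. rho_wt D g \<alpha> b \<star> corr1 D g \<alpha> \<beta> u b (\<lambda>a. d a (b a))) (PiE {1..g} B)"

end

theory Submission
  imports Defs
begin

text \<open>
  The identity is a formal version of Zhu recursion. Let \<open>\<omega>(n)\<close> be the modes of the conformal vector,
  \<open>G\<^sub>c\<^sup>j\<close> the genus zero correlator with \<open>\<omega>(j)\<close> applied to the vector at \<open>w\<^sub>c\<close>, and \<open>F(x)\<close> the one with
  \<open>Y(\<omega>,x)\<close> inserted.

  In genus zero, \<open>F(x)\<close> is determined by its poles at the insertion points: moving \<open>\<omega>(n)\<close> through the
  chain of intertwining operators gives \<open>F(x) = \<Sum>\<^sub>c \<Sum>\<^sub>j (1/j!) \<partial>\<^sub>y\<^sup>j (1/(x-y)) G\<^sub>c\<^sup>j\<close> at \<open>y = w\<^sub>c\<close>. The modes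
  \<open>\<omega>(0), \<omega>(1), \<omega>(2)\<close>, that is \<open>L(-1), L(0), L(1)\<close>, kill the vacuum on both sides, so that the sum
  does not change when a polynomial of degree 2 in \<open>y\<close> is added to the kernel \<open>1/(x-y)\<close>, for instance
  the one that turns it into \<open>\<pi>\<^sub>2(x,y)\<close> (lemma \<open>conf_pi2\<close>). The associativity formula gives in the same
  way the correlators with a creation mode \<open>\<omega>(-1-p)\<close> at one of the points (lemma \<open>creation_pi2\<close>).

  Now sum over the bases and call the result \<open>H\<^sub>c\<^sup>j\<close>. The adjoint of \<open>\<omega>(j)\<close> is \<open>\<omega>(2-j)\<close>, so for dual
  bases \<open>H\<^sub>c\<^sup>j = \<rho>\<^sub>c\<^sup>j\<^sup>-\<^sup>1 H\<^sub>-\<^sub>c\<^sup>2\<^sup>-\<^sup>j\<close> (lemma \<open>handle_symmetry\<close>). For \<open>j \<ge> 3\<close> the right side has a creation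
  mode, and the genus zero formula applies to it. With \<open>X\<^sub>c\<^sup>j = \<rho>\<^sub>c\<^sup>-\<^sup>j\<^sup>/\<^sup>2 H\<^sub>c\<^sup>j\<close> this is the linear system
  \<open>F = L X\<close>, \<open>X\<^sup>k\<^sup>+\<^sup>3 = (A X)\<^sup>k\<close>, and the Neumann series for \<open>I - A\<Delta>\<close> eliminates all \<open>X\<^sup>j\<close> with
  \<open>j \<ge> 3\<close> (theorem \<open>schottky_resummation\<close>). The three remaining ones are derivatives of the partition
  function: \<open>\<omega>(0)\<close> translates \<open>w\<^sub>a\<close>, \<open>\<omega>(1)\<close> multiplies by the weight, and \<open>\<omega>(2)\<close> at \<open>w\<^sub>a\<close> is, up to a
  factor \<open>\<rho>\<^sub>a\<close>, \<open>\<omega>(0)\<close> at \<open>w\<^sub>-\<^sub>a\<close> (lemma \<open>dpar_Z_series\<close>).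

  All these series are infinite, and what makes the rearrangements legitimate is one linear functional
  on exponents, \<open>degree\<close>. It gives \<open>\<rho>\<^sub>a\<close> the weight 8 and every other variable a weight in \<open>(0,1)\<close>, the
  larger the further inside the variable is in the expansion order. Every series has finitely many
  exponents below any given degree; such series form a commutative ring. The expansions of
  \<open>1/(x-y)\<close> are in this ring because the ratio of an inner to an outer variable has positive degree;
  the entries of \<open>A\<close> have degrees that grow with both indices because half a power of \<open>\<rho>\<close> outweighs
  one derivative; and the sums over the bases are in it because the exponents of a correlator are
  differences of the weights of consecutive intermediate states, so that its degree is, by partial
  summation, a combination with positive coefficients of weights that are bounded below.
\<close>

section \<open>Formal series graded by a linear functional\<close>

lemma fmonom_fmul: "(fmonom d \<star> f) e = f (e - d)"
proof -
  have "(fmonom d \<star> f) e = (\<Sum>c\<in>{d}. fmonom d c * f (e - c))"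
    unfolding fmul_def by (rule Sum_any.expand_superset) (auto simp: fmonom_def)
  then show ?thesis by (simp add: fmonom_def)
qed

lemma fmul_commute: "f \<star> h = h \<star> f"
proof
  fix e
  have "Sum_any (\<lambda>d. f d * h (e - d)) = Sum_any (\<lambda>d. h d * f (e - d))"
    by (rule Sum_any.reindex_cong[where l = "\<lambda>d. e - d"])
      (auto simp: o_def mult.commute intro: involuntory_imp_bij)
  then show "(f \<star> h) e = (h \<star> f) e" by (simp add: fmul_def)
qed

lemma fmul_fmonom: "(f \<star> fmonom d) e = f (e - d)"
  by (simp add: fmul_commute[of f] fmonom_fmul)

lemma fmonom_add: "fmonom d \<star> fmonom d' = fmonom (d + d')"
proof
  fix e
  have "e - d = d' \<longleftrightarrow> e = d + d'" by (metis add.commute diff_eq_eq)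
  then show "(fmonom d \<star> fmonom d') e = fmonom (d + d') e"
    unfolding fmonom_fmul by (simp only: fmonom_def)
qed

lemma fmul_one [simp]: "fmonom 0 \<star> f = f" "f \<star> fmonom 0 = f"
  by (auto simp: fmonom_fmul fmul_fmonom)

lemma fmul_zero [simp]: "0 \<star> f = 0" "f \<star> 0 = 0"
  by (auto simp: fmul_def fun_eq_iff)

lemma fscale_fmul: "fscale c f \<star> h = fscale c (f \<star> h)"
proof
  fix e
  show "(fscale c f \<star> h) e = fscale c (f \<star> h) e"
  proof (cases "c = 0")
    case False
    then have "{d. c * (f d * h (e - d)) \<noteq> 0} = {d. f d * h (e - d) \<noteq> 0}" by auto
    then show ?thesis
      using False by (simp add: fmul_def fscale_def mult.assoc Sum_any.expand_set sum_distrib_left)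
  qed (simp add: fmul_def fscale_def)
qed

lemma fmul_fscale: "f \<star> fscale c h = fscale c (f \<star> h)"
  by (simp add: fmul_commute[of f] fscale_fmul)

lemma fmonom_fmul_shift: "f \<star> (fmonom d \<star> k) = fmonom d \<star> (f \<star> k)"
proof
  fix e
  have "(f \<star> (fmonom d \<star> k)) e = (f \<star> k) (e - d)"
    unfolding fmul_def[of f] fmonom_fmul by (simp add: diff_diff_eq add.commute)
  then show "(f \<star> (fmonom d \<star> k)) e = (fmonom d \<star> (f \<star> k)) e" by (simp add: fmonom_fmul)
qed

lemma fmul_nonzeroE:
  assumes "(f \<star> h) e \<noteq> 0"
  obtains d where "f d \<noteq> 0" "h (e - d) \<noteq> 0"
proof -
  from assms have "Sum_any (\<lambda>d. f d * h (e - d)) \<noteq> 0" unfolding fmul_def .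
  then obtain d where "f d * h (e - d) \<noteq> 0" by (rule Sum_any.not_neutral_obtains_not_neutral)
  then show ?thesis by (intro that[of d]) auto
qed

lemma fsum_nonzeroE:
  assumes "fsum F J e \<noteq> 0"
  obtains j where "j \<in> J" "F j e \<noteq> 0"
proof -
  from assms have "Sum_any (\<lambda>j. if j \<in> J then F j e else 0) \<noteq> 0" unfolding fsum_def .
  then obtain j where "(if j \<in> J then F j e else 0) \<noteq> 0"
    by (rule Sum_any.not_neutral_obtains_not_neutral)
  then show ?thesis by (intro that[of j]) (auto split: if_splits)
qed

lemma sum_fun_app: "(\<Sum>j\<in>J. F j) e = (\<Sum>j\<in>J. (F j e :: 'b::comm_monoid_add))"
  by (induction J rule: infinite_finite_induct) auto

lemma fsum_finite_support:
  assumes "finite A" "A \<subseteq> J" "\<And>j. j \<in> J - A \<Longrightarrow> F j e = 0"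
  shows "fsum F J e = (\<Sum>j\<in>A. F j e)"
proof -
  have "fsum F J e = (\<Sum>j\<in>A. if j \<in> J then F j e else 0)"
    unfolding fsum_def by (rule Sum_any.expand_superset) (use assms in auto)
  also have "\<dots> = (\<Sum>j\<in>A. F j e)" by (rule sum.cong) (use assms in auto)
  finally show ?thesis .
qed

lemma fsum_finite: "finite J \<Longrightarrow> fsum F J = (\<Sum>j\<in>J. F j)"
  by (rule ext) (subst fsum_finite_support[of J], auto simp: sum_fun_app)

lemma fsum_cong: "J = J' \<Longrightarrow> (\<And>j. j \<in> J' \<Longrightarrow> F j = F' j) \<Longrightarrow> fsum F J = fsum F' J'"
  by (auto simp: fsum_def fun_eq_iff intro!: Sum_any.cong)

lemma fsum_reindex:
  assumes "inj_on h J" shows "fsum F (h ` J) = fsum (\<lambda>j. F (h j)) J"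
proof
  fix e
  let ?S = "{j\<in>J. F (h j) e \<noteq> 0}"
  have S: "{i. (if i \<in> h ` J then F i e else 0) \<noteq> 0} = h ` ?S" by auto
  have "inj_on h ?S" using assms by (rule inj_on_subset) auto
  then have "(\<Sum>i\<in>h ` ?S. if i \<in> h ` J then F i e else 0) = (\<Sum>j\<in>?S. F (h j) e)"
    by (subst sum.reindex) (auto intro!: sum.cong)
  moreover have "{j. (if j \<in> J then F (h j) e else 0) \<noteq> 0} = ?S" by auto
  moreover have "(\<Sum>j\<in>?S. if j \<in> J then F (h j) e else 0) = (\<Sum>j\<in>?S. F (h j) e)"
    by (rule sum.cong) auto
  ultimately show "fsum F (h ` J) e = fsum (\<lambda>j. F (h j)) J e"
    unfolding fsum_def Sum_any.expand_set S by simp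
qed

text \<open>
  Additivity makes monomials multiply by adding degrees, so lower bounds for the degrees of the
  factors of a product limit the ways to obtain a given monomial.
\<close>

locale grading =
  fixes lam :: "(var \<Rightarrow> complex) \<Rightarrow> real"
  assumes lam_add: "lam (d + e) = lam d + lam e"
begin

lemma lam_zero: "lam 0 = 0"
  using lam_add[of 0 0] by simp

lemma lam_diff: "lam (e - d) = lam e - lam d"
  using lam_add[of "e - d" d] by (simp del: fun_diff_def plus_fun_def)

definition order_ge :: "real \<Rightarrow> fseries \<Rightarrow> bool" where
  "order_ge t f \<longleftrightarrow> (\<forall>e. f e \<noteq> 0 \<longrightarrow> t \<le> lam e)"

text \<open>
  A Novikov-type finiteness condition. Since degrees of factors add up, it makes every
  coefficient of a product a finite sum.
\<close>

definition lf :: "fseries \<Rightarrow> bool" where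
  "lf f \<longleftrightarrow> (\<forall>t. finite {e. f e \<noteq> 0 \<and> lam e \<le> t})"

abbreviation below :: "('j \<Rightarrow> fseries) \<Rightarrow> 'j set \<Rightarrow> real \<Rightarrow> ('j \<times> (var \<Rightarrow> complex)) set" where
  "below F J t \<equiv> {(j, e). j \<in> J \<and> F j e \<noteq> 0 \<and> lam e \<le> t}"

text \<open>
  Summability of a family: below a given degree only finitely many monomials occur in all members
  together. Infinite sums of such a family can be rearranged and multiplied out coefficient by
  coefficient.
\<close>

definition sf :: "('j \<Rightarrow> fseries) \<Rightarrow> 'j set \<Rightarrow> bool" where
  "sf F J \<longleftrightarrow> (\<forall>t. finite (below F J t))"

lemma sfD: "sf F J \<Longrightarrow> finite (below F J t)"
  by (simp add: sf_def)

lemma sf_bounded: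
  assumes "sf F J" obtains m where "\<And>j. j \<in> J \<Longrightarrow> order_ge m (F j)"
proof -
  let ?S = "(below F J 0)"
  have fin: "finite (insert 0 ((\<lambda>p. lam (snd p)) ` ?S))" using sfD[OF assms, of 0] by simp
  define m where "m = Min (insert 0 ((\<lambda>p. lam (snd p)) ` ?S))"
  have "m \<le> lam e" if "j \<in> J" "F j e \<noteq> 0" for j e
  proof (cases "lam e \<le> 0")
    case True
    then have "lam e \<in> insert 0 ((\<lambda>p. lam (snd p)) ` ?S)" using that by force
    then show ?thesis unfolding m_def using fin by (rule Min_le[rotated])
  next
    case False
    then show ?thesis using Min_le[OF fin, of 0] by (simp add: m_def)
  qed
  then show ?thesis by (intro that[of m]) (simp add: order_ge_def)
qed

lemma sf_imp_lf: "sf F J \<Longrightarrow> j \<in> J \<Longrightarrow> lf (F j)"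
  unfolding lf_def
proof
  fix t assume a: "sf F J" "j \<in> J"
  have "{e. F j e \<noteq> 0 \<and> lam e \<le> t} \<subseteq> snd ` (below F J t)"
    using a(2) by force
  then show "finite {e. F j e \<noteq> 0 \<and> lam e \<le> t}"
    by (rule finite_subset) (rule finite_imageI[OF sfD[OF a(1)]])
qed

lemma lf_eq_sf: "lf f \<longleftrightarrow> sf (\<lambda>_. f) {()}"
proof
  assume "lf f"
  have "{(j, e). j \<in> {()} \<and> f e \<noteq> 0 \<and> lam e \<le> t} = Pair () ` {e. f e \<noteq> 0 \<and> lam e \<le> t}" for t
    by auto
  then show "sf (\<lambda>_. f) {()}" using \<open>lf f\<close> by (auto simp: sf_def lf_def)
qed (use sf_imp_lf[of "\<lambda>_. f" "{()}"] in auto)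

lemma lf_bounded:
  assumes "lf f" obtains m where "order_ge m f"
  using assms sf_bounded[of "\<lambda>_. f" "{()}"] by (auto simp: lf_eq_sf)

lemma sf_subset: "sf F J \<Longrightarrow> J' \<subseteq> J \<Longrightarrow> sf F J'"
  unfolding sf_def
proof (intro allI)
  fix t assume a: "\<forall>t. finite (below F J t)" "J' \<subseteq> J"
  show "finite (below F (J') t)"
    by (rule finite_subset[OF _ a(1)[rule_format, of t]]) (use a(2) in auto)
qed

text \<open>
  The usual source of summability: the lower bounds of the degrees tend to infinity.
\<close>

lemma sf_if_order:
  assumes "\<And>j. j \<in> J \<Longrightarrow> lf (F j)" "\<And>j. j \<in> J \<Longrightarrow> order_ge (q j) (F j)"
    and "\<And>t. finite {j\<in>J. q j \<le> t}"
  shows "sf F J"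
  unfolding sf_def
proof
  fix t
  have "(below F J t)
      \<subseteq> Sigma {j\<in>J. q j \<le> t} (\<lambda>j. {e. F j e \<noteq> 0 \<and> lam e \<le> t})"
    using assms(2) by (force simp: order_ge_def)
  then show "finite (below F J t)"
    by (rule finite_subset) (use assms(1,3) in \<open>auto simp: lf_def\<close>)
qed

lemma finite_convolution_support:
  assumes "lf f" "lf h" shows "finite {d. f d \<noteq> 0 \<and> h (e - d) \<noteq> 0}"
proof -
  obtain m where m: "order_ge m h" using assms(2) lf_bounded by blast
  have "{d. f d \<noteq> 0 \<and> h (e - d) \<noteq> 0} \<subseteq> {d. f d \<noteq> 0 \<and> lam d \<le> lam e - m}"
    using m by (force simp: order_ge_def lam_diff)
  then show ?thesis using assms(1) by (auto simp: lf_def intro: finite_subset)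
qed

lemma order_ge_fmul:
  assumes "order_ge s f" "order_ge t h" shows "order_ge (s + t) (f \<star> h)"
  unfolding order_ge_def
proof (intro allI impI)
  fix e assume "(f \<star> h) e \<noteq> 0"
  then obtain d where "f d \<noteq> 0" "h (e - d) \<noteq> 0" by (rule fmul_nonzeroE)
  then have "s \<le> lam d" "t \<le> lam (e - d)" using assms by (auto simp: order_ge_def)
  then show "s + t \<le> lam e" by (simp add: lam_diff)
qed

lemma order_ge_mono: "order_ge s f \<Longrightarrow> t \<le> s \<Longrightarrow> order_ge t f"
  by (force simp: order_ge_def)

text \<open>
  A common lower bound for the degrees of the factors shifts the degrees of the family by a
  constant only.
\<close>

lemma sf_fmul:
  assumes F: "sf F J" and K: "\<And>j. j \<in> J \<Longrightarrow> lf (K j)" "\<And>j. j \<in> J \<Longrightarrow> order_ge C (K j)"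
  shows "sf (\<lambda>j. K j \<star> F j) J"
  unfolding sf_def
proof
  fix t
  let ?P = "(below F J (t - C))"
  have "{(j, e). j \<in> J \<and> (K j \<star> F j) e \<noteq> 0 \<and> lam e \<le> t}
      \<subseteq> (\<lambda>((j, e), d). (j, e + d)) ` Sigma ?P (\<lambda>(j, e). {d. K j d \<noteq> 0 \<and> lam d \<le> t - lam e})"
  proof clarify
    fix j e assume a: "j \<in> J" "(K j \<star> F j) e \<noteq> 0" "lam e \<le> t"
    from a(2) obtain d where d: "K j d \<noteq> 0" "F j (e - d) \<noteq> 0" by (rule fmul_nonzeroE)
    then have "C \<le> lam d" using K(2)[OF a(1)] by (auto simp: order_ge_def)
    then have "((j, e - d), d) \<in> Sigma ?P (\<lambda>(j, e). {d. K j d \<noteq> 0 \<and> lam d \<le> t - lam e})"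
      using a d by (auto simp: lam_diff simp del: fun_diff_def minus_apply)
    then show "(j, e) \<in> (\<lambda>((j, e), d). (j, e + d)) ` Sigma ?P (\<lambda>(j, e). {d. K j d \<noteq> 0 \<and> lam d \<le> t - lam e})"
      by (rule rev_image_eqI) (auto simp: fun_eq_iff)
  qed
  moreover have "finite (Sigma ?P (\<lambda>(j, e). {d. K j d \<noteq> 0 \<and> lam d \<le> t - lam e}))"
    using sfD[OF F] K(1) by (intro finite_SigmaI) (auto simp: lf_def)
  ultimately show "finite {(j, e). j \<in> J \<and> (K j \<star> F j) e \<noteq> 0 \<and> lam e \<le> t}"
    by (rule finite_subset[OF _ finite_imageI])
qed

lemma sf_fmul_const: "lf k \<Longrightarrow> sf F J \<Longrightarrow> sf (\<lambda>j. k \<star> F j) J"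
proof -
  assume a: "lf k" "sf F J"
  from a(1) obtain m where "order_ge m k" by (rule lf_bounded)
  then show ?thesis using a by (intro sf_fmul[OF a(2)]) auto
qed

lemma lf_fmul: "lf f \<Longrightarrow> lf h \<Longrightarrow> lf (f \<star> h)"
  unfolding lf_eq_sf[of h] lf_eq_sf[of "f \<star> h"] by (rule sf_fmul_const)

lemma lf_fmonom: "lf (fmonom d)"
  unfolding lf_def
proof
  fix t
  have "{e. fmonom d e \<noteq> 0 \<and> lam e \<le> t} \<subseteq> {d}" by (auto simp: fmonom_def)
  then show "finite {e. fmonom d e \<noteq> 0 \<and> lam e \<le> t}" using finite_subset by blast
qed

lemma order_ge_fmonom: "order_ge (lam d) (fmonom d)"
  by (auto simp: order_ge_def fmonom_def)

lemma lf_support_subset: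
  assumes "lf f" "\<And>e. h e \<noteq> 0 \<Longrightarrow> f e \<noteq> 0" shows "lf h"
  unfolding lf_def
proof
  fix t
  have "{e. h e \<noteq> 0 \<and> lam e \<le> t} \<subseteq> {e. f e \<noteq> 0 \<and> lam e \<le> t}" using assms(2) by auto
  then show "finite {e. h e \<noteq> 0 \<and> lam e \<le> t}" using assms(1) finite_subset by (auto simp: lf_def)
qed

lemma lf_fscale: "lf f \<Longrightarrow> lf (fscale c f)"
  by (erule lf_support_subset) (auto simp: fscale_def)

lemma lf_zero: "lf 0"
  by (simp add: lf_def)

lemma lf_uminus: "lf f \<Longrightarrow> lf (- f)"
  by (erule lf_support_subset) auto

lemma order_ge_fscale: "order_ge t f \<Longrightarrow> order_ge t (fscale c f)"
  by (auto simp: order_ge_def fscale_def)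

lemma order_ge_add: "order_ge t f \<Longrightarrow> order_ge t h \<Longrightarrow> order_ge t (f + h)"
  by (force simp: order_ge_def)

lemma order_ge_uminus: "order_ge t f \<Longrightarrow> order_ge t (- f)"
  by (auto simp: order_ge_def)

lemma order_ge_diff: "order_ge t f \<Longrightarrow> order_ge t h \<Longrightarrow> order_ge t (f - h)"
  by (force simp: order_ge_def)

lemma order_ge_sum: "(\<And>j. j \<in> J \<Longrightarrow> order_ge t (F j)) \<Longrightarrow> order_ge t (\<Sum>j\<in>J. F j)"
  by (induction J rule: infinite_finite_induct) (auto intro: order_ge_add simp: order_ge_def[of _ 0])

lemma lf_add: "lf f \<Longrightarrow> lf h \<Longrightarrow> lf (f + h)"
  unfolding lf_def
proof
  fix t assume a: "\<forall>t. finite {e. f e \<noteq> 0 \<and> lam e \<le> t}" "\<forall>t. finite {e. h e \<noteq> 0 \<and> lam e \<le> t}"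
  have "{e. (f + h) e \<noteq> 0 \<and> lam e \<le> t} \<subseteq> {e. f e \<noteq> 0 \<and> lam e \<le> t} \<union> {e. h e \<noteq> 0 \<and> lam e \<le> t}"
    by auto
  then show "finite {e. (f + h) e \<noteq> 0 \<and> lam e \<le> t}"
    using a by (meson finite_UnI finite_subset)
qed

lemma lf_diff: "lf f \<Longrightarrow> lf h \<Longrightarrow> lf (f - h)"
  using lf_add[of f "- h"] lf_uminus[of h] by simp

lemma lf_sum: "(\<And>j. j \<in> J \<Longrightarrow> lf (F j)) \<Longrightarrow> lf (\<Sum>j\<in>J. F j)"
  by (induction J rule: infinite_finite_induct) (auto intro: lf_add lf_zero)

lemma fmul_add_right: "lf f \<Longrightarrow> lf h \<Longrightarrow> lf k \<Longrightarrow> f \<star> (h + k) = f \<star> h + f \<star> k"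
proof
  fix e assume a: "lf f" "lf h" "lf k"
  have "finite {d. f d * h (e - d) \<noteq> 0}" "finite {d. f d * k (e - d) \<noteq> 0}"
    using finite_convolution_support a by simp_all
  then show "(f \<star> (h + k)) e = (f \<star> h + f \<star> k) e"
    by (simp add: fmul_def distrib_left Sum_any.distrib)
qed

lemma fmul_uminus_right: "f \<star> (- h) = - (f \<star> h)"
  using fmul_fscale[of f "-1" h] by (simp add: fscale_def fun_Compl_def)

lemma fmul_diff_right: "lf f \<Longrightarrow> lf h \<Longrightarrow> lf k \<Longrightarrow> f \<star> (h - k) = f \<star> h - f \<star> k"
  using fmul_add_right[of f h "- k"] fmul_uminus_right[of f k] lf_uminus[of k] by simp

lemma fmul_add_left: "lf f \<Longrightarrow> lf h \<Longrightarrow> lf k \<Longrightarrow> (h + k) \<star> f = h \<star> f + k \<star> f"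
  using fmul_add_right by (simp add: fmul_commute[of _ f])

lemma fmul_diff_left: "lf f \<Longrightarrow> lf h \<Longrightarrow> lf k \<Longrightarrow> (h - k) \<star> f = h \<star> f - k \<star> f"
  using fmul_diff_right by (simp add: fmul_commute[of _ f])

lemma fmul_sum_right:
  "lf f \<Longrightarrow> (\<And>j. j \<in> J \<Longrightarrow> lf (F j)) \<Longrightarrow> f \<star> (\<Sum>j\<in>J. F j) = (\<Sum>j\<in>J. f \<star> F j)"
  by (induction J rule: infinite_finite_induct) (auto simp: fmul_add_right lf_sum)

lemma sf_finite_index: "sf F J \<Longrightarrow> finite {j\<in>J. F j e \<noteq> 0}"
proof -
  assume a: "sf F J"
  have "{j\<in>J. F j e \<noteq> 0} \<subseteq> fst ` (below F J (lam e))" by force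
  then show ?thesis by (rule finite_subset) (rule finite_imageI[OF sfD[OF a]])
qed

lemma fmul_fsum:
  assumes f: "lf f" and H: "sf H J"
  shows "f \<star> fsum H J = fsum (\<lambda>j. f \<star> H j) J"
proof
  fix e
  define G where "G j d = (if j \<in> J then f d * H j (e - d) else 0)" for j d
  obtain m where m: "order_ge m f" using f lf_bounded by blast
  let ?P = "(below H J (lam e - m))"
  have fP: "finite ?P" by (rule sfD[OF H])
  have P: "(j, e - d) \<in> ?P" if "G j d \<noteq> 0" for j d
    using that m by (auto simp: G_def order_ge_def lam_diff simp del: fun_diff_def minus_apply split: if_splits)
  have "(f \<star> fsum H J) e = Sum_any (\<lambda>d. Sum_any (\<lambda>j. G j d))"
    unfolding fmul_def
  proof (rule Sum_any.cong)
    fix d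
    have "finite {j. (if j \<in> J then H j (e - d) else 0) \<noteq> 0}"
      by (rule finite_subset[OF _ sf_finite_index[OF H, of "e - d"]]) auto
    then have "f d * Sum_any (\<lambda>j. if j \<in> J then H j (e - d) else 0)
        = Sum_any (\<lambda>j. f d * (if j \<in> J then H j (e - d) else 0))"
      by (rule Sum_any_right_distrib)
    then show "f d * fsum H J (e - d) = Sum_any (\<lambda>j. G j d)"
      by (simp add: fsum_def G_def if_distrib cong: if_cong)
  qed
  also have "\<dots> = Sum_any (\<lambda>j. Sum_any (\<lambda>d. G j d))"
  proof (rule Sum_any.swap)
    show "finite ((\<lambda>p. e - snd p) ` ?P \<times> fst ` ?P)" using fP by blast
    show "{d. \<exists>j. G j d \<noteq> 0} \<times> {j. \<exists>d. G j d \<noteq> 0} \<subseteq> (\<lambda>p. e - snd p) ` ?P \<times> fst ` ?P"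
    proof (rule Sigma_mono; clarify)
      fix d j assume "G j d \<noteq> 0"
      then show "d \<in> (\<lambda>p. e - snd p) ` ?P" by (intro image_eqI[OF _ P]) auto
      show "j \<in> fst ` ?P" by (rule image_eqI[OF _ P[OF \<open>G j d \<noteq> 0\<close>]]) simp
    qed
  qed
  also have "\<dots> = fsum (\<lambda>j. f \<star> H j) J e"
    unfolding fsum_def by (rule Sum_any.cong) (auto simp: G_def fmul_def)
  finally show "(f \<star> fsum H J) e = fsum (\<lambda>j. f \<star> H j) J e" .
qed

lemma sf_fsum:
  assumes "sf F (J \<times> K)" shows "sf (\<lambda>j. fsum (\<lambda>k. F (j, k)) K) J"
  unfolding sf_def
proof
  fix t
  have "{(j, e). j \<in> J \<and> fsum (\<lambda>k. F (j, k)) K e \<noteq> 0 \<and> lam e \<le> t}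
      \<subseteq> (\<lambda>((j, k), e). (j, e)) ` (below F (J \<times> K) t)"
  proof clarify
    fix j e assume a: "j \<in> J" "fsum (\<lambda>k. F (j, k)) K e \<noteq> 0" "lam e \<le> t"
    from a(2) obtain k where "k \<in> K" "F (j, k) e \<noteq> 0" by (rule fsum_nonzeroE)
    then have "((j, k), e) \<in> (below F (J \<times> K) t)" using a by simp
    then show "(j, e) \<in> (\<lambda>((j, k), e). (j, e)) ` (below F (J \<times> K) t)"
      by (rule rev_image_eqI) simp
  qed
  then show "finite {(j, e). j \<in> J \<and> fsum (\<lambda>k. F (j, k)) K e \<noteq> 0 \<and> lam e \<le> t}"
    by (rule finite_subset) (rule finite_imageI[OF sfD[OF assms]])
qed

lemma fsum_Times:
  assumes "sf F (J \<times> K)"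
  shows "fsum (\<lambda>j. fsum (\<lambda>k. F (j, k)) K) J = fsum F (J \<times> K)"
proof
  fix e
  let ?P = "{p \<in> J \<times> K. F p e \<noteq> 0}"
  have fP: "finite ?P" by (rule sf_finite_index[OF assms])
  have "fsum (\<lambda>k. F (j, k)) K e = (\<Sum>k\<in>snd ` ?P. F (j, k) e)" if "j \<in> J" for j
    using fP that by (intro fsum_finite_support) (auto simp: image_iff)
  moreover have "fsum (\<lambda>j. fsum (\<lambda>k. F (j, k)) K) J e = (\<Sum>j\<in>fst ` ?P. fsum (\<lambda>k. F (j, k)) K e)"
  proof (intro fsum_finite_support)
    fix j assume j: "j \<in> J - fst ` ?P"
    show "fsum (\<lambda>k. F (j, k)) K e = 0"
    proof (rule ccontr)
      assume "fsum (\<lambda>k. F (j, k)) K e \<noteq> 0"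
      then obtain k where "k \<in> K" "F (j, k) e \<noteq> 0" by (rule fsum_nonzeroE)
      then have "(j, k) \<in> ?P" using j by simp
      then have "j \<in> fst ` ?P" by (rule rev_image_eqI) simp
      with j show False by simp
    qed
  qed (use fP in auto)
  ultimately have "fsum (\<lambda>j. fsum (\<lambda>k. F (j, k)) K) J e
      = (\<Sum>j\<in>fst ` ?P. \<Sum>k\<in>snd ` ?P. F (j, k) e)"
    by (auto intro!: sum.cong)
  also have "\<dots> = (\<Sum>p\<in>fst ` ?P \<times> snd ` ?P. F p e)"
    by (simp add: sum.cartesian_product)
  also have "\<dots> = fsum F (J \<times> K) e"
  proof (intro fsum_finite_support[symmetric])
    fix p assume p: "p \<in> J \<times> K - fst ` ?P \<times> snd ` ?P"
    show "F p e = 0"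
    proof (rule ccontr)
      assume "F p e \<noteq> 0"
      then have "p \<in> ?P" using p by simp
      then have "fst p \<in> fst ` ?P" "snd p \<in> snd ` ?P" by (rule imageI)+
      with p show False by (cases p) simp
    qed
  qed (use fP in auto)
  finally show "fsum (\<lambda>j. fsum (\<lambda>k. F (j, k)) K) J e = fsum F (J \<times> K) e" .
qed

lemma sf_swap: "sf F (J \<times> K) \<Longrightarrow> sf (\<lambda>(k, j). F (j, k)) (K \<times> J)"
  unfolding sf_def
proof
  fix t assume a: "\<forall>t. finite (below F (J \<times> K) t)"
  have "{(q, e). q \<in> K \<times> J \<and> (case q of (k, j) \<Rightarrow> F (j, k)) e \<noteq> 0 \<and> lam e \<le> t}
     \<subseteq> (\<lambda>((j, k), e). ((k, j), e)) ` (below F (J \<times> K) t)"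
    by force
  then show "finite {(q, e). q \<in> K \<times> J \<and> (case q of (k, j) \<Rightarrow> F (j, k)) e \<noteq> 0 \<and> lam e \<le> t}"
    using a by (meson finite_imageI finite_subset)
qed

lemma fsum_swap:
  assumes "sf F (J \<times> K)"
  shows "fsum (\<lambda>j. fsum (\<lambda>k. F (j, k)) K) J = fsum (\<lambda>k. fsum (\<lambda>j. F (j, k)) J) K"
proof -
  have "fsum F (J \<times> K) = fsum F (prod.swap ` (K \<times> J))" by (simp only: product_swap)
  also have "\<dots> = fsum (\<lambda>(k, j). F (j, k)) (K \<times> J)"
    by (subst fsum_reindex) (auto intro!: fsum_cong)
  finally show ?thesis
    using fsum_Times[OF assms] fsum_Times[OF sf_swap[OF assms]] by simp
qed

lemma lf_fsum: "sf F J \<Longrightarrow> lf (fsum F J)"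
proof -
  assume a: "sf F J"
  have "sf (\<lambda>(u, j). F j) ({()} \<times> J)" unfolding sf_def
  proof
    fix t
    have "{(p, e). p \<in> {()} \<times> J \<and> (case p of (u, j) \<Rightarrow> F j) e \<noteq> 0 \<and> lam e \<le> t}
      = (\<lambda>(j, e). (((), j), e)) ` (below F J t)" by force
    then show "finite {(p, e). p \<in> {()} \<times> J \<and> (case p of (u, j) \<Rightarrow> F j) e \<noteq> 0 \<and> lam e \<le> t}"
      using sfD[OF a] by simp
  qed
  from sf_fsum[OF this] show ?thesis by (simp add: lf_eq_sf)
qed

lemma order_ge_fsum: "(\<And>j. j \<in> J \<Longrightarrow> order_ge t (F j)) \<Longrightarrow> order_ge t (fsum F J)"
  unfolding order_ge_def by (auto elim!: fsum_nonzeroE)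

lemma fsum_add:
  assumes "sf F J" "sf H J" shows "fsum (\<lambda>j. F j + H j) J = fsum F J + fsum H J"
proof
  fix e
  have f: "finite {j. (if j \<in> J then F j e else 0) \<noteq> 0}"
    by (rule finite_subset[OF _ sf_finite_index[OF assms(1), of e]]) (auto split: if_splits)
  have f': "finite {j. (if j \<in> J then H j e else 0) \<noteq> 0}"
    by (rule finite_subset[OF _ sf_finite_index[OF assms(2), of e]]) (auto split: if_splits)
  have "fsum (\<lambda>j. F j + H j) J e
      = Sum_any (\<lambda>j. (if j \<in> J then F j e else 0) + (if j \<in> J then H j e else 0))"
    unfolding fsum_def by (rule Sum_any.cong) auto
  also have "\<dots> = (fsum F J + fsum H J) e" using f f' by (simp add: Sum_any.distrib fsum_def)
  finally show "fsum (\<lambda>j. F j + H j) J e = (fsum F J + fsum H J) e" .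
qed

lemma fsum_insert:
  assumes "sf F (insert j J)" "j \<notin> J" shows "fsum F (insert j J) = F j + fsum F J"
proof
  fix e
  let ?A = "{i\<in>J. F i e \<noteq> 0}"
  have f: "finite ?A" by (rule sf_finite_index[OF sf_subset[OF assms(1)]]) auto
  have "fsum F (insert j J) e = (\<Sum>i\<in>insert j ?A. F i e)"
    using f by (intro fsum_finite_support) auto
  moreover have "fsum F J e = (\<Sum>i\<in>?A. F i e)"
    using f by (intro fsum_finite_support) auto
  ultimately show "fsum F (insert j J) e = (F j + fsum F J) e"
    using f assms(2) by simp
qed

text \<open>
  This gives associativity, because the product is commutative. The series \<open>h\<close> is the sum of its
  monomials, and multiplication by a monomial shifts exponents, which commutes with everything.
\<close>

lemma fmul_left_commute:
  assumes "lf f" "lf h" "lf k" shows "f \<star> (h \<star> k) = h \<star> (f \<star> k)"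
proof -
  have sm: "sf (\<lambda>d. fscale (h d) (fmonom d)) UNIV"
    unfolding sf_def
  proof
    fix t
    have "{(d, e). d \<in> UNIV \<and> fscale (h d) (fmonom d) e \<noteq> 0 \<and> lam e \<le> t}
       \<subseteq> (\<lambda>d. (d, d)) ` {d. h d \<noteq> 0 \<and> lam d \<le> t}"
      by (auto simp: fscale_def fmonom_def split: if_splits)
    then show "finite {(d, e). d \<in> UNIV \<and> fscale (h d) (fmonom d) e \<noteq> 0 \<and> lam e \<le> t}"
      using assms(2) unfolding lf_def by (meson finite_imageI finite_subset)
  qed
  have exp: "h \<star> x = fsum (\<lambda>d. x \<star> fscale (h d) (fmonom d)) UNIV" for x
    unfolding fmul_fscale by (rule ext) (simp add: fsum_def fmul_def[of h] fscale_def[of _ "x \<star> _"] fmul_fmonom)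
  have "f \<star> (h \<star> k) = fsum (\<lambda>d. f \<star> (k \<star> fscale (h d) (fmonom d))) UNIV"
    unfolding exp[of k] by (rule fmul_fsum[OF assms(1) sf_fmul_const[OF assms(3) sm]])
  also have "\<dots> = fsum (\<lambda>d. (f \<star> k) \<star> fscale (h d) (fmonom d)) UNIV"
    by (rule fsum_cong)
      (auto simp: fmul_fscale fmul_commute[of _ "fmonom _"] fmonom_fmul_shift)
  also have "\<dots> = h \<star> (f \<star> k)" by (simp add: exp)
  finally show ?thesis .
qed

lemma fmul_assoc:
  assumes "lf f" "lf h" "lf k" shows "(f \<star> h) \<star> k = f \<star> (h \<star> k)"
  using fmul_left_commute[of k f h] assms by (simp add: fmul_commute[of _ k] fmul_commute[of h k])

end

section \<open>Monomials, derivatives and geometric series\<close>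

definition single :: "var \<Rightarrow> complex \<Rightarrow> var \<Rightarrow> complex" where
  "single v s = (\<lambda>u. if u = v then s else 0)"

lemma single_app [simp]: "single v s v = s" "u \<noteq> v \<Longrightarrow> single v s u = 0"
  by (auto simp: single_def)

lemma single_add: "single v s + single v t = single v (s + t)"
  and single_diff: "single v s - single v t = single v (s - t)"
  and single_uminus: "- single v s = single v (- s)"
  and single_zero [simp]: "single v 0 = 0"
  by (auto simp: single_def fun_eq_iff)

lemma vpow_single: "vpow v s = fmonom (single v s)"
  by (simp add: vpow_def single_def)

lemma rho_single: "rho a s = fmonom (single (VR \<bar>a\<bar>) s)"
  by (simp add: rho_def vpow_single)

lemma vpow_add: "vpow v s \<star> vpow v t = vpow v (s + t)"
  by (simp add: vpow_single fmonom_add single_add)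

lemma vpow_zero [simp]: "vpow v 0 = fmonom 0"
  by (simp add: vpow_single)

lemma fderiv_pow:
  "(fderiv v ^^ i) f e = pochhammer (e v + 1) i * f (e + single v (of_nat i))"
proof (induction i arbitrary: e)
  case 0
  then show ?case by (simp add: single_def plus_fun_def)
next
  case (Suc i)
  have 1: "e(v := e v + 1) + single v (of_nat i) = e + single v (of_nat (Suc i))"
    by (auto simp: fun_eq_iff single_def)
  have "(fderiv v ^^ Suc i) f e = (e v + 1) * (fderiv v ^^ i) f (e(v := e v + 1))"
    by (simp add: fderiv_def)
  also have "\<dots> = pochhammer (e v + 1) (Suc i) * f (e + single v (of_nat (Suc i)))"
    unfolding Suc 1 by (simp add: pochhammer_rec)
  finally show ?case .
qed

lemma pochhammer_over_fact: "pochhammer (a + 1) i / fact i = ((a + of_nat i) gchoose i :: complex)"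
  unfolding gbinomial_pochhammer' by simp

lemma dderiv_coeff:
  assumes "u \<noteq> v"
  shows "dderiv u i v j f e = ((e u + of_nat i) gchoose i) * ((e v + of_nat j) gchoose j)
    * f (e + single u (of_nat i) + single v (of_nat j))"
  unfolding dderiv_def fscale_def fderiv_pow pochhammer_over_fact[symmetric]
  using assms by (simp add: mult_ac)

lemma Sum_any_inj:
  assumes "inj p" "\<And>d. d \<notin> range p \<Longrightarrow> g d = 0"
  shows "Sum_any g = Sum_any (\<lambda>k. g (p k))"
proof -
  have "{d. g d \<noteq> 0} = p ` {k. g (p k) \<noteq> 0}" 
  proof (intro subset_antisym subsetI)
    fix d assume "d \<in> {d. g d \<noteq> 0}"
    moreover from this obtain k where "d = p k" using assms(2)[of d] by auto
    ultimately show "d \<in> p ` {k. g (p k) \<noteq> 0}" by simp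
  qed auto
  moreover have "inj_on p {k. g (p k) \<noteq> 0}" using assms(1) by (rule inj_on_subset) simp
  ultimately show ?thesis by (simp add: Sum_any.expand_set sum.reindex)
qed

text \<open>
  A series whose exponents are parametrized by an injection \<open>p\<close> acts by a single sum of shifts.
\<close>

lemma fmul_monomial_series:
  assumes "inj p" "\<And>k. S (p k) = a k" "\<And>d. d \<notin> range p \<Longrightarrow> S d = 0"
  shows "(S \<star> G) e = Sum_any (\<lambda>k. a k * G (e - p k))"
  unfolding fmul_def by (subst Sum_any_inj[OF assms(1)]) (auto simp: assms)

text \<open>
  The expansion of \<open>1/(u-v)\<close> for \<open>\<bar>u\<bar> > \<bar>v\<bar>\<close>.
\<close>

definition geom :: "var \<Rightarrow> var \<Rightarrow> fseries" where
  "geom u v = fsum (\<lambda>k::nat. vpow u (- 1 - of_nat k) \<star> vpow v (of_nat k)) UNIV"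

lemma inv_diff_geom: "inv_diff r u v = (if r u > r v then geom u v else - geom v u)"
  by (simp add: inv_diff_def geom_def)

definition geom_exp :: "var \<Rightarrow> var \<Rightarrow> nat \<Rightarrow> var \<Rightarrow> complex" where
  "geom_exp u v k = single u (- 1 - of_nat k) + single v (of_nat k)"

lemma geom_exp_app: "u \<noteq> v \<Longrightarrow> geom_exp u v k u = - 1 - of_nat k"
  "u \<noteq> v \<Longrightarrow> geom_exp u v k v = of_nat k" "w \<noteq> u \<Longrightarrow> w \<noteq> v \<Longrightarrow> geom_exp u v k w = 0"
  by (auto simp: geom_exp_def)

lemma inj_geom_exp: "u \<noteq> v \<Longrightarrow> inj (geom_exp u v)"
  by (rule injI) (metis geom_exp_app(2) of_nat_eq_iff)

lemma geom_fsum: "geom u v = fsum (\<lambda>k. fmonom (geom_exp u v k)) UNIV"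
  by (simp add: geom_def vpow_single fmonom_add geom_exp_def)

lemma geom_coeff:
  assumes "u \<noteq> v"
  shows "geom u v (geom_exp u v k) = 1" "d \<notin> range (geom_exp u v) \<Longrightarrow> geom u v d = 0"
proof -
  have "geom u v (geom_exp u v k) = (\<Sum>j\<in>{k}. fmonom (geom_exp u v j) (geom_exp u v k))"
    unfolding geom_fsum by (rule fsum_finite_support)
      (auto simp: fmonom_def inj_eq[OF inj_geom_exp[OF assms]])
  then show "geom u v (geom_exp u v k) = 1" by (simp add: fmonom_def)
next
  assume "d \<notin> range (geom_exp u v)"
  then show "geom u v d = 0" unfolding geom_fsum
    by (subst fsum_finite_support[of "{}"]) (auto simp: fmonom_def)
qed

text \<open>
  The coefficients are those of the derivatives of \<open>x^(-1-k) y^k\<close>. They are to be compared with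
  the binomial coefficients in the commutator and associativity formulas.
\<close>

lemma dderiv_geom_fmul:
  assumes "x \<noteq> y"
  shows "(dderiv x m y j (geom x y) \<star> G) e = Sum_any (\<lambda>k::nat. ((- 1 - of_nat k) gchoose m)
      * (of_nat k gchoose j) * G (e + single x (1 + of_nat k + of_nat m) - single y (of_nat k - of_nat j)))"
    (is "_ = Sum_any ?t")
proof -
  let ?s = "single x (of_nat m) + single y (of_nat j)"
  define p where "p k = geom_exp x y k - ?s" for k
  have e: "p k + single x (of_nat m) + single y (of_nat j) = geom_exp x y k" for k
    by (simp add: p_def add.assoc)
  have px: "p k x = - 1 - of_nat k - of_nat m" "p k y = of_nat k - of_nat j" for k
    using assms by (simp_all add: p_def geom_exp_app)
  have "(dderiv x m y j (geom x y) \<star> G) e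
      = Sum_any (\<lambda>k::nat. ((- 1 - of_nat k) gchoose m) * (of_nat k gchoose j) * G (e - p k))"
  proof (rule fmul_monomial_series)
    show "inj p" using inj_geom_exp[OF assms] by (simp add: inj_def p_def)
    show "dderiv x m y j (geom x y) (p k) = ((- 1 - of_nat k) gchoose m) * (of_nat k gchoose j)" for k
      unfolding dderiv_coeff[OF assms] e by (simp add: px geom_coeff[OF assms])
  next
    fix d assume d: "d \<notin> range p"
    have "d + single x (of_nat m) + single y (of_nat j) \<notin> range (geom_exp x y)"
    proof
      assume "d + single x (of_nat m) + single y (of_nat j) \<in> range (geom_exp x y)"
      then obtain k where "d + single x (of_nat m) + single y (of_nat j) = geom_exp x y k" by blast
      then have "d = p k" by (metis add.assoc add_diff_cancel_right' p_def)
      with d show False by blast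
    qed
    then show "dderiv x m y j (geom x y) d = 0"
      unfolding dderiv_coeff[OF assms] by (simp add: geom_coeff[OF assms])
  qed
  moreover have "e - p k = e + single x (1 + of_nat k + of_nat m) - single y (of_nat k - of_nat j)" for k
    using assms by (auto simp: fun_eq_iff p_def geom_exp_def single_def)
  ultimately show ?thesis by simp
qed

lemma dderiv_swap: "u \<noteq> v \<Longrightarrow> dderiv u i v j f = dderiv v j u i f"
  by (rule ext) (simp add: dderiv_coeff add.assoc add.commute[of "single u _"])

lemma dderiv_uminus: "u \<noteq> v \<Longrightarrow> dderiv u i v j (- f) = - dderiv u i v j f"
  by (rule ext) (simp add: dderiv_coeff)

lemma dderiv_add: "u \<noteq> v \<Longrightarrow> dderiv u i v j (f + h) = dderiv u i v j f + dderiv u i v j h"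
  by (rule ext) (simp add: dderiv_coeff algebra_simps del: plus_fun_def)

lemma dderiv_sum: "u \<noteq> v \<Longrightarrow> dderiv u i v j (\<Sum>l\<in>A. F l) = (\<Sum>l\<in>A. dderiv u i v j (F l))"
  by (induction A rule: infinite_finite_induct) (auto simp: dderiv_add, auto simp: fun_eq_iff dderiv_coeff)

definition indep_of :: "var \<Rightarrow> fseries \<Rightarrow> bool" where
  "indep_of v f \<longleftrightarrow> (\<forall>e. f e \<noteq> 0 \<longrightarrow> e v = 0)"

lemma dderiv_indep_fmul_vpow:
  assumes "x \<noteq> y" "indep_of y f"
  shows "dderiv x m y j (f \<star> vpow y (of_nat l))
    = fscale (of_nat (l choose j)) (fscale (1 / fact m) ((fderiv x ^^ m) f) \<star> vpow y (of_nat l - of_nat j))"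
proof
  fix e
  let ?d = "e + single x (of_nat m) - single y (of_nat l - of_nat j)"
  have d: "e + single x (of_nat m) + single y (of_nat j) - single y (of_nat l) = ?d"
    "e - single y (of_nat l - of_nat j) + single x (of_nat m) = ?d"
    by (auto simp: fun_eq_iff single_def)
  have "f ?d = 0" if "e y \<noteq> of_nat l - of_nat j"
    using that assms by (auto simp: indep_of_def)
  then show "dderiv x m y j (f \<star> vpow y (of_nat l)) e = fscale (of_nat (l choose j))
      (fscale (1 / fact m) ((fderiv x ^^ m) f) \<star> vpow y (of_nat l - of_nat j)) e"
    using assms(1)
    unfolding dderiv_coeff[OF assms(1)] vpow_single fmul_fmonom fscale_def fderiv_pow d
    by (cases "e y = of_nat l - of_nat j")
      (simp_all add: pochhammer_over_fact[symmetric] binomial_gbinomial gbinomial_pochhammer' mult_ac)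
qed

lemma indep_of_fmul: "indep_of v f \<Longrightarrow> indep_of v h \<Longrightarrow> indep_of v (f \<star> h)"
  unfolding indep_of_def by (auto elim!: fmul_nonzeroE)

lemma indep_of_add: "indep_of v f \<Longrightarrow> indep_of v h \<Longrightarrow> indep_of v (f + h)"
  unfolding indep_of_def by (metis add_0 plus_fun_apply)

lemma indep_of_uminus: "indep_of v f \<Longrightarrow> indep_of v (- f)"
  unfolding indep_of_def by simp

lemma indep_of_diff: "indep_of v f \<Longrightarrow> indep_of v h \<Longrightarrow> indep_of v (f - h)"
  using indep_of_add[of v f "- h"] indep_of_uminus by simp

lemma indep_of_vpow: "u \<noteq> v \<Longrightarrow> indep_of v (vpow u s)"
  by (auto simp: indep_of_def vpow_single fmonom_def)

lemma indep_of_geom: "u \<noteq> v \<Longrightarrow> w \<noteq> v \<Longrightarrow> indep_of v (geom u w)"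
  unfolding indep_of_def geom_fsum
  by (auto elim!: fsum_nonzeroE simp: fmonom_def geom_exp_app split: if_splits)

lemma indep_of_inv_diff: "u \<noteq> v \<Longrightarrow> w \<noteq> v \<Longrightarrow> indep_of v (inv_diff r u w)"
  by (simp add: inv_diff_geom indep_of_geom indep_of_uminus)

context grading begin

lemma lf_vpow: "lf (vpow v s)"
  by (simp add: vpow_single lf_fmonom)

lemmas lf_intros = lf_fmul lf_add lf_diff lf_uminus lf_fscale lf_vpow lf_fmonom

lemma lf_dderiv: "u \<noteq> v \<Longrightarrow> lf f \<Longrightarrow> lf (dderiv u i v j f)"
  by (rule lf_support_subset[of "fmonom (- (single u (of_nat i) + single v (of_nat j))) \<star> f"])
    (auto intro: lf_intros simp: fmonom_fmul dderiv_coeff add.assoc simp del: minus_add_distrib)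

lemma order_ge_dderiv:
  assumes "u \<noteq> v" "order_ge t f"
  shows "order_ge (t - lam (single u (of_nat i)) - lam (single v (of_nat j))) (dderiv u i v j f)"
  unfolding order_ge_def
proof (intro allI impI)
  fix e assume "dderiv u i v j f e \<noteq> 0"
  then have "f (e + single u (of_nat i) + single v (of_nat j)) \<noteq> 0"
    by (auto simp: dderiv_coeff[OF assms(1)])
  then have "t \<le> lam (e + single u (of_nat i) + single v (of_nat j))"
    using assms(2) by (simp add: order_ge_def)
  then show "t - lam (single u (of_nat i)) - lam (single v (of_nat j)) \<le> lam e"
    by (simp add: lam_add)
qed

text \<open>
  To be used with \<open>D = x - y\<close>, \<open>I = 1/(x-y)\<close> and \<open>p\<^sub>l = 1/(x - A\<^sub>l)\<close>. Each factor \<open>(y - A\<^sub>l)/(x -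
  A\<^sub>l)\<close> is \<open>1 - D p\<^sub>l\<close>, so multiplying out cancels the pole in all terms but the first.
\<close>

lemma pi2_product_expansion:
  assumes "lf I" "lf D" "lf p0" "lf p1" "lf p2" and ID: "I \<star> D = fmonom 0"
  shows "I \<star> (fmonom 0 - D \<star> p0) \<star> (fmonom 0 - D \<star> p1) \<star> (fmonom 0 - D \<star> p2)
    = I - (p0 + p1 + p2) + D \<star> (p0 \<star> p1 + p0 \<star> p2 + p1 \<star> p2) - D \<star> (D \<star> (p0 \<star> (p1 \<star> p2)))"
proof -
  have c: "I \<star> (D \<star> p) = p" "D \<star> (I \<star> p) = p" if "lf p" for p
    using fmul_assoc[of I D p] fmul_left_commute[of D I p] that assms by simp_all
  note ring = fmul_diff_right fmul_diff_left fmul_add_left lf_intros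
  have 1: "I \<star> (fmonom 0 - D \<star> p0) = I - p0"
    using assms by (simp add: ring c)
  have 2: "(I - p0) \<star> (fmonom 0 - D \<star> p1) = I - p0 - p1 + D \<star> (p0 \<star> p1)"
    using assms fmul_left_commute[of p0 D p1] by (simp add: ring c)
  have 3: "(I - p0 - p1 + D \<star> (p0 \<star> p1)) \<star> (fmonom 0 - D \<star> p2)
      = (I - p0 - p1 + D \<star> (p0 \<star> p1)) - (p2 - D \<star> (p0 \<star> p2) - D \<star> (p1 \<star> p2) + D \<star> (D \<star> (p0 \<star> (p1 \<star> p2))))"
    using assms fmul_left_commute[of p0 D p2] fmul_left_commute[of p1 D p2]
      fmul_left_commute[of p0 D "p1 \<star> p2"] fmul_left_commute[of p1 D p2]
    by (simp add: ring c fmul_assoc)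
  show ?thesis
    unfolding 1 2 3 using assms by (simp add: fmul_add_right lf_intros algebra_simps)
qed

end

section \<open>The expansion of the kernel\<close>

locale expansion =
  fixes g :: nat and r :: "var \<Rightarrow> real"
  assumes order: "expansion_order g r"
begin

text \<open>
  The variables other than the \<open>\<rho>\<^sub>a\<close>.
\<close>

definition points :: "var set" where
  "points = {VX, VY} \<union> VW ` Iset g \<union> VA ` {..2}"

definition vars :: "var set" where
  "vars = points \<union> VR ` {1..int g}"

text \<open>
  The bounded decreasing function of the rank makes \<open>v/u\<close> of positive degree when \<open>\<bar>u\<bar> > \<bar>v\<bar>\<close>,
  while no point variable weighs more than 1. The weight 8 of \<open>\<rho>\<^sub>a\<close> gives 4 for each half power,
  which outweighs the loss of at most 1 per derivative; the kernel itself has degree at least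
  \<open>-4\<close>.
\<close>

definition wgt :: "var \<Rightarrow> real" where
  "wgt v = (case v of VR _ \<Rightarrow> 8 | _ \<Rightarrow> 1 / (1 + exp (r v)))"

definition degree :: "(var \<Rightarrow> complex) \<Rightarrow> real" where
  "degree e = (\<Sum>v\<in>vars. wgt v * Re (e v))"

lemma degree_add: "degree (d + e) = degree d + degree e"
  by (simp add: degree_def distrib_left sum.distrib)

sublocale grading degree
  by unfold_locales (rule degree_add)

lemma finite_Iset: "finite (Iset g)"
  by (rule finite_subset[of _ "{- int g..int g}"]) (auto simp: Iset_def)

lemma finite_vars: "finite vars"
  by (simp add: vars_def points_def finite_Iset)

lemma degree_single: "v \<in> vars \<Longrightarrow> degree (single v s) = wgt v * Re s"
proof -
  assume v: "v \<in> vars"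
  have "degree (single v s) = (\<Sum>u\<in>vars. if u = v then wgt v * Re s else 0)"
    unfolding degree_def by (rule sum.cong) (auto simp: single_def)
  then show ?thesis using v finite_vars by simp
qed

lemma wgt_point: "v \<in> points \<Longrightarrow> wgt v = 1 / (1 + exp (r v))"
  by (auto simp: points_def wgt_def)

lemma wgt_bounds: "v \<in> points \<Longrightarrow> 0 < wgt v" "v \<in> points \<Longrightarrow> wgt v < 1"
  by (simp_all add: wgt_point add_pos_pos)

lemma wgt_antimono: "u \<in> points \<Longrightarrow> v \<in> points \<Longrightarrow> r v < r u \<Longrightarrow> wgt u < wgt v"
  by (simp add: wgt_point add_pos_pos frac_less2)

lemma wgt_VR: "wgt (VR a) = 8"
  by (simp add: wgt_def)

lemma VR_vars: "a \<in> Iset g \<Longrightarrow> VR \<bar>a\<bar> \<in> vars"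
  by (auto simp: Iset_def vars_def)

lemma points_vars: "v \<in> points \<Longrightarrow> v \<in> vars"
  by (simp add: vars_def)

lemma points_simps [simp]: "VX \<in> points" "VY \<in> points" "a \<in> Iset g \<Longrightarrow> VW a \<in> points"
  "l \<le> 2 \<Longrightarrow> VA l \<in> points"
  by (auto simp: points_def)

lemma Iset_uminus: "a \<in> Iset g \<Longrightarrow> - a \<in> Iset g"
  by (simp add: Iset_def)

lemma r_inj: "r u = r v \<longleftrightarrow> u = v"
  using order by (auto simp: expansion_order_def inj_def)

lemma degree_geom_exp:
  "u \<in> points \<Longrightarrow> v \<in> points \<Longrightarrow> degree (geom_exp u v k) = - wgt u + (wgt v - wgt u) * real k"
  unfolding geom_exp_def degree_add
  by (simp add: degree_single points_vars algebra_simps)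

text \<open>
  The exponents move from an outer to an inner variable, which raises the degree by a fixed
  positive amount at each step.
\<close>

lemma sf_geom:
  assumes "u \<in> points" "v \<in> points" "r v < r u"
  shows "sf (\<lambda>k. fmonom (geom_exp u v k)) UNIV"
proof (rule sf_if_order)
  show "order_ge (degree (geom_exp u v j)) (fmonom (geom_exp u v j))" for j
    by (rule order_ge_fmonom)
next
  fix t
  have w: "wgt u < wgt v" using assms by (rule wgt_antimono)
  have "k \<le> nat \<lceil>(t + wgt u) / (wgt v - wgt u)\<rceil>" if "degree (geom_exp u v k) \<le> t" for k
  proof -
    have "real k \<le> (t + wgt u) / (wgt v - wgt u)"
      using that w by (simp add: degree_geom_exp assms field_simps)
    then show ?thesis by linarith
  qed
  then show "finite {k\<in>UNIV. degree (geom_exp u v k) \<le> t}"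
    by (intro finite_subset[OF _ finite_atMost[of "nat \<lceil>(t + wgt u) / (wgt v - wgt u)\<rceil>"]]) auto
qed (rule lf_fmonom)

lemma order_ge_geom:
  assumes "u \<in> points" "v \<in> points" "r v < r u"
  shows "order_ge (- 1) (geom u v)"
  unfolding geom_fsum
proof (rule order_ge_fsum)
  fix k
  have "0 \<le> (wgt v - wgt u) * real k" using wgt_antimono[OF assms] by simp
  then have "- 1 \<le> degree (geom_exp u v k)"
    using wgt_bounds[OF assms(1)] by (simp add: degree_geom_exp assms)
  then show "order_ge (- 1) (fmonom (geom_exp u v k))"
    using order_ge_fmonom order_ge_mono by blast
qed

lemma lf_geom: "u \<in> points \<Longrightarrow> v \<in> points \<Longrightarrow> r v < r u \<Longrightarrow> lf (geom u v)"
  unfolding geom_fsum by (intro lf_fsum sf_geom)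

lemma geom_inverse:
  assumes "u \<in> points" "v \<in> points" "r v < r u"
  shows "(vpow u 1 - vpow v 1) \<star> geom u v = fmonom 0"
proof -
  note sf = sf_geom[OF assms]
  define F where "F k = fmonom (single u (- of_nat k) + single v (of_nat k))" for k :: nat
  have 1: "vpow u 1 \<star> geom u v = fsum F UNIV"
    unfolding geom_fsum fmul_fsum[OF lf_vpow sf] unfolding vpow_single fmonom_add
    by (rule fsum_cong) (auto simp: F_def geom_exp_def add.assoc[symmetric] single_add)
  have 2: "vpow v 1 \<star> geom u v = fsum (\<lambda>k. F (Suc k)) UNIV"
    unfolding geom_fsum fmul_fsum[OF lf_vpow sf] unfolding vpow_single fmonom_add
    by (rule fsum_cong) (auto simp: F_def geom_exp_def add.left_commute[of "single v _"] single_add)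
  have sF: "sf F UNIV"
    using sf_fmul_const[OF lf_vpow[of u 1] sf]
    by (simp add: F_def[abs_def] vpow_single fmonom_add geom_exp_def add.assoc[symmetric] single_add)
  have "UNIV = insert 0 (range Suc)" using not0_implies_Suc by auto
  then have "fsum F UNIV = F 0 + fsum F (range Suc)"
    using fsum_insert[of F 0 "range Suc"] sF by simp
  also have "fsum F (range Suc) = fsum (\<lambda>k. F (Suc k)) UNIV"
    by (rule fsum_reindex) simp
  finally have "fsum F UNIV - fsum (\<lambda>k. F (Suc k)) UNIV = F 0" by (simp only: add_diff_cancel_right')
  then show ?thesis
    using 1 2 assms by (simp add: fmul_diff_left lf_geom lf_vpow F_def)
qed

text \<open>
  Both expansions of \<open>1/(u-v)\<close> are inverse to \<open>u - v\<close>, each in the region where it is used.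
\<close>

lemma inv_diff_facts:
  assumes "u \<in> points" "v \<in> points" "u \<noteq> v"
  shows "lf (inv_diff r u v)" "order_ge (- 1) (inv_diff r u v)"
    "inv_diff r u v \<star> (vpow u 1 - vpow v 1) = fmonom 0"
proof -
  consider "r v < r u" | "r u < r v" using r_inj[of u v] assms by fastforce
  then have "lf (inv_diff r u v) \<and> order_ge (- 1) (inv_diff r u v) \<and>
    inv_diff r u v \<star> (vpow u 1 - vpow v 1) = fmonom 0"
  proof cases
    case 1
    then show ?thesis using assms
      by (simp add: inv_diff_geom lf_geom order_ge_geom geom_inverse fmul_commute[of "geom _ _"])
  next
    case 2
    have "- geom v u \<star> (vpow u 1 - vpow v 1) = (vpow v 1 - vpow u 1) \<star> geom v u"
      using fmul_uminus_right[of "vpow u 1 - vpow v 1" "geom v u"]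
        fmul_uminus_right[of "geom v u" "vpow u 1 - vpow v 1"]
      by (simp add: fmul_commute[of "geom _ _"] fmul_commute[of "- geom _ _"])
    with 2 show ?thesis using assms
      by (simp add: inv_diff_geom lf_geom lf_uminus order_ge_uminus order_ge_geom geom_inverse)
  qed
  then show "lf (inv_diff r u v)" "order_ge (- 1) (inv_diff r u v)"
    "inv_diff r u v \<star> (vpow u 1 - vpow v 1) = fmonom 0" by auto
qed

lemma order_ge_vpow: "v \<in> points \<Longrightarrow> order_ge (wgt v * Re s) (vpow v s)"
  using order_ge_fmonom[of "single v s"] by (simp add: vpow_single degree_single points_vars)

lemma order_ge_var: "v \<in> points \<Longrightarrow> order_ge 0 (vpow v 1)"
  by (rule order_ge_mono[OF order_ge_vpow]) (use wgt_bounds[of v] in auto)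

definition pole :: "var \<Rightarrow> nat \<Rightarrow> fseries" where
  "pole x l = inv_diff r x (VA l)"

text \<open>
  The elementary symmetric functions of the three series \<open>1/(x - A\<^sub>l)\<close>.
\<close>

definition esym :: "nat \<Rightarrow> var \<Rightarrow> fseries" where
  "esym k x = (if k = 1 then pole x 0 + pole x 1 + pole x 2
     else if k = 2 then pole x 0 \<star> pole x 1 + pole x 0 \<star> pole x 2 + pole x 1 \<star> pole x 2
     else pole x 0 \<star> (pole x 1 \<star> pole x 2))"

text \<open>
  The coefficients of \<open>1, y, y\<^sup>2\<close> in \<open>-e\<^sub>1 + (x-y) e\<^sub>2 - (x-y)\<^sup>2 e\<^sub>3\<close>.
\<close>

definition quad_coeff :: "nat \<Rightarrow> var \<Rightarrow> fseries" where
  "quad_coeff l x = (if l = 0 then vpow x 1 \<star> esym 2 x - esym 1 x - vpow x 1 \<star> (vpow x 1 \<star> esym 3 x)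
     else if l = 1 then fscale 2 (vpow x 1 \<star> esym 3 x) - esym 2 x
     else - esym 3 x)"

text \<open>
  The possible arguments of the kernel. The points \<open>A\<^sub>l\<close> are excluded because the kernel has its
  other poles there.
\<close>

definition modvar :: "var \<Rightarrow> bool" where
  "modvar x \<longleftrightarrow> x \<in> points \<and> (\<forall>l. x \<noteq> VA l)"

lemma modvar_simps [simp]: "modvar VX" "modvar VY" "a \<in> Iset g \<Longrightarrow> modvar (VW a)"
  by (auto simp: modvar_def)

lemma pole_facts:
  assumes "modvar x" "l \<le> 2"
  shows "lf (pole x l)" "order_ge (- 1) (pole x l)"
    "pole x l \<star> (vpow x 1 - vpow (VA l) 1) = fmonom 0"
  using inv_diff_facts[of x "VA l"] assms by (auto simp: pole_def modvar_def)

lemma pi2_factor_eq: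
  assumes "modvar x" "l \<le> 2"
  shows "pi2_factor r x y l = fmonom 0 - (vpow x 1 - vpow y 1) \<star> pole x l"
proof -
  have "pi2_factor r x y l = pole x l \<star> ((vpow x 1 - vpow (VA l) 1) - (vpow x 1 - vpow y 1))"
    by (simp add: pi2_factor_def pole_def fmul_commute)
  also have "\<dots> = fmonom 0 - (vpow x 1 - vpow y 1) \<star> pole x l"
    by (subst fmul_diff_right)
      (auto simp: pole_facts assms lf_diff lf_vpow fmul_commute[of _ "pole x l"])
  finally show ?thesis .
qed

lemma lf_esym: "modvar x \<Longrightarrow> lf (esym k x)"
  by (simp add: esym_def pole_facts lf_add lf_fmul)

lemma order_ge_esym: assumes "modvar x" shows "order_ge (- 3) (esym k x)"
proof -
  have p: "order_ge (- 1) (pole x 0)" "order_ge (- 1) (pole x 1)" "order_ge (- 1) (pole x 2)"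
    using assms by (simp_all add: pole_facts)
  have "order_ge (- 3) (pole x i \<star> pole x j)" if "i \<le> 2" "j \<le> 2" for i j
    by (rule order_ge_mono[OF order_ge_fmul[OF pole_facts(2) pole_facts(2)]]) (use that assms in auto)
  moreover have "order_ge (- 3) (pole x 0 \<star> (pole x 1 \<star> pole x 2))"
    using order_ge_fmul[OF p(1) order_ge_fmul[OF p(2,3)]] by simp
  ultimately show ?thesis
    unfolding esym_def using order_ge_mono[OF p(1), of "-3"] order_ge_mono[OF p(2), of "-3"]
      order_ge_mono[OF p(3), of "-3"] by (auto intro!: order_ge_add)
qed

lemma fmul_uminus_left: "(- f) \<star> h = - (f \<star> h)"
  by (simp add: fmul_commute[of _ h] fmul_uminus_right)

lemma pi2_quad:
  assumes "modvar x" "modvar y" "x \<noteq> y"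
  shows "pi2 r x y = inv_diff r x y + (\<Sum>l\<le>2. quad_coeff l x \<star> vpow y (of_nat l))"
proof -
  have p: "lf (pole x 0)" "lf (pole x 1)" "lf (pole x 2)"
    using assms by (simp_all add: pole_facts)
  have I: "lf (inv_diff r x y)" "inv_diff r x y \<star> (vpow x 1 - vpow y 1) = fmonom 0"
    using assms by (auto intro: inv_diff_facts simp: modvar_def)
  define E1 E2 E3 where E: "E1 = esym 1 x" "E2 = esym 2 x" "E3 = esym 3 x"
  define X Y where XY: "X = vpow x 1" "Y = vpow y 1"
  have lf: "lf E1" "lf E2" "lf E3" "lf X" "lf Y"
    unfolding E XY using assms by (auto intro: lf_esym lf_vpow)
  have e: "pole x 0 + pole x 1 + pole x 2 = E1"
    "pole x 0 \<star> pole x 1 + pole x 0 \<star> pole x 2 + pole x 1 \<star> pole x 2 = E2"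
    "pole x 0 \<star> (pole x 1 \<star> pole x 2) = E3" by (simp_all add: esym_def E)
  have "pi2 r x y = inv_diff r x y - E1 + (X - Y) \<star> E2 - (X - Y) \<star> ((X - Y) \<star> E3)"
    using pi2_product_expansion[OF I(1) lf_diff[OF lf_vpow lf_vpow] p I(2)] assms
    unfolding e pi2_def XY by (simp add: pi2_factor_eq)
  also have "(X - Y) \<star> E2 = X \<star> E2 - E2 \<star> Y"
    using lf by (simp only: fmul_diff_left fmul_commute[of Y E2])
  also have "(X - Y) \<star> ((X - Y) \<star> E3)
      = X \<star> (X \<star> E3) - fscale 2 (X \<star> E3) \<star> Y + E3 \<star> vpow y 2"
  proof -
    have a: "Y \<star> (X \<star> E3) = X \<star> (Y \<star> E3)"
      using lf by (intro fmul_left_commute)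
    have b: "Y \<star> (Y \<star> E3) = E3 \<star> vpow y 2"
      using fmul_assoc[of Y Y E3] lf by (simp add: vpow_add XY fmul_commute[of "vpow y 2"])
    have c: "fscale 2 (X \<star> E3) \<star> Y = X \<star> (Y \<star> E3) + X \<star> (Y \<star> E3)"
      unfolding fscale_fmul fmul_commute[of "X \<star> E3" Y] a by (simp add: fscale_def fun_eq_iff)
    have "(X - Y) \<star> ((X - Y) \<star> E3) = X \<star> (X \<star> E3) - Y \<star> (X \<star> E3) - (X \<star> (Y \<star> E3) - Y \<star> (Y \<star> E3))"
      using lf by (simp only: fmul_diff_left fmul_diff_right lf_fmul lf_diff)
    then show ?thesis unfolding c a b by (simp only: algebra_simps)
  qed
  finally have 1: "pi2 r x y = inv_diff r x y - E1 + (X \<star> E2 - E2 \<star> Y)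
      - (X \<star> (X \<star> E3) - fscale 2 (X \<star> E3) \<star> Y + E3 \<star> vpow y 2)" .
  have "(\<Sum>l\<le>2. quad_coeff l x \<star> vpow y (of_nat l))
      = quad_coeff 0 x + quad_coeff 1 x \<star> Y + quad_coeff 2 x \<star> vpow y 2"
    by (simp add: numeral_2_eq_2 XY)
  also have "quad_coeff 1 x \<star> Y = fscale 2 (X \<star> E3) \<star> Y - E2 \<star> Y"
    using lf by (simp add: quad_coeff_def E[symmetric] XY[symmetric] fmul_diff_left lf_fmul lf_fscale)
  also have "quad_coeff 2 x = - E3" by (simp add: quad_coeff_def E)
  also have "quad_coeff 0 x = X \<star> E2 - E1 - X \<star> (X \<star> E3)" by (simp add: quad_coeff_def E XY)
  finally have 2: "(\<Sum>l\<le>2. quad_coeff l x \<star> vpow y (of_nat l)) = X \<star> E2 - E1 - X \<star> (X \<star> E3)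
      + (fscale 2 (X \<star> E3) \<star> Y - E2 \<star> Y) + - E3 \<star> vpow y 2" .
  show ?thesis unfolding 1 2 fmul_uminus_left add_uminus_conv_diff by (simp only: algebra_simps)
qed

lemma indep_of_quad_coeff:
  assumes "y \<noteq> x" "\<And>l. y \<noteq> VA l" shows "indep_of y (quad_coeff l x)"
proof -
  have p: "indep_of y (pole x l)" for l
    unfolding pole_def using assms by (intro indep_of_inv_diff) (auto dest: sym)
  then have e: "indep_of y (esym k x)" for k
    unfolding esym_def by (auto intro!: indep_of_add indep_of_fmul)
  have "indep_of y (vpow x 1)" using assms by (intro indep_of_vpow) auto
  moreover have "indep_of y (fscale 2 h)" if "indep_of y h" for h
    using that by (auto simp: indep_of_def fscale_def)
  ultimately show ?thesis
    unfolding quad_coeff_def using e by (auto intro!: indep_of_diff indep_of_fmul indep_of_uminus)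
qed

text \<open>
  The functions \<open>f\<^sub>l\<close> are read off from the kernel with the auxiliary second argument. As
  \<open>quad_coeff\<close> is free of that argument, the same coefficients serve for every second argument.
\<close>

lemma fl_quad_coeff:
  assumes "modvar x" "x \<noteq> VY" "l \<le> 2"
  shows "fl r l x = quad_coeff l x"
proof
  fix e
  have ind: "indep_of VY (quad_coeff k x)" for k
    by (rule indep_of_quad_coeff) (use assms in auto)
  show "fl r l x e = quad_coeff l x e"
  proof (cases "e VY = 0")
    case False
    then show ?thesis using ind by (auto simp: fl_def indep_of_def)
  next
    case True
    have u: "e(VY := of_nat l) = e + single VY (of_nat l)" using True by (auto simp: fun_eq_iff single_def)
    have s: "e + single VY (of_nat l) - single VY (of_nat k) = e + single VY (of_nat l - of_nat k)" for k :: nat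
      by (auto simp: fun_eq_iff single_def)
    have "fl r l x e = (\<Sum>k\<le>2. quad_coeff k x (e + single VY (of_nat l - of_nat k)))"
      using True assms(1,2) by (simp add: fl_def pi2_quad u sum_fun_app vpow_single fmul_fmonom s del: plus_fun_def)
    also have "\<dots> = (\<Sum>k\<le>2. if k = l then quad_coeff l x e else 0)"
    proof (intro sum.cong refl)
      fix k
      have "(e + single VY (of_nat l - of_nat k)) VY = of_nat l - of_nat k" using True by simp
      then have "quad_coeff k x (e + single VY (of_nat l - of_nat k)) = 0" if "k \<noteq> l"
        using ind[of k] that unfolding indep_of_def by (metis eq_iff_diff_eq_0 of_nat_eq_iff)
      then show "quad_coeff k x (e + single VY (of_nat l - of_nat k)) = (if k = l then quad_coeff l x e else 0)"
        by auto
    qed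
    also have "\<dots> = quad_coeff l x e" using assms(3) by simp
    finally show ?thesis .
  qed
qed

lemma pi2_expansion:
  assumes "modvar x" "modvar y" "x \<noteq> y" "x \<noteq> VY"
  shows "pi2 r x y = inv_diff r x y + (\<Sum>l\<le>2. fl r l x \<star> vpow y (of_nat l))"
  unfolding pi2_quad[OF assms(1-3)] using assms by (simp add: fl_quad_coeff)

lemma lf_fl: "modvar x \<Longrightarrow> x \<noteq> VY \<Longrightarrow> l \<le> 2 \<Longrightarrow> lf (fl r l x)"
  by (simp add: fl_quad_coeff quad_coeff_def lf_diff lf_uminus lf_fmul lf_vpow lf_esym lf_fscale)

lemma order_ge_fl:
  assumes "modvar x" "x \<noteq> VY" "l \<le> 2" shows "order_ge (- 3) (fl r l x)"
proof -
  have X: "order_ge 0 (vpow x 1)" using assms by (intro order_ge_var) (simp add: modvar_def)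
  have e: "order_ge (- 3) (vpow x 1 \<star> h)" if "order_ge (- 3) h" for h
    using order_ge_fmul[OF X that] by simp
  show ?thesis
    unfolding fl_quad_coeff[OF assms] quad_coeff_def using order_ge_esym[OF assms(1)]
    by (auto intro!: order_ge_diff order_ge_uminus order_ge_fscale e)
qed

lemma indep_of_fl:
  assumes "modvar x" "x \<noteq> VY" "l \<le> 2" "y \<noteq> x" "\<And>l. y \<noteq> VA l" shows "indep_of y (fl r l x)"
  unfolding fl_quad_coeff[OF assms(1-3)] by (rule indep_of_quad_coeff[OF assms(4,5)])

lemma pi2_facts:
  assumes "modvar x" "modvar y" "x \<noteq> y"
  shows "lf (pi2 r x y)" "order_ge (- 4) (pi2 r x y)"
proof -
  have I: "lf (inv_diff r x y)" "order_ge (- 1) (inv_diff r x y)"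
    using assms by (auto intro: inv_diff_facts simp: modvar_def)
  have f: "lf (pi2_factor r x y l) \<and> order_ge (- 1) (pi2_factor r x y l)" if "l \<le> 2" for l
  proof -
    have "order_ge (0 + - 1) (pi2_factor r x y l)"
      unfolding pi2_factor_def
      using assms that pole_facts[OF assms(1) that]
      by (intro order_ge_fmul order_ge_diff order_ge_var) (auto simp: modvar_def pole_def)
    then show ?thesis
      using assms that pole_facts[OF assms(1) that]
      by (auto simp: pi2_factor_def pole_def intro!: lf_fmul lf_diff lf_vpow)
  qed
  show "lf (pi2 r x y)" unfolding pi2_def using I f by (intro lf_fmul) auto
  show "order_ge (- 4) (pi2 r x y)"
    unfolding pi2_def
    using order_ge_fmul[OF order_ge_fmul[OF order_ge_fmul[OF I(2)]], of "-1" _ "-1" _ "-1"] f by simp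
qed

text \<open>
  The derivatives of the kernel differ from those of \<open>1/(x-y)\<close> by a combination of derivatives of
  \<open>1, y, y\<^sup>2\<close>; the Ward identities concern just these.
\<close>

lemma dderiv_pi2:
  assumes "modvar x" "modvar y" "x \<noteq> y" "x \<noteq> VY" "y \<noteq> VY"
  shows "dderiv x m y n (pi2 r x y) = dderiv x m y n (inv_diff r x y)
    + (\<Sum>l\<le>2. fscale (of_nat (l choose n)) (fscale (1 / fact m) ((fderiv x ^^ m) (fl r l x))
        \<star> vpow y (of_nat l - of_nat n)))"
  unfolding pi2_expansion[OF assms(1-4)] dderiv_add[OF assms(3)] dderiv_sum[OF assms(3)]
  using assms by (simp add: dderiv_indep_fmul_vpow indep_of_fl modvar_def)

lemma dderiv_facts:
  assumes "u \<in> points" "v \<in> points" "u \<noteq> v" "lf f" "order_ge t f"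
  shows "lf (dderiv u m v n f)" "order_ge (t - real m - real n) (dderiv u m v n f)"
proof -
  show "lf (dderiv u m v n f)" using assms by (simp add: lf_dderiv)
  have "wgt u * real m \<le> real m" "wgt v * real n \<le> real n"
    using wgt_bounds[OF assms(1)] wgt_bounds[OF assms(2)] by (simp_all add: mult_left_le_one_le)
  then show "order_ge (t - real m - real n) (dderiv u m v n f)"
    using order_ge_dderiv[OF assms(3,5), of m n] assms
    by (elim order_ge_mono) (simp add: degree_single points_vars)
qed

lemma dderiv_pi2_facts:
  assumes "modvar x" "modvar y" "x \<noteq> y"
  shows "lf (dderiv x m y n (pi2 r x y))" "order_ge (- 4 - real m - real n) (dderiv x m y n (pi2 r x y))"
  using dderiv_facts[OF _ _ assms(3) pi2_facts[OF assms], of m n] assms by (auto simp: modvar_def)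

lemma deriv_fl_facts:
  assumes "modvar x" "x \<noteq> VY" "l \<le> 2"
  shows "lf (fscale (1 / fact m) ((fderiv x ^^ m) (fl r l x)))"
    "order_ge (- 3 - real m) (fscale (1 / fact m) ((fderiv x ^^ m) (fl r l x)))"
  using dderiv_facts[OF _ points_simps(2) assms(2) lf_fl[OF assms] order_ge_fl[OF assms], of m 0] assms
  by (auto simp: modvar_def dderiv_def)

lemma order_ge_rho: "a \<in> Iset g \<Longrightarrow> order_ge (8 * Re s) (rho a s)"
  using order_ge_fmonom[of "single (VR \<bar>a\<bar>) s"] by (simp add: rho_single degree_single VR_vars wgt_VR)

lemma lf_rho: "lf (rho a s)"
  by (simp add: rho_def lf_vpow)

lemma Lrow_facts:
  assumes "b \<in> Iset g"
  shows "lf (Lrow r b n)" "order_ge (3 * real n - 4) (Lrow r b n)"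
proof -
  note d = dderiv_pi2_facts[of VX "VW b" 0 n]
  show "lf (Lrow r b n)" using d assms by (simp add: Lrow_def lf_fmul lf_rho)
  show "order_ge (3 * real n - 4) (Lrow r b n)"
    unfolding Lrow_def using order_ge_fmul[OF order_ge_rho[OF assms] d(2), of "of_nat n / 2"] assms
    by (auto elim: order_ge_mono)
qed

text \<open>
  Half a power of \<open>\<rho>\<close> per index has degree 4, and the derivative belonging to it costs at most 1.
\<close>

lemma Amat_facts:
  assumes "a \<in> Iset g" "b \<in> Iset g"
  shows "lf (Amat r a b m n)" "order_ge (3 * real m + 3 * real n) (Amat r a b m n)"
proof -
  have a': "- a \<in> Iset g" using assms(1) by (rule Iset_uminus)
  have "lf (Amat r a b m n) \<and> order_ge (3 * real m + 3 * real n) (Amat r a b m n)"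
  proof (cases "b = - a")
    case False
    note d = dderiv_pi2_facts[of "VW (- a)" "VW b" m n]
    have dd: "lf (dderiv (VW (- a)) m (VW b) n (pi2 r (VW (- a)) (VW b)))"
      "order_ge (- 4 - real m - real n) (dderiv (VW (- a)) m (VW b) n (pi2 r (VW (- a)) (VW b)))"
      using d False assms a' by auto
    have A: "Amat r a b m n = rho a ((of_nat m + 1) / 2) \<star> rho b (of_nat n / 2)
        \<star> dderiv (VW (- a)) m (VW b) n (pi2 r (VW (- a)) (VW b))"
      using False by (simp add: Amat_def)
    have "order_ge (8 * Re ((of_nat m + 1) / 2) + 8 * Re (of_nat n / 2) + (- 4 - real m - real n)) (Amat r a b m n)"
      unfolding A using assms by (intro order_ge_fmul order_ge_rho dd(2))
    then have "order_ge (3 * real m + 3 * real n) (Amat r a b m n)"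
      by (rule order_ge_mono) (simp add: field_simps)
    then show ?thesis using False dd(1) by (simp add: Amat_def lf_fmul lf_rho)
  next
    case True
    let ?f = "\<lambda>l. fscale (1 / fact m) ((fderiv (VW (- a)) ^^ m) (fl r l (VW (- a))))
                   \<star> vpow (VW (- a)) (of_nat l - of_nat n)"
    have f: "lf (?f l)" "order_ge (- 3 - real m - real n) (?f l)" if "l \<le> 2" for l
    proof -
      note d = deriv_fl_facts[of "VW (- a)" l m]
      show "lf (?f l)" using d a' that by (simp add: lf_fmul lf_vpow)
      have "order_ge ((- 3 - real m) + wgt (VW (- a)) * Re (of_nat l - of_nat n)) (?f l)"
        using a' that by (intro order_ge_fmul d order_ge_vpow) auto
      moreover have "- real n \<le> wgt (VW (- a)) * (real l - real n)"
      proof -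
        have w: "0 < wgt (VW (- a))" "wgt (VW (- a)) < 1" using wgt_bounds a' by auto
        have "wgt (VW (- a)) * real n \<le> real n" using w by (simp add: mult_left_le_one_le)
        moreover have "0 \<le> wgt (VW (- a)) * real l" using w by simp
        ultimately show ?thesis by (simp add: right_diff_distrib)
      qed
      ultimately show "order_ge (- 3 - real m - real n) (?f l)"
        by (elim order_ge_mono) simp
    qed
    let ?S = "\<Sum>l\<le>2. fscale (of_nat (l choose n)) (?f l)"
    have S: "lf ?S" "order_ge (- 3 - real m - real n) ?S"
      using f by (auto intro!: lf_sum order_ge_sum lf_fscale order_ge_fscale)
    have A: "Amat r a b m n = rho a ((of_nat m + of_nat n + 1) / 2) \<star> ?S"
      using True by (simp add: Amat_def)
    have "order_ge (8 * Re ((of_nat m + of_nat n + 1) / 2) + (- 3 - real m - real n)) (Amat r a b m n)"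
      unfolding A using assms by (intro order_ge_fmul order_ge_rho S(2))
    then have "order_ge (3 * real m + 3 * real n) (Amat r a b m n)"
      by (rule order_ge_mono) (simp add: field_simps)
    then show ?thesis using True S(1) by (simp add: Amat_def lf_fmul lf_rho)
  qed
  then show "lf (Amat r a b m n)" "order_ge (3 * real m + 3 * real n) (Amat r a b m n)" by auto
qed

end

section \<open>Modes on modules and intertwining operators\<close>

lemma lin_on_zero:
  assumes "lin_on s t S f" "(0::'a::ab_group_add) \<in> S" shows "f 0 = (0::'b::ab_group_add)"
proof -
  have "f (0 + 0) = f 0 + f 0" using assms unfolding lin_on_def by blast
  then show ?thesis by simp
qed

lemma lin_on_add: "lin_on s t S f \<Longrightarrow> x \<in> S \<Longrightarrow> y \<in> S \<Longrightarrow> f (x + y) = f x + f y"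
  and lin_on_scale: "lin_on s t S f \<Longrightarrow> x \<in> S \<Longrightarrow> f (s c x) = t c (f x)"
  by (auto simp: lin_on_def)

lemma weak_moduleD:
  assumes "weak_module V M"
  shows "vector_space (msmult M)" "module.subspace (msmult M) (mcarrier M)"
    "u \<in> vcarrier V \<Longrightarrow> w \<in> mcarrier M \<Longrightarrow> mop M u n w \<in> mcarrier M"
    "u \<in> vcarrier V \<Longrightarrow> lin_on (msmult M) (msmult M) (mcarrier M) (mop M u n)"
    "w \<in> mcarrier M \<Longrightarrow> lin_on (vsmult V) (msmult M) (vcarrier V) (\<lambda>u. mop M u n w)"
    "u \<in> vcarrier V \<Longrightarrow> w \<in> mcarrier M \<Longrightarrow> \<exists>N. \<forall>n\<ge>N. mop M u n w = 0"
  using assms unfolding weak_module_def by auto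

lemma module_carrier:
  assumes "weak_module V M"
  shows "0 \<in> mcarrier M" "x \<in> mcarrier M \<Longrightarrow> y \<in> mcarrier M \<Longrightarrow> x + y \<in> mcarrier M"
    "x \<in> mcarrier M \<Longrightarrow> y \<in> mcarrier M \<Longrightarrow> x - y \<in> mcarrier M"
    "x \<in> mcarrier M \<Longrightarrow> msmult M c x \<in> mcarrier M"
    "(\<And>i. i \<in> I \<Longrightarrow> f i \<in> mcarrier M) \<Longrightarrow> (\<Sum>i\<in>I. f i) \<in> mcarrier M"
proof -
  interpret vector_space "msmult M" by (rule weak_moduleD(1)[OF assms])
  note s = weak_moduleD(2)[OF assms]
  show "0 \<in> mcarrier M" "x \<in> mcarrier M \<Longrightarrow> y \<in> mcarrier M \<Longrightarrow> x + y \<in> mcarrier M"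
    "x \<in> mcarrier M \<Longrightarrow> y \<in> mcarrier M \<Longrightarrow> x - y \<in> mcarrier M"
    "x \<in> mcarrier M \<Longrightarrow> msmult M c x \<in> mcarrier M"
    using subspace_0[OF s] subspace_add[OF s] subspace_diff[OF s] subspace_scale[OF s] by auto
  show "(\<And>i. i \<in> I \<Longrightarrow> f i \<in> mcarrier M) \<Longrightarrow> (\<Sum>i\<in>I. f i) \<in> mcarrier M"
    by (rule subspace_sum[OF s])
qed

lemma scale_simps:
  assumes "weak_module V M"
  shows "msmult M c 0 = 0" "msmult M 0 x = 0" "msmult M 1 x = x"
    "msmult M c (x + y) = msmult M c x + msmult M c y"
    "msmult M c (x - y) = msmult M c x - msmult M c y"
    "msmult M (a + b) x = msmult M a x + msmult M b x"
    "msmult M (a - b) x = msmult M a x - msmult M b x"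
    "msmult M a (msmult M b x) = msmult M (a * b) x"
    "msmult M c x = 0 \<longleftrightarrow> c = 0 \<or> x = 0"
proof -
  interpret vector_space "msmult M" by (rule weak_moduleD(1)[OF assms])
  show "msmult M c 0 = 0" "msmult M 0 x = 0" "msmult M 1 x = x"
    "msmult M c (x + y) = msmult M c x + msmult M c y"
    "msmult M c (x - y) = msmult M c x - msmult M c y"
    "msmult M (a + b) x = msmult M a x + msmult M b x"
    "msmult M (a - b) x = msmult M a x - msmult M b x"
    "msmult M a (msmult M b x) = msmult M (a * b) x"
    "msmult M c x = 0 \<longleftrightarrow> c = 0 \<or> x = 0"
    by (simp_all add: scale_right_distrib scale_left_distrib scale_left_diff_distrib scale_right_diff_distrib)
qed

lemma lin_on_sum:
  assumes "lin_on s t (mcarrier M) f" "weak_module V M" "\<And>i. i \<in> I \<Longrightarrow> x i \<in> mcarrier M"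
  shows "f (\<Sum>i\<in>I. x i) = (\<Sum>i\<in>I. f (x i))"
  using assms(3)
proof (induction I rule: infinite_finite_induct)
  case (insert i I)
  then show ?case
    using lin_on_add[OF assms(1), of "x i" "sum x I"] module_carrier(5)[OF assms(2), of I x] by simp
qed (use lin_on_zero[OF assms(1) module_carrier(1)[OF assms(2)]] in auto)

lemma lin_on_diff:
  assumes "lin_on s t (mcarrier M) f" "weak_module V M" "x \<in> mcarrier M" "y \<in> mcarrier M"
  shows "f (x - y) = f x - f y"
  using lin_on_add[OF assms(1) module_carrier(3)[OF assms(2-4)] assms(4)] by simp

lemma intertwiningD:
  assumes "intertwining V M3 M1 M2 Y"
  shows "v \<in> mcarrier M1 \<Longrightarrow> w \<in> mcarrier M2 \<Longrightarrow> Y v n w \<in> mcarrier M3"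
    "v \<in> mcarrier M1 \<Longrightarrow> lin_on (msmult M2) (msmult M3) (mcarrier M2) (Y v n)"
    "w \<in> mcarrier M2 \<Longrightarrow> lin_on (msmult M1) (msmult M3) (mcarrier M1) (\<lambda>v. Y v n w)"
    "v \<in> mcarrier M1 \<Longrightarrow> w \<in> mcarrier M2 \<Longrightarrow> \<exists>N. \<forall>n. N \<le> Re n \<longrightarrow> Y v n w = 0"
    "u \<in> vcarrier V \<Longrightarrow> v \<in> mcarrier M1 \<Longrightarrow> w \<in> mcarrier M2 \<Longrightarrow>
        jacobi_at (msmult M3) (mop M1 u) (mop M2 u) (mop M3 u) Y v w l m n"
    "v \<in> mcarrier M1 \<Longrightarrow> w \<in> mcarrier M2 \<Longrightarrow>
        Y (Lop V M1 (-1) v) n w = msmult M3 (- n) (Y v (n - 1) w)"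
  using assms unfolding intertwining_def by blast+

lemma Sum_any_lessThan:
  assumes "\<And>i. i \<ge> J \<Longrightarrow> f i = 0" shows "Sum_any f = (\<Sum>i<(J::nat). f i)"
proof (rule Sum_any.expand_superset)
  show "{a. f a \<noteq> 0} \<subseteq> {..<J}" using assms by (auto simp: not_le[symmetric])
qed simp

text \<open>
  The Jacobi identity for \<open>l = 0\<close>, where only the term \<open>i = 0\<close> survives on the right.
\<close>

lemma intertwining_commutator:
  assumes Y: "intertwining V M3 M1 M2 Y" and M: "weak_module V M1" "weak_module V M2" "weak_module V M3"
    and uvw: "u \<in> vcarrier V" "v \<in> mcarrier M1" "w \<in> mcarrier M2"
    and J: "\<And>i. i \<ge> J \<Longrightarrow> mop M1 u (int i) v = 0"
  shows "mop M3 u m (Y v n w) = Y v n (mop M2 u m w)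
    + (\<Sum>i<J. msmult M3 (of_int m gchoose i) (Y (mop M1 u (int i) v) (of_int m + n - of_nat i) w))"
proof -
  have Y0: "Y 0 k w = 0" for k
    using lin_on_zero[OF intertwiningD(3)[OF Y uvw(3)] module_carrier(1)[OF M(1)]] .
  have "Sum_any (\<lambda>i::nat. msmult M3 (of_int m gchoose i) (Y (mop M1 u (0 + int i) v) (of_int m + n - of_nat i) w))
      = (\<Sum>i<J. msmult M3 (of_int m gchoose i) (Y (mop M1 u (int i) v) (of_int m + n - of_nat i) w))"
    by (subst Sum_any_lessThan[of J]) (auto simp: J Y0 scale_simps[OF M(3)])
  moreover have "Sum_any (\<lambda>i::nat. msmult M3 ((-1) ^ i * (of_int 0 gchoose i))
         (mop M3 u (m + 0 - int i) (Y v (n + of_nat i) w)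
          - msmult M3 ((-1) powi 0) (Y v (n + of_int 0 - of_nat i) (mop M2 u (m + int i) w))))
      = (\<Sum>i<1. msmult M3 ((-1) ^ i * (of_int 0 gchoose i))
         (mop M3 u (m + 0 - int i) (Y v (n + of_nat i) w)
          - msmult M3 ((-1) powi 0) (Y v (n + of_int 0 - of_nat i) (mop M2 u (m + int i) w))))"
  proof (rule Sum_any_lessThan)
    fix i :: nat assume "1 \<le> i"
    then have "(of_int 0 gchoose i :: complex) = 0" by (cases i) simp_all
    then show "msmult M3 ((-1) ^ i * (of_int 0 gchoose i))
         (mop M3 u (m + 0 - int i) (Y v (n + of_nat i) w)
          - msmult M3 ((-1) powi 0) (Y v (n + of_int 0 - of_nat i) (mop M2 u (m + int i) w))) = 0"
      by (simp add: scale_simps[OF M(3)])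
  qed
  ultimately show ?thesis
    using intertwiningD(5)[OF Y uvw, of 0 m n] by (simp add: jacobi_at_def scale_simps[OF M(3)] algebra_simps)
qed

text \<open>
  The Jacobi identity for \<open>m = 0\<close>, where only the term \<open>i = 0\<close> survives on the left.
\<close>

lemma intertwining_associator:
  assumes Y: "intertwining V M3 M1 M2 Y" and M: "weak_module V M1" "weak_module V M2" "weak_module V M3"
    and uvw: "u \<in> vcarrier V" "v \<in> mcarrier M1" "w \<in> mcarrier M2"
    and P: "\<And>i. i \<ge> P \<Longrightarrow> Y v (n + of_nat i) w = 0" "\<And>i. i \<ge> P \<Longrightarrow> mop M2 u (int i) w = 0"
  shows "Y (mop M1 u l v) n w = (\<Sum>i<P. msmult M3 ((-1) ^ i * (of_int l gchoose i))
      (mop M3 u (l - int i) (Y v (n + of_nat i) w)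
        - msmult M3 ((-1) powi l) (Y v (n + of_int l - of_nat i) (mop M2 u (int i) w))))"
proof -
  have Y0: "Y v k 0 = 0" for k
    using lin_on_zero[OF intertwiningD(2)[OF Y uvw(2)] module_carrier(1)[OF M(2)]] .
  have M0: "mop M3 u k 0 = 0" for k
    using lin_on_zero[OF weak_moduleD(4)[OF M(3) uvw(1)] module_carrier(1)[OF M(3)]] .
  have "Sum_any (\<lambda>i::nat. msmult M3 (of_int 0 gchoose i) (Y (mop M1 u (l + int i) v) (of_int 0 + n - of_nat i) w))
     = (\<Sum>i<1. msmult M3 (of_int 0 gchoose i) (Y (mop M1 u (l + int i) v) (of_int 0 + n - of_nat i) w))"
  proof (rule Sum_any_lessThan)
    fix i :: nat assume "1 \<le> i"
    then have "(of_int 0 gchoose i :: complex) = 0" by (cases i) simp_all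
    then show "msmult M3 (of_int 0 gchoose i) (Y (mop M1 u (l + int i) v) (of_int 0 + n - of_nat i) w) = 0"
      by (simp add: scale_simps[OF M(3)])
  qed
  moreover have "Sum_any (\<lambda>i::nat. msmult M3 ((-1) ^ i * (of_int l gchoose i))
         (mop M3 u (0 + l - int i) (Y v (n + of_nat i) w)
          - msmult M3 ((-1) powi l) (Y v (n + of_int l - of_nat i) (mop M2 u (0 + int i) w))))
      = (\<Sum>i<P. msmult M3 ((-1) ^ i * (of_int l gchoose i))
      (mop M3 u (l - int i) (Y v (n + of_nat i) w)
        - msmult M3 ((-1) powi l) (Y v (n + of_int l - of_nat i) (mop M2 u (int i) w))))"
    by (subst Sum_any_lessThan[of P]) (auto simp: P Y0 M0 scale_simps[OF M(3)])
  ultimately show ?thesis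
    using intertwiningD(5)[OF Y uvw, of l 0 n] by (simp add: jacobi_at_def scale_simps[OF M(3)])
qed

lemma wt_space_scale:
  assumes "weak_module V M" "conf V \<in> vcarrier V" "x \<in> wt_space V M l"
  shows "msmult M c x \<in> wt_space V M l"
  using assms lin_on_scale[OF weak_moduleD(4)[OF assms(1,2)]] module_carrier(4)[OF assms(1)]
  by (auto simp: wt_space_def Lop_def scale_simps[OF assms(1)] mult.commute)

lemma wt_space_carrier: "x \<in> wt_space V M l \<Longrightarrow> x \<in> mcarrier M"
  by (simp add: wt_space_def)

lemma wt_space_0:
  assumes "weak_module V M" "conf V \<in> vcarrier V" shows "0 \<in> wt_space V M l"
  using lin_on_zero[OF weak_moduleD(4)[OF assms] module_carrier(1)[OF assms(1)]]
  by (simp add: wt_space_def Lop_def scale_simps[OF assms(1)] module_carrier[OF assms(1)])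

lemma wt_space_add:
  assumes "weak_module V M" "conf V \<in> vcarrier V" "x \<in> wt_space V M l" "y \<in> wt_space V M l"
  shows "x + y \<in> wt_space V M l"
  using assms lin_on_add[OF weak_moduleD(4)[OF assms(1,2)], of x y] module_carrier(2)[OF assms(1)]
  by (auto simp: wt_space_def Lop_def scale_simps[OF assms(1)])

text \<open>
  Eigenvectors of \<open>L(0)\<close> for different eigenvalues are independent.
\<close>

lemma wt_space_sum_zero:
  assumes M: "weak_module V M" "conf V \<in> vcarrier V"
  shows "finite F \<Longrightarrow> (\<And>l. l \<in> F \<Longrightarrow> x l \<in> wt_space V M l) \<Longrightarrow> (\<Sum>l\<in>F. x l) = 0 \<Longrightarrow> l \<in> F \<Longrightarrow> x l = 0"
proof (induction F arbitrary: x l rule: finite_induct)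
  case (insert a F)
  interpret vector_space "msmult M" by (rule weak_moduleD(1)[OF M(1)])
  have x: "x l \<in> mcarrier M" "Lop V M 0 (x l) = msmult M l (x l)" if "l \<in> insert a F" for l
    using insert.prems(1)[OF that] by (simp_all add: wt_space_def)
  have s: "x a + (\<Sum>l\<in>F. x l) = 0" using insert by simp
  have lin: "lin_on (msmult M) (msmult M) (mcarrier M) (Lop V M 0)"
    using weak_moduleD(4)[OF M, of 1] by (simp add: Lop_def[abs_def])
  have "(\<Sum>l\<in>insert a F. msmult M l (x l)) = Lop V M 0 (\<Sum>l\<in>insert a F. x l)"
    using lin_on_sum[OF lin M(1), of "insert a F" x] x by simp
  also have "\<dots> = 0" using insert.prems(2) lin_on_zero[OF lin module_carrier(1)[OF M(1)]] by simp
  finally have "msmult M a (x a) + (\<Sum>l\<in>F. msmult M l (x l)) = 0" using insert.hyps by simp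
  moreover have "msmult M a (x a) + (\<Sum>l\<in>F. msmult M a (x l)) = 0"
    using s by (metis scale_right_distrib scale_sum_right scale_zero_right)
  ultimately have "(\<Sum>l\<in>F. msmult M l (x l)) - (\<Sum>l\<in>F. msmult M a (x l)) = 0"
    by (metis add_left_cancel diff_self)
  then have "(\<Sum>l\<in>F. msmult M (l - a) (x l)) = 0"
    by (simp add: scale_left_diff_distrib sum_subtractf)
  then have "msmult M (l - a) (x l) = 0" if "l \<in> F" for l
    using insert.IH[of "\<lambda>l. msmult M (l - a) (x l)" l] insert.prems(1) that by (simp add: wt_space_scale[OF M])
  then have F: "x l = 0" if "l \<in> F" for l using that insert.hyps(2) by force
  then have "x a = 0" using s by simp
  then show ?case using F insert.prems(3) by blast
qed simp

lemma wt_space_span_disjoint: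
  assumes M: "weak_module V M" "conf V \<in> vcarrier V"
    and x: "x \<in> module.span (msmult M) (\<Union>l\<in>S. wt_space V M l)" "x \<in> wt_space V M l" "l \<notin> S"
  shows "x = 0"
proof -
  interpret vector_space "msmult M" by (rule weak_moduleD(1)[OF M(1)])
  have "\<exists>F y. finite F \<and> F \<subseteq> S \<and> (\<forall>l\<in>F. y l \<in> wt_space V M l) \<and> x = (\<Sum>l\<in>F. y l)"
    using x(1)
  proof (induction rule: span_induct_alt)
    case base
    then show ?case by (intro exI[of _ "{}"]) simp
  next
    case (step c z w)
    then obtain F y l where F: "finite F" "F \<subseteq> S" "\<forall>l\<in>F. y l \<in> wt_space V M l" "w = (\<Sum>l\<in>F. y l)"
      and l: "l \<in> S" "z \<in> wt_space V M l" by auto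
    define y' where "y' k = (if k = l then msmult M c z else 0) + (if k \<in> F then y k else 0)" for k
    have "y' k \<in> wt_space V M k" for k
      using F l by (auto simp: y'_def wt_space_0[OF M] intro!: wt_space_add[OF M] wt_space_scale[OF M])
    moreover have "(\<Sum>k\<in>insert l F. y' k) = msmult M c z + w"
    proof -
      have "(\<Sum>k\<in>insert l F. if k \<in> F then y k else 0) = (\<Sum>k\<in>F. y k)"
        by (rule sum.mono_neutral_cong_right) (use F(1) in auto)
      then show ?thesis unfolding y'_def sum.distrib F(4) using F(1) by simp
    qed
    ultimately show ?case using F l by (intro exI[of _ "insert l F"] exI[of _ y']) auto
  qed
  then obtain F y where F: "finite F" "F \<subseteq> S" "\<forall>l\<in>F. y l \<in> wt_space V M l" "x = (\<Sum>l\<in>F. y l)" by blast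
  \<comment> \<open>a vanishing sum of eigenvectors in which \<open>- x\<close> is the term of weight \<open>l\<close>\<close>
  define y' where "y' k = (if k = l then - x else y k)" for k
  have "l \<notin> F" using F(2) x(3) by blast
  have "y' k \<in> wt_space V M k" if "k \<in> insert l F" for k
    using that F(3) x(2) wt_space_scale[OF M x(2), of "-1"] by (auto simp: y'_def)
  moreover have "(\<Sum>k\<in>insert l F. y' k) = 0"
    using \<open>l \<notin> F\<close> F by (simp add: y'_def) (smt (verit) sum.cong)
  ultimately have "y' l = 0" using wt_space_sum_zero[OF M, of "insert l F" y' l] F(1) by blast
  then show ?thesis by (simp add: y'_def)
qed

text \<open>
  Commute \<open>L(0) = \<omega>(1)\<close> with the operator; the term with \<open>\<omega>(0) = L(-1)\<close> is a derivative and
  contributes \<open>-n-1\<close>.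
\<close>

lemma intertwining_weight:
  assumes Y: "intertwining V M3 M1 M2 Y" and M: "weak_module V M1" "weak_module V M2" "weak_module V M3"
    and c: "conf V \<in> vcarrier V"
    and vw: "v \<in> wt_space V M1 k" "w \<in> wt_space V M2 l"
  shows "Y v n w \<in> wt_space V M3 (k + l - n - 1)"
proof -
  have vc: "v \<in> mcarrier M1" "w \<in> mcarrier M2" using vw by (simp_all add: wt_space_def)
  obtain K where K: "\<And>n. n \<ge> K \<Longrightarrow> mop M1 (conf V) n v = 0" using weak_moduleD(6)[OF M(1) c vc(1)] by blast
  define J where "J = max 2 (nat K)"
  have J: "mop M1 (conf V) (int i) v = 0" if "i \<ge> J" for i using that K[of "int i"] by (auto simp: J_def)
  let ?t = "\<lambda>i. msmult M3 (of_int 1 gchoose i) (Y (mop M1 (conf V) (int i) v) (of_int 1 + n - of_nat i) w)"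
  have "(\<Sum>i<J. ?t i) = (\<Sum>i<2. ?t i)"
  proof (rule sum.mono_neutral_right)
    show "\<forall>i\<in>{..<J} - {..<2}. ?t i = 0"
    proof
      fix i assume "i \<in> {..<J} - {..<2}"
      then have "1 choose i = 0" by (intro binomial_eq_0) auto
      then have "(of_int 1 gchoose i :: complex) = 0"
        by (metis binomial_gbinomial of_int_1 of_nat_0 of_nat_1)
      then show "?t i = 0" by (simp add: scale_simps[OF M(3)])
    qed
  qed (auto simp: J_def)
  moreover have "(\<Sum>i<2. ?t i) = Y (Lop V M1 (-1) v) (n + 1) w + Y (Lop V M1 0 v) n w"
    by (simp add: numeral_2_eq_2 scale_simps[OF M(3)] Lop_def add.commute)
  moreover have "Y (Lop V M1 (-1) v) (n + 1) w = msmult M3 (- (n + 1)) (Y v n w)"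
    using intertwiningD(6)[OF Y vc, of "n + 1"] by simp
  moreover have "Y (Lop V M1 0 v) n w = msmult M3 k (Y v n w)"
    using vw(1) lin_on_scale[OF intertwiningD(3)[OF Y vc(2)] vc(1)] by (simp add: wt_space_def)
  moreover have "Y v n (Lop V M2 0 w) = msmult M3 l (Y v n w)"
    using vw(2) lin_on_scale[OF intertwiningD(2)[OF Y vc(1)] vc(2)] by (simp add: wt_space_def)
  ultimately have "Lop V M3 0 (Y v n w) = msmult M3 l (Y v n w)
      + (msmult M3 (- (n + 1)) (Y v n w) + msmult M3 k (Y v n w))"
    using intertwining_commutator[OF Y M c vc J, where m = 1 and n = n] by (simp add: Lop_def)
  also have "\<dots> = msmult M3 (k + l - n - 1) (Y v n w)"
    by (simp add: scale_simps(6)[OF M(3), symmetric] algebra_simps)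
  finally show ?thesis using intertwiningD(1)[OF Y vc] by (simp add: wt_space_def)
qed

section \<open>The conformal vector and chains of intertwining operators\<close>

lemma wt_space_diff:
  assumes "weak_module V M" "conf V \<in> vcarrier V" "x \<in> wt_space V M l" "y \<in> wt_space V M l"
  shows "x - y \<in> wt_space V M l"
  using assms lin_on_diff[OF weak_moduleD(4)[OF assms(1,2)] assms(1), of x y] module_carrier(3)[OF assms(1)]
  by (auto simp: wt_space_def Lop_def scale_simps[OF assms(1)])

lemma is_voaD:
  assumes "is_voa V"
  shows "weak_module V (adjoint_mod V)" "vac V \<in> vcarrier V" "conf V \<in> vcarrier V"
    "u \<in> vcarrier V \<Longrightarrow> vop V u (-1) (vac V) = u"
    "u \<in> vcarrier V \<Longrightarrow> 0 \<le> n \<Longrightarrow> vop V u n (vac V) = 0"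
  using assms unfolding is_voa_def by auto

lemma adjoint_simps [simp]:
  "mcarrier (adjoint_mod V) = vcarrier V" "msmult (adjoint_mod V) = vsmult V" "mop (adjoint_mod V) = vop V"
  by (simp_all add: adjoint_mod_def)

text \<open>
  Both are Virasoro relations on the vacuum, because \<open>\<omega> = L(-2) 1\<close>.
\<close>

lemma conf_weight:
  assumes V: "is_voa V"
  shows "conf V \<in> wt_space V (adjoint_mod V) 2" "Lop V (adjoint_mod V) 1 (conf V) = 0"
proof -
  note v = is_voaD[OF V]
  note M = v(1)
  let ?L = "Lop V (adjoint_mod V)"
  obtain c where c: "?L m (?L n w) - ?L n (?L m w) = vsmult V (of_int (m - n)) (?L (m + n) w)
          + vsmult V (if m + n = 0 then of_int (m ^ 3 - m) / 12 * c else 0) w"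
    if "w \<in> vcarrier V" for m n w
    using V unfolding is_voa_def Let_def by blast
  have z: "vsmult V 0 x = 0" for x using scale_simps(2)[OF M] by simp
  have L0: "?L k 0 = 0" for k
    using lin_on_zero[OF weak_moduleD(4)[OF M v(3)] module_carrier(1)[OF M]] by (simp add: Lop_def)
  have Lv: "?L (-2) (vac V) = conf V" "k \<ge> -1 \<Longrightarrow> ?L k (vac V) = 0" for k
    using v(4,5)[OF v(3)] by (simp_all add: Lop_def)
  show "Lop V (adjoint_mod V) 1 (conf V) = 0"
    using c[OF v(2), of 1 "-2"] scale_simps(1)[OF M] by (simp add: Lv L0 z)
  have "?L 0 (conf V) = vsmult V 2 (conf V)"
    using c[OF v(2), of 0 "-2"] by (simp add: Lv L0 z)
  then show "conf V \<in> wt_space V (adjoint_mod V) 2"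
    using v(3) by (simp add: wt_space_def)
qed

text \<open>
  The chosen decomposition into homogeneous components is forced, since eigenvectors for
  different eigenvalues are independent.
\<close>

lemma hcomp_conf:
  assumes V: "is_voa V" shows "hcomp V (conf V) k = (if k = 2 then conf V else 0)"
proof -
  note v = is_voaD[OF V]
  note M = v(1)
  let ?W = "\<lambda>k::int. wt_space V (adjoint_mod V) (of_int k)"
  let ?P = "\<lambda>f. (\<forall>k. f k \<in> ?W k) \<and> finite {k. f k \<noteq> 0} \<and> conf V = Sum_any f"
  define h where "h k = (if k = 2 then conf V else 0)" for k :: int
  have hs: "{k. h k \<noteq> 0} \<subseteq> {2}" by (auto simp: h_def)
  have "Sum_any h = (\<Sum>k\<in>{2}. h k)" by (rule Sum_any.expand_superset) (use hs in auto)
  then have "?P h" using conf_weight(1)[OF V] wt_space_0[OF M v(3)] finite_subset[OF hs]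
    by (auto simp: h_def)
  then have P: "?P (hcomp V (conf V))" unfolding hcomp_def by (rule someI[of ?P h])
  define f where "f = hcomp V (conf V)"
  define F where "F = insert 2 {k. f k \<noteq> 0}"
  have fin: "finite F" using P by (simp add: F_def f_def)
  have "Sum_any f = (\<Sum>k\<in>F. f k)" using fin by (intro Sum_any.expand_superset) (auto simp: F_def)
  moreover have "(\<Sum>k\<in>F. h k) = conf V" using fin by (simp add: h_def F_def)
  ultimately have s: "(\<Sum>k\<in>F. f k - h k) = 0" using P by (simp add: sum_subtractf f_def)
  \<comment> \<open>the difference of the two decompositions, indexed by eigenvalues instead of integers\<close>
  define x where "x l = (\<Sum>k\<in>F. if of_int k = l then f k - h k else 0)" for l :: complex
  have x: "x (of_int k) = f k - h k" if "k \<in> F" for k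
    using that fin by (simp add: x_def)
  have W: "f k - h k \<in> ?W k" for k
    using P \<open>?P h\<close> by (auto simp: f_def intro!: wt_space_diff[OF M v(3)])
  have "x l = 0" if "l \<in> of_int ` F" for l
  proof (rule wt_space_sum_zero[OF M v(3), of "of_int ` F"])
    show "(\<Sum>l\<in>of_int ` F. x l) = 0"
      using s by (subst sum.reindex) (auto simp: inj_on_def x)
  qed (use fin that x W in auto)
  then have "f k = h k" if "k \<in> F" for k using x[OF that] that by auto
  moreover have "f k = h k" if "k \<notin> F" for k using that by (auto simp: F_def h_def)
  ultimately show ?thesis unfolding f_def h_def by metis
qed

text \<open>
  The adjoint of \<open>L(n)\<close> is \<open>L(-n)\<close>: as \<open>L(1)\<omega> = 0\<close> and \<open>\<omega>\<close> has weight 2, a single term of the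
  adjoint operator survives, with sign \<open>(-1)\<^sup>2\<close>.
\<close>

lemma adj_mode_conf:
  assumes V: "is_voa V" and M: "weak_module V M" and x: "x \<in> mcarrier M"
  shows "adj_mode V M (conf V) n x = mop M (conf V) (2 - n) x"
proof -
  note v = is_voaD[OF V]
  let ?L = "Lop V (adjoint_mod V) 1"
  have L0: "(?L ^^ j) 0 = 0" for j
  proof (induction j)
    case (Suc j)
    then show ?case
      using lin_on_zero[OF weak_moduleD(4)[OF v(1) v(3)] module_carrier(1)[OF v(1)]] by (simp add: Lop_def)
  qed simp
  have L1: "(?L ^^ Suc j) (conf V) = 0" for j
    unfolding funpow_Suc_right o_apply conf_weight(2)[OF V] by (rule L0)
  have z: "mop M 0 k x = 0" for k
    using lin_on_zero[OF weak_moduleD(5)[OF M x]] module_carrier(1)[OF v(1)] by simp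
  let ?t = "\<lambda>k j. msmult M ((-1) powi k / fact j)
     (mop M ((?L ^^ j) (hcomp V (conf V) k)) (2 * k - int j - n - 2) x)"
  have "Sum_any (\<lambda>k. Sum_any (?t k)) = (\<Sum>k\<in>{2}. Sum_any (?t k))"
    by (rule Sum_any.expand_superset)
      (auto simp: hcomp_conf[OF V] L0 z scale_simps[OF M] split: if_splits)
  also have "\<dots> = Sum_any (?t 2)" by simp
  also have "\<dots> = (\<Sum>j<1. ?t 2 j)"
  proof (rule Sum_any_lessThan)
    fix j :: nat assume "1 \<le> j"
    then obtain j' where "j = Suc j'" by (cases j) auto
    then have "(?L ^^ j) (hcomp V (conf V) 2) = 0" using L1 by (simp only: hcomp_conf[OF V] if_True simp_thms)
    then show "?t 2 j = 0" by (simp only: z scale_simps(1)[OF M])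
  qed
  also have "\<dots> = mop M (conf V) (2 - n) x" by (simp add: hcomp_conf[OF V] scale_simps[OF M])
  finally show ?thesis by (simp add: adj_mode_def)
qed

text \<open>
  By adjointness the mode acts as \<open>\<omega>(2-m)\<close> on the vacuum to the left, where modes with
  non-negative index vanish.
\<close>

lemma form_vac_conf:
  assumes V: "is_voa V" and f: "invariant_form V fm" and x: "x \<in> vcarrier V" and m: "m \<le> 2"
  shows "fm (vac V) (vop V (conf V) m x) = 0"
proof -
  note v = is_voaD[OF V]
  have "fm (vop V (conf V) (2 - m) (vac V)) x = fm (vac V) (adj_mode V (adjoint_mod V) (conf V) (2 - m) x)"
    using f v x unfolding invariant_form_def by blast
  also have "\<dots> = fm (vac V) (vop V (conf V) m x)"
    using adj_mode_conf[OF V v(1), of x "2 - m"] x by simp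
  finally have 1: "fm (vac V) (vop V (conf V) m x) = fm (vop V (conf V) (2 - m) (vac V)) x" by simp
  have "lin_on (vsmult V) (*) (vcarrier V) (\<lambda>u. fm u x)"
    using f x unfolding invariant_form_def by blast
  then have "fm 0 x = 0" using lin_on_zero module_carrier(1)[OF v(1)] by fastforce
  then show ?thesis unfolding 1 using v(5)[OF v(3), of "2 - m"] m by simp
qed

text \<open>
  Slot \<open>k\<close> of the chain carries a vector of \<open>S k\<close> and maps \<open>M (k+1)\<close> to \<open>M k\<close>; slot \<open>0\<close> is the
  leftmost one. The chain begins and ends in the vertex operator algebra.
\<close>

locale intertwiner_chain =
  fixes V :: "'w::ab_group_add voa" and fm :: "'w \<Rightarrow> 'w \<Rightarrow> complex"
    and M S :: "nat \<Rightarrow> ('w, 'w) vmod" and Y :: "nat \<Rightarrow> 'w intw_op" and N :: nat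
  assumes voa: "is_voa V" and inv_form: "invariant_form V fm"
    and ends: "M 0 = adjoint_mod V" "M N = adjoint_mod V"
    and weak_M: "k \<le> N \<Longrightarrow> weak_module V (M k)"
    and weak_S: "k < N \<Longrightarrow> weak_module V (S k)"
    and Y_intw: "k < N \<Longrightarrow> intertwining V (M k) (S k) (M (Suc k)) (Y k)"
begin

abbreviation om :: "('w, 'w) vmod \<Rightarrow> int \<Rightarrow> 'w \<Rightarrow> 'w" where
  "om X m x \<equiv> mop X (conf V) m x"

definition slots :: "(nat \<Rightarrow> 'w) \<Rightarrow> bool" where
  "slots v \<longleftrightarrow> (\<forall>k<N. v k \<in> mcarrier (S k))"

definition run :: "nat \<Rightarrow> nat \<Rightarrow> (nat \<Rightarrow> 'w) \<Rightarrow> (nat \<Rightarrow> complex) \<Rightarrow> 'w \<Rightarrow> 'w" where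
  "run i j v n s = foldr (\<lambda>k. Y k (v k) (n k)) [i..<j] s"

definition corr :: "(nat \<Rightarrow> 'w) \<Rightarrow> (nat \<Rightarrow> complex) \<Rightarrow> complex" where
  "corr v n = fm (vac V) (run 0 N v n (vac V))"

lemmas voaD = is_voaD[OF voa]

lemma run_same [simp]: "run i i v n s = s"
  by (simp add: run_def)

lemma run_Suc: "i \<le> j \<Longrightarrow> run i (Suc j) v n s = run i j v n (Y j (v j) (n j) s)"
  by (simp add: run_def)

lemma run_Cons: "i < j \<Longrightarrow> run i j v n s = Y i (v i) (n i) (run (Suc i) j v n s)"
  by (simp add: run_def upt_rec[of i j])

lemma run_append: "i \<le> j \<Longrightarrow> j \<le> k \<Longrightarrow> run i k v n s = run i j v n (run j k v n s)"
  unfolding run_def using upt_add_eq_append[of i j "k - j"] by simp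

lemma run_cong:
  "(\<And>k. i \<le> k \<Longrightarrow> k < j \<Longrightarrow> v k = v' k \<and> n k = n' k) \<Longrightarrow> run i j v n s = run i j v' n' s"
  unfolding run_def by (rule foldr_cong) auto

lemma Y_carrier: "k < N \<Longrightarrow> x \<in> mcarrier (S k) \<Longrightarrow> s \<in> mcarrier (M (Suc k)) \<Longrightarrow> Y k x n s \<in> mcarrier (M k)"
  by (rule intertwiningD(1)[OF Y_intw])

lemma run_carrier:
  "j \<le> N \<Longrightarrow> i \<le> j \<Longrightarrow> slots v \<Longrightarrow> s \<in> mcarrier (M j) \<Longrightarrow> run i j v n s \<in> mcarrier (M i)"
proof (induction j arbitrary: s)
  case (Suc j)
  show ?case
  proof (cases "i = Suc j")
    case False
    then have "run i j v n (Y j (v j) (n j) s) \<in> mcarrier (M i)"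
      using Suc.prems by (intro Suc.IH Y_carrier) (auto simp: slots_def)
    then show ?thesis using False Suc.prems by (simp add: run_Suc)
  qed (use Suc.prems in simp)
qed simp

lemma vac_M: "vac V \<in> mcarrier (M N)"
  using voaD(2) ends(2) by simp

lemma run_lin:
  "j \<le> N \<Longrightarrow> i \<le> j \<Longrightarrow> slots v \<Longrightarrow> lin_on (msmult (M j)) (msmult (M i)) (mcarrier (M j)) (run i j v n)"
proof (induction j)
  case (Suc j)
  show ?case
  proof (cases "i = Suc j")
    case False
    then have ij: "i \<le> j" using Suc.prems by simp
    have v: "v j \<in> mcarrier (S j)" using Suc.prems by (simp add: slots_def)
    have Yl: "lin_on (msmult (M (Suc j))) (msmult (M j)) (mcarrier (M (Suc j))) (Y j (v j) (n j))"
      using Suc.prems v by (intro intertwiningD(2)[OF Y_intw]) auto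
    have Yc: "s \<in> mcarrier (M (Suc j)) \<Longrightarrow> Y j (v j) (n j) s \<in> mcarrier (M j)" for s
      using Suc.prems v by (intro Y_carrier) auto
    have IH: "lin_on (msmult (M j)) (msmult (M i)) (mcarrier (M j)) (run i j v n)"
      using Suc ij by simp
    show ?thesis
      unfolding lin_on_def
      by (auto simp: run_Suc[OF ij] lin_on_add[OF Yl] lin_on_scale[OF Yl] lin_on_add[OF IH] lin_on_scale[OF IH] Yc)
  qed (simp add: lin_on_def run_def)
qed (simp add: lin_on_def run_def)

lemma form_lin: "lin_on (vsmult V) (*) (vcarrier V) (fm (vac V))"
  using inv_form voaD(2) by (simp add: invariant_form_def)

text \<open>
  The part of a correlator to the left of slot \<open>j\<close>, as a linear functional of the state that
  enters from the right. Working with this functional instead of the operators turns all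
  identities into identities of complex numbers.
\<close>

definition left_form :: "nat \<Rightarrow> (nat \<Rightarrow> 'w) \<Rightarrow> (nat \<Rightarrow> complex) \<Rightarrow> 'w \<Rightarrow> complex" where
  "left_form j v n s = fm (vac V) (run 0 j v n s)"

lemma left_form_lin: "j \<le> N \<Longrightarrow> slots v \<Longrightarrow> lin_on (msmult (M j)) (*) (mcarrier (M j)) (left_form j v n)"
proof -
  assume j: "j \<le> N" "slots v"
  note l = run_lin[OF j(1) _ j(2), of 0 n]
  have c: "s \<in> mcarrier (M j) \<Longrightarrow> run 0 j v n s \<in> vcarrier V" for s
    using run_carrier[OF j(1) _ j(2), of 0] ends(1) by fastforce
  show ?thesis
    unfolding lin_on_def left_form_def using l ends(1)
    by (auto simp: lin_on_add[OF l] lin_on_scale[OF l] lin_on_add[OF form_lin] lin_on_scale[OF form_lin] c)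
qed

lemma left_form_Suc: "left_form (Suc j) v n s = left_form j v n (Y j (v j) (n j) s)"
  by (simp add: left_form_def run_Suc)

lemma left_form_cong: "(\<And>k. k < j \<Longrightarrow> v k = v' k \<and> n k = n' k) \<Longrightarrow> left_form j v n s = left_form j v' n' s"
  unfolding left_form_def by (subst run_cong[where v' = v' and n' = n']) auto

lemma corr_left_form: "j \<le> N \<Longrightarrow> corr v n = left_form j v n (run j N v n (vac V))"
  by (simp add: corr_def left_form_def run_append[of 0 j N])

definition vput :: "nat \<Rightarrow> int \<Rightarrow> (nat \<Rightarrow> 'w) \<Rightarrow> nat \<Rightarrow> 'w" where
  "vput k q v = v(k := om (S k) q (v k))"

lemma om_S: "k < N \<Longrightarrow> x \<in> mcarrier (S k) \<Longrightarrow> om (S k) q x \<in> mcarrier (S k)"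
  by (rule weak_moduleD(3)[OF weak_S voaD(3)])

lemma om_M: "k \<le> N \<Longrightarrow> x \<in> mcarrier (M k) \<Longrightarrow> om (M k) q x \<in> mcarrier (M k)"
  by (rule weak_moduleD(3)[OF weak_M voaD(3)])

lemma slots_vput: "slots v \<Longrightarrow> slots (vput k q v)"
  using om_S by (auto simp: slots_def vput_def)

text \<open>
  A common truncation bound for all slots keeps the sums in the commutator formulas finite.
\<close>

definition annih :: "nat \<Rightarrow> (nat \<Rightarrow> 'w) \<Rightarrow> bool" where
  "annih J v \<longleftrightarrow> (\<forall>k<N. \<forall>q\<ge>J. om (S k) (int q) (v k) = 0)"

text \<open>
  The mode passes the slots one by one, and each slot leaves behind the terms of the commutator
  formula.
\<close>

lemma commutator:
  assumes "slots v" "annih J v"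
  shows "j \<le> N \<Longrightarrow> s \<in> mcarrier (M j) \<Longrightarrow> fm (vac V) (vop V (conf V) m (run 0 j v n s))
    = left_form j v n (om (M j) m s)
      + (\<Sum>k<j. \<Sum>q<J. (of_int m gchoose q) * left_form j (vput k q v) (n(k := of_int m + n k - of_nat q)) s)"
proof (induction j arbitrary: s)
  case 0
  then show ?case using ends(1) by (simp add: left_form_def)
next
  case (Suc j)
  then have j: "j < N" "j \<le> N" "Suc j \<le> N" by simp_all
  have v: "v j \<in> mcarrier (S j)" using assms(1) j by (simp add: slots_def)
  let ?s = "Y j (v j) (n j) s"
  have s: "?s \<in> mcarrier (M j)" by (rule Y_carrier[OF j(1) v Suc.prems(2)])
  note lin = left_form_lin[OF j(2) assms(1), of n]
  have c: "Y j (om (S j) (int q) (v j)) k s \<in> mcarrier (M j)" for q k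
    by (rule Y_carrier[OF j(1) om_S[OF j(1) v] Suc.prems(2)])
  let ?B = "\<lambda>q. msmult (M j) (of_int m gchoose q) (Y j (om (S j) (int q) (v j)) (of_int m + n j - of_nat q) s)"
  have 1: "om (M j) m ?s = Y j (v j) (n j) (om (M (Suc j)) m s) + (\<Sum>q<J. ?B q)"
    using j assms(2) Suc.prems v
    by (intro intertwining_commutator[OF Y_intw weak_S weak_M weak_M voaD(3)]) (auto simp: annih_def)
  note mc = module_carrier[OF weak_M[OF j(2)]]
  have B: "?B q \<in> mcarrier (M j)" for q by (intro mc(4) c)
  have "left_form j v n (om (M j) m ?s) = left_form j v n (Y j (v j) (n j) (om (M (Suc j)) m s)) + (\<Sum>q<J. left_form j v n (?B q))"
    unfolding 1
    by (subst lin_on_add[OF lin], rule Y_carrier[OF j(1) v om_M[OF j(3) Suc.prems(2)]], rule mc(5)[OF B],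
        subst lin_on_sum[OF lin weak_M[OF j(2)]], rule B, rule refl)
  also have "(\<Sum>q<J. left_form j v n (?B q)) = (\<Sum>q<J. (of_int m gchoose q)
      * left_form j v n (Y j (om (S j) (int q) (v j)) (of_int m + n j - of_nat q) s))"
    by (rule sum.cong[OF refl], rule lin_on_scale[OF lin c])
  finally have "left_form j v n (om (M j) m ?s) = left_form j v n (Y j (v j) (n j) (om (M (Suc j)) m s))
     + (\<Sum>q<J. (of_int m gchoose q) * left_form j v n (Y j (om (S j) (int q) (v j)) (of_int m + n j - of_nat q) s))" .
  moreover have "left_form j v n (Y j (om (S j) (int q) (v j)) (of_int m + n j - of_nat q) s)
      = left_form (Suc j) (vput j q v) (n(j := of_int m + n j - of_nat q)) s" for q
    unfolding left_form_Suc by (simp add: vput_def) (rule left_form_cong, auto)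
  moreover have "(\<Sum>k<j. \<Sum>q<J. (of_int m gchoose q) * left_form j (vput k q v) (n(k := of_int m + n k - of_nat q)) ?s)
      = (\<Sum>k<j. \<Sum>q<J. (of_int m gchoose q) * left_form (Suc j) (vput k q v) (n(k := of_int m + n k - of_nat q)) s)"
    by (intro sum.cong refl) (simp add: left_form_Suc vput_def)
  ultimately show ?case
    using Suc.IH[OF j(2) s] by (simp only: run_Suc[OF le0] left_form_Suc[of j v n] sum.lessThan_Suc add_ac)
qed

text \<open>
  The vacuum on the left kills the mode, so only the commutator terms remain.
\<close>

lemma vacuum_commutator:
  assumes "slots v" "annih J v" "j \<le> N" "s \<in> mcarrier (M j)" "m \<le> 2"
  shows "left_form j v n (om (M j) m s)
      = - (\<Sum>k<j. \<Sum>q<J. (of_int m gchoose q) * left_form j (vput k q v) (n(k := of_int m + n k - of_nat q)) s)"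
proof -
  have "run 0 j v n s \<in> vcarrier V" using run_carrier[OF assms(3) _ assms(1,4), of 0] ends(1) by simp
  then show ?thesis
    using commutator[OF assms(1-4), of m n] form_vac_conf[OF voa inv_form _ assms(5)]
    by (simp add: eq_neg_iff_add_eq_0)
qed

lemma corr_conf:
  assumes "slots v" "annih J v" "0 \<le> m"
  shows "fm (vac V) (vop V (conf V) m (run 0 N v n (vac V)))
    = (\<Sum>k<N. \<Sum>q<J. (of_int m gchoose q) * corr (vput k q v) (n(k := of_int m + n k - of_nat q)))"
proof -
  have "om (M N) m (vac V) = 0" using voaD(5)[OF voaD(3) assms(3)] ends(2) by simp
  moreover have "left_form N v n 0 = 0"
    using lin_on_zero[OF left_form_lin[OF _ assms(1)] module_carrier(1)[OF weak_M]] by simp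
  ultimately show ?thesis
    using commutator[OF assms(1,2) order_refl vac_M, of m n] by (simp add: corr_left_form[of N])
qed

text \<open>
  For \<open>m = 0, 1, 2\<close> the mode dies at both ends of the chain: these are the global conformal Ward
  identities.
\<close>

lemma ward:
  assumes "slots v" "annih J v" "0 \<le> m" "m \<le> 2"
  shows "(\<Sum>k<N. \<Sum>q<J. (of_int m gchoose q) * corr (vput k q v) (n(k := of_int m + n k - of_nat q))) = 0"
proof -
  have "run 0 N v n (vac V) \<in> vcarrier V" using run_carrier[OF order_refl _ assms(1) vac_M, of 0] ends(1) by simp
  then show ?thesis
    using corr_conf[OF assms(1-3), of n] form_vac_conf[OF voa inv_form _ assms(4)] by simp
qed

end

section \<open>Creation modes inside a chain\<close>

lemma gbinomial_neg_nat:
  "((- 1 - of_nat k) gchoose m :: complex) = (-1) ^ m * of_nat ((m + k) choose m)"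
  using gbinomial_negated_upper[of "- 1 - of_nat k :: complex" m]
    binomial_gbinomial[of "m + k" m, where 'a = complex]
  by (simp add: algebra_simps)

lemma binomial_swap: "(m + k) choose m = (k + m) choose (k::nat)"
  using binomial_symmetric[of m "m + k"] by (simp add: add.commute)

context intertwiner_chain
begin

lemma left_form_zero: "j \<le> N \<Longrightarrow> slots v \<Longrightarrow> left_form j v n 0 = 0"
  using lin_on_zero[OF left_form_lin module_carrier(1)[OF weak_M]] by blast

lemma corr_eq_zero:
  assumes "j < N" "slots v" "Y j (v j) (n j) (run (Suc j) N v n (vac V)) = 0"
  shows "corr v n = 0"
  using assms left_form_zero[of j v n] by (simp add: corr_left_form[of j] run_Cons)

lemma corr_cong: "(\<And>k. k < N \<Longrightarrow> v k = v' k \<and> n k = n' k) \<Longrightarrow> corr v n = corr v' n'"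
  unfolding corr_def by (subst run_cong[where v' = v' and n' = n']) auto

text \<open>
  The truncation bound depends on the state entering from the right only, so it is uniform in the
  modes to the left.
\<close>

lemma truncation:
  assumes "j < N" "slots v"
  shows "\<exists>T. \<forall>t\<ge>T. \<forall>n'. (\<forall>k>j. n' k = n k) \<and> n' j = n j + of_nat t
      \<longrightarrow> Y j (v j) (n' j) (run (Suc j) N v n' (vac V)) = 0"
proof -
  have s: "run (Suc j) N v n (vac V) \<in> mcarrier (M (Suc j))"
    using assms by (intro run_carrier vac_M) auto
  have v: "v j \<in> mcarrier (S j)" using assms by (simp add: slots_def)
  obtain B where B: "\<And>m. B \<le> Re m \<Longrightarrow> Y j (v j) m (run (Suc j) N v n (vac V)) = 0"
    using intertwiningD(4)[OF Y_intw[OF assms(1)] v s] by blast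
  show ?thesis
  proof (intro exI allI impI)
    fix t n' assume t: "nat \<lceil>B - Re (n j)\<rceil> \<le> t" and n': "(\<forall>k>j. n' k = n k) \<and> n' j = n j + of_nat t"
    have "run (Suc j) N v n' (vac V) = run (Suc j) N v n (vac V)"
      by (rule run_cong) (use n' in auto)
    moreover have "B \<le> Re (n' j)" using t n' by simp
    ultimately show "Y j (v j) (n' j) (run (Suc j) N v n' (vac V)) = 0" using B by simp
  qed
qed

lemma corr_truncation:
  assumes "j < N" "slots v"
  shows "\<exists>T. \<forall>t\<ge>T. \<forall>n'. (\<forall>k>j. n' k = n k) \<and> n' j = n j + of_nat t \<longrightarrow> corr v n' = 0"
  using truncation[OF assms, of n] corr_eq_zero[OF assms] by blast

text \<open>
  Moving the mode through the first \<open>j\<close> slots and moving it through all slots start from the same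
  number, so the two results differ by the commutators with the other slots.
\<close>

lemma inner_commutator:
  assumes "slots v" "annih J v" "j \<le> N"
  shows "left_form j v n (om (M j) (int m) (run j N v n (vac V)))
    = (\<Sum>k\<in>{j..<N}. \<Sum>q<J. (of_nat m gchoose q) * corr (vput k q v) (n(k := of_nat m + n k - of_nat q)))"
proof -
  let ?s = "run j N v n (vac V)"
  let ?t = "\<lambda>k. \<Sum>q<J. (of_nat m gchoose q) * corr (vput k q v) (n(k := of_nat m + n k - of_nat q))"
  have s: "?s \<in> mcarrier (M j)" by (intro run_carrier vac_M assms) auto
  have "left_form j (vput k q v) (n(k := x)) ?s = corr (vput k q v) (n(k := x))" if "k < j" for k q x
  proof -
    have "run j N (vput k q v) (n(k := x)) (vac V) = ?s"
      by (rule run_cong) (use that in \<open>auto simp: vput_def\<close>)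
    then show ?thesis by (simp add: corr_left_form[OF assms(3)])
  qed
  then have "(\<Sum>k<j. \<Sum>q<J. (of_int (int m) gchoose q) * left_form j (vput k q v) (n(k := of_int (int m) + n k - of_nat q)) ?s)
      = (\<Sum>k<j. ?t k)" by simp
  moreover have "fm (vac V) (vop V (conf V) (int m) (run 0 j v n ?s)) = (\<Sum>k<N. ?t k)"
    using corr_conf[OF assms(1,2), of "int m" n] by (simp add: run_append[OF le0 assms(3), symmetric])
  moreover have "(\<Sum>k<N. ?t k) = (\<Sum>k<j. ?t k) + (\<Sum>k\<in>{j..<N}. ?t k)"
    using sum.atLeastLessThan_concat[of 0 j N ?t] assms(3) by (simp add: lessThan_atLeast0)
  ultimately show ?thesis
    using commutator[OF assms(1,2,3) s, of "int m" n] by simp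
qed

text \<open>
  A term of \<open>(1/p! q!) \<partial>\<^sub>x\<^sup>p \<partial>\<^sub>y\<^sup>q (1/(x-y))\<close> applied to a correlator in modes, for \<open>x\<close> at slot
  \<open>i\<close> and \<open>y\<close> at a slot \<open>k\<close> to the left of it. There \<open>\<bar>y\<bar> > \<bar>x\<bar>\<close>, and powers \<open>x^s\<close> with \<open>s < p\<close>
  are annihilated by the derivative, so the summation index is \<open>t = s - p\<close>.
\<close>

definition outer_term :: "nat \<Rightarrow> nat \<Rightarrow> nat \<Rightarrow> nat \<Rightarrow> (nat \<Rightarrow> 'w) \<Rightarrow> (nat \<Rightarrow> complex) \<Rightarrow> nat \<Rightarrow> complex" where
  "outer_term p q i k w n t = - of_nat ((t + p) choose p) * ((- 1 - of_nat (t + p)) gchoose q)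
     * corr w (n(i := n i + of_nat t, k := n k - 1 - of_nat (t + p) - of_nat q))"

text \<open>
  The same for a slot \<open>k\<close> to the right of \<open>i\<close>, where \<open>\<bar>x\<bar> > \<bar>y\<bar>\<close>.
\<close>

definition inner_term :: "nat \<Rightarrow> nat \<Rightarrow> nat \<Rightarrow> nat \<Rightarrow> (nat \<Rightarrow> 'w) \<Rightarrow> (nat \<Rightarrow> complex) \<Rightarrow> nat \<Rightarrow> complex" where
  "inner_term p q i k w n t = ((- 1 - of_nat t) gchoose p) * (of_nat t gchoose q)
     * corr w (n(i := n i - 1 - of_nat (t + p), k := n k + of_nat t - of_nat q))"

text \<open>
  The associativity formula replaces \<open>\<omega>(-1-p)\<close> in slot \<open>i\<close> by modes \<open>\<omega>(-1-p-t)\<close> to its left and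
  \<open>\<omega>(t)\<close> to its right. The former move on to the left vacuum and the latter to the right one,
  where they vanish, so that only commutators with the other slots remain. The sums over \<open>t\<close> are
  cut off at \<open>P\<close>; the value does not depend on \<open>P\<close> once it is large.
\<close>

lemma creation_insertion:
  assumes i: "i < N" and v: "slots v" "annih J v"
  shows "\<exists>P0. \<forall>P\<ge>P0. corr (vput i (- 1 - int p) v) n =
      (\<Sum>k<i. \<Sum>q<J. \<Sum>t<P. outer_term p q i k (vput k q v) n t)
    + (\<Sum>k\<in>{Suc i..<N}. \<Sum>q<J. \<Sum>t<P. inner_term p q i k (vput k q v) n t)"
proof -
  let ?s = "run (Suc i) N v n (vac V)"
  have iN: "i \<le> N" "Suc i \<le> N" using i by simp_all
  have s: "?s \<in> mcarrier (M (Suc i))" by (intro run_carrier vac_M v) (use i in auto)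
  have vi: "v i \<in> mcarrier (S i)" using v i by (simp add: slots_def)
  note Yi = Y_intw[OF i]
  obtain T1 where T1: "\<forall>t\<ge>T1. \<forall>n'. (\<forall>k>i. n' k = n k) \<and> n' i = n i + of_nat t
      \<longrightarrow> Y i (v i) (n' i) (run (Suc i) N v n' (vac V)) = 0" using truncation[OF i v(1), of n] by blast
  have T1': "Y i (v i) (n i + of_nat t) ?s = 0" if "t \<ge> T1" for t
  proof -
    have "run (Suc i) N v (n(i := n i + of_nat t)) (vac V) = ?s" by (rule run_cong) auto
    then show ?thesis using T1[rule_format, of t "n(i := n i + of_nat t)"] that by simp
  qed
  obtain T2 where T2: "\<And>m. m \<ge> T2 \<Longrightarrow> om (M (Suc i)) m ?s = 0"
    using weak_moduleD(6)[OF weak_M[OF iN(2)] voaD(3) s] by blast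
  show ?thesis
  proof (intro exI allI impI)
    fix P assume P: "max T1 (nat T2) \<le> P"
    let ?c = "\<lambda>t. (-1) ^ t * (of_int (- 1 - int p) gchoose t) :: complex"
    let ?A = "\<lambda>t. om (M i) (- 1 - int p - int t) (Y i (v i) (n i + of_nat t) ?s)"
    let ?B = "\<lambda>t. Y i (v i) (n i + of_int (- 1 - int p) - of_nat t) (om (M (Suc i)) (int t) ?s)"
    have ct: "?c t = of_nat ((t + p) choose p)" for t
      using gbinomial_neg_nat[of p t] binomial_swap[of p t]
      by (simp add: power_mult_distrib[symmetric] mult.assoc[symmetric] add.commute)
    have Ac: "?A t \<in> mcarrier (M i)" for t
      by (intro om_M Y_carrier iN vi s i)
    have Bc: "?B t \<in> mcarrier (M i)" for t
      by (intro om_M Y_carrier iN vi s i)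
    note lin = left_form_lin[OF iN(1) v(1), of n]
    note mc = module_carrier[OF weak_M[OF iN(1)]]
    have "corr (vput i (- 1 - int p) v) n = left_form i v n (Y i (om (S i) (- 1 - int p) (v i)) (n i) ?s)"
    proof -
      have "run (Suc i) N (vput i (- 1 - int p) v) n (vac V) = ?s"
        by (rule run_cong) (auto simp: vput_def)
      moreover have "left_form i (vput i (- 1 - int p) v) n x = left_form i v n x" for x
        by (rule left_form_cong) (auto simp: vput_def)
      moreover have "vput i (- 1 - int p) v i = om (S i) (- 1 - int p) (v i)" by (simp add: vput_def)
      ultimately show ?thesis by (simp add: corr_left_form[OF iN(1)] run_Cons[OF i])
    qed
    \<comment> \<open>modes to the left of slot \<open>i\<close> in \<open>?A\<close>, modes to its right in \<open>?B\<close>\<close>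
    also have "Y i (om (S i) (- 1 - int p) (v i)) (n i) ?s
        = (\<Sum>t<P. msmult (M i) (?c t) (?A t - msmult (M i) ((-1) powi (- 1 - int p)) (?B t)))"
      using P T1' T2 i
      by (intro intertwining_associator[OF Yi weak_S weak_M weak_M voaD(3) vi s]) auto
    also have "left_form i v n \<dots> = (\<Sum>t<P. ?c t * (left_form i v n (?A t) - (-1) powi (- 1 - int p) * left_form i v n (?B t)))"
      by (subst lin_on_sum[OF lin weak_M[OF iN(1)]], intro mc Ac Bc,
          intro sum.cong refl, subst lin_on_scale[OF lin], intro mc Ac Bc,
          subst lin_on_diff[OF lin weak_M[OF iN(1)]], rule Ac, intro mc Bc,
          subst lin_on_scale[OF lin Bc], rule refl)
    also have "\<dots> = (\<Sum>t<P. ?c t * left_form i v n (?A t)) + (\<Sum>t<P. (-1) ^ p * ?c t * left_form i v n (?B t))"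
    proof -
      have "(-1 :: complex) powi (- 1 - int p) = - ((-1) ^ p)"
        by (simp add: power_int_diff power_int_minus minus_one_power_iff)
      then show ?thesis
        by (simp only: sum.distrib[symmetric]) (simp add: algebra_simps)
    qed
    also have "(\<Sum>t<P. ?c t * left_form i v n (?A t)) = (\<Sum>t<P. \<Sum>k<i. \<Sum>q<J.
        outer_term p q i k (vput k q v) n t)"
    proof (rule sum.cong[OF refl])
      fix t
      have "left_form i (vput k q v) (n(k := x)) (Y i (v i) (n i + of_nat t) ?s)
          = corr (vput k q v) (n(i := n i + of_nat t, k := x))" if "k < i" for k q x
      proof -
        have "run (Suc i) N (vput k q v) (n(i := n i + of_nat t, k := x)) (vac V) = ?s"
          by (rule run_cong) (use that in \<open>auto simp: vput_def\<close>)
        moreover have "left_form i (vput k q v) (n(i := n i + of_nat t, k := x)) y = left_form i (vput k q v) (n(k := x)) y" for y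
          by (rule left_form_cong) auto
        ultimately show ?thesis using that by (simp add: corr_left_form[OF iN(1)] run_Cons[OF i] vput_def)
      qed
      moreover have "left_form i v n (?A t) = - (\<Sum>k<i. \<Sum>q<J. (of_int (- 1 - int p - int t) gchoose q)
          * left_form i (vput k q v) (n(k := of_int (- 1 - int p - int t) + n k - of_nat q)) (Y i (v i) (n i + of_nat t) ?s))"
        by (rule vacuum_commutator[OF v iN(1) Y_carrier[OF i vi s]]) simp
      ultimately have "left_form i v n (?A t) = - (\<Sum>k<i. \<Sum>q<J. ((- 1 - of_nat (t + p)) gchoose q)
          * corr (vput k q v) (n(i := n i + of_nat t, k := n k - 1 - of_nat (t + p) - of_nat q)))"
        by (simp add: algebra_simps)
      then show "?c t * left_form i v n (?A t) = (\<Sum>k<i. \<Sum>q<J.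
        outer_term p q i k (vput k q v) n t)"
        unfolding ct outer_term_def by (simp only: sum_distrib_left sum_negf[symmetric] mult_minus_left mult_minus_right mult.assoc)
    qed
    also have "(\<Sum>t<P. (-1) ^ p * ?c t * left_form i v n (?B t)) = (\<Sum>t<P. \<Sum>k\<in>{Suc i..<N}. \<Sum>q<J.
        inner_term p q i k (vput k q v) n t)"
    proof (rule sum.cong[OF refl])
      fix t
      let ?n = "n(i := n i - 1 - of_nat (t + p))"
      have "?B t = Y i (v i) (?n i) (om (M (Suc i)) (int t) ?s)" by (simp add: algebra_simps)
      moreover have "run (Suc i) N v ?n (vac V) = ?s" by (rule run_cong) auto
      moreover have "left_form i v ?n x = left_form i v n x" for x by (rule left_form_cong) auto
      ultimately have "left_form i v n (?B t) = left_form (Suc i) v ?n (om (M (Suc i)) (int t) (run (Suc i) N v ?n (vac V)))"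
        by (simp add: left_form_Suc)
      also have "\<dots> = (\<Sum>k\<in>{Suc i..<N}. \<Sum>q<J. (of_nat t gchoose q)
          * corr (vput k q v) (?n(k := of_nat t + ?n k - of_nat q)))"
        by (rule inner_commutator[OF v iN(2)])
      also have "\<dots> = (\<Sum>k\<in>{Suc i..<N}. \<Sum>q<J. (of_nat t gchoose q)
          * corr (vput k q v) (n(i := n i - 1 - of_nat (t + p), k := n k + of_nat t - of_nat q)))"
        by (intro sum.cong refl) (auto simp: algebra_simps)
      finally have B: "left_form i v n (?B t) = \<dots>" .
      have "(-1) ^ p * ?c t = ((- 1 - of_nat t) gchoose p)"
        unfolding ct gbinomial_neg_nat by (simp add: add.commute)
      then show "(-1) ^ p * ?c t * left_form i v n (?B t) = (\<Sum>k\<in>{Suc i..<N}. \<Sum>q<J.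
        inner_term p q i k (vput k q v) n t)"
        unfolding B inner_term_def by (simp only: sum_distrib_left mult.assoc)
    qed
    finally show "corr (vput i (- 1 - int p) v) n =
      (\<Sum>k<i. \<Sum>q<J. \<Sum>t<P. outer_term p q i k (vput k q v) n t)
    + (\<Sum>k\<in>{Suc i..<N}. \<Sum>q<J. \<Sum>t<P. inner_term p q i k (vput k q v) n t)"
      by (simp only: sum.swap[of _ "{..<P}"])
  qed
qed

end

section \<open>Genus zero recursion\<close>

text \<open>
  The variables of the slots are ordered as in the expansion: a slot further left has higher
  rank.
\<close>

locale correlator = intertwiner_chain V fm M S Y N + expansion g r
  for V :: "'w::ab_group_add voa" and fm and M S :: "nat \<Rightarrow> ('w, 'w) vmod" and Y N g r +
  fixes z :: "nat \<Rightarrow> var"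
  assumes z_bij: "bij_betw z {..<N} (VW ` Iset g)"
    and z_order: "k < k' \<Longrightarrow> k' < N \<Longrightarrow> r (z k') < r (z k)"
    and z_VX: "k < N \<Longrightarrow> r (z k) < r VX"
begin

definition pureW :: "(var \<Rightarrow> complex) \<Rightarrow> bool" where
  "pureW e \<longleftrightarrow> (\<forall>u. u \<notin> VW ` Iset g \<longrightarrow> e u = 0)"

definition modes :: "(var \<Rightarrow> complex) \<Rightarrow> nat \<Rightarrow> complex" where
  "modes e k = - e (z k) - 1"

definition corr_series :: "(nat \<Rightarrow> 'w) \<Rightarrow> fseries" where
  "corr_series v e = (if pureW e then corr v (modes e) else 0)"

definition conf_corr_series :: "(nat \<Rightarrow> 'w) \<Rightarrow> fseries" where
  "conf_corr_series v e = (if \<forall>u. u \<notin> insert VX (VW ` Iset g) \<longrightarrow> e u = 0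
     then fm (vac V) (cmodes (vop V) (conf V) (- e VX - 1) (run 0 N v (modes e) (vac V))) else 0)"

lemma z_in: "k < N \<Longrightarrow> z k \<in> VW ` Iset g"
  using z_bij by (auto simp: bij_betw_def)

lemma z_eq: "k < N \<Longrightarrow> k' < N \<Longrightarrow> z k = z k' \<longleftrightarrow> k = k'"
  using z_bij by (auto simp: bij_betw_def inj_on_def)

lemma z_modvar: "k < N \<Longrightarrow> modvar (z k)"
  using z_in[of k] by auto

lemma z_neq: "k < N \<Longrightarrow> z k \<noteq> VX" "k < N \<Longrightarrow> z k \<noteq> VY"
  using z_in[of k] by auto

lemma pureW_shift: "k < N \<Longrightarrow> pureW (e + single (z k) a) \<longleftrightarrow> pureW e"
proof -
  assume "k < N"
  then have "(e + single (z k) a) u = e u" if "u \<notin> VW ` Iset g" for u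
    using that z_in[of k] by (auto simp: single_def)
  then show ?thesis unfolding pureW_def by (metis (no_types, lifting))
qed

lemma modes_shift: "k < N \<Longrightarrow> j < N \<Longrightarrow> modes (e + single (z k) a) j = (if j = k then modes e k - a else modes e j)"
  by (auto simp: modes_def z_eq single_def)

lemma corr_series_shift:
  assumes "k < N"
  shows "corr_series w (e + single (z k) a) = (if pureW e then corr w ((modes e)(k := modes e k - a)) else 0)"
proof -
  have "corr w (modes (e + single (z k) a)) = corr w ((modes e)(k := modes e k - a))"
    by (rule corr_cong) (use assms in \<open>auto simp: modes_shift\<close>)
  then show ?thesis using assms by (simp only: corr_series_def pureW_shift)
qed

lemma corr_series_shift2:
  assumes "k < N" "i < N" "i \<noteq> k"
  shows "corr_series w (e + single (z i) a + single (z k) b)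
    = (if pureW e then corr w ((modes e)(i := modes e i - a, k := modes e k - b)) else 0)"
proof -
  have "corr w (modes (e + single (z i) a + single (z k) b)) = corr w ((modes e)(i := modes e i - a, k := modes e k - b))"
    by (rule corr_cong) (use assms in \<open>auto simp: modes_shift\<close>)
  then show ?thesis using assms by (simp only: corr_series_def pureW_shift)
qed

lemma Sum_any_nat_offset:
  assumes "\<And>k. k < p \<Longrightarrow> f k = 0" "\<And>t. t \<ge> T \<Longrightarrow> f (t + p) = 0"
  shows "Sum_any f = (\<Sum>t<T. f (t + (p::nat)))"
proof -
  have "Sum_any f = Sum_any (\<lambda>t. f (t + p))"
  proof (rule Sum_any_inj)
    fix d assume "d \<notin> range (\<lambda>t. t + p)"
    then have "d < p" by (metis le_add_diff_inverse2 not_less rangeI)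
    then show "f d = 0" by (rule assms(1))
  qed simp
  also have "\<dots> = (\<Sum>t<T. f (t + p))" by (rule Sum_any_lessThan) (rule assms(2))
  finally show ?thesis .
qed

text \<open>
  The partial sums are eventually constant, by truncation at slot \<open>k\<close>. Stating this with
  \<open>eventually\<close> allows one common cut-off for all slots later.
\<close>

lemma pole_at_inner:
  assumes "i < k" "k < N" "slots w"
  shows "eventually (\<lambda>P. (dderiv (z i) p (z k) q (inv_diff r (z i) (z k)) \<star> corr_series w) e
    = (if pureW e then \<Sum>t<P. inner_term p q i k w (modes e) t else 0))
    sequentially"
proof -
  have iN: "i < N" and ne: "z i \<noteq> z k" using assms z_eq[of i k] by auto
  have I: "inv_diff r (z i) (z k) = geom (z i) (z k)"
    using z_order[OF assms(1,2)] by (simp add: inv_diff_geom)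
  obtain T where T: "\<And>t n'. t \<ge> T \<Longrightarrow> (\<forall>j>k. n' j = modes e j) \<Longrightarrow>
      n' k = ((modes e)(k := modes e k - of_nat q)) k + of_nat t \<Longrightarrow> corr w n' = 0"
    using corr_truncation[OF assms(2,3), of "(modes e)(k := modes e k - of_nat q)"] by fastforce
  show ?thesis
    unfolding eventually_sequentially inner_term_def
  proof (intro exI allI impI)
    fix P assume P: "T \<le> P"
    let ?f = "\<lambda>t. ((- 1 - of_nat t) gchoose p) * (of_nat t gchoose q)
         * corr w ((modes e)(i := modes e i - 1 - of_nat (t + p), k := modes e k + of_nat t - of_nat q))"
    have "corr_series w (e + single (z i) (1 + of_nat t + of_nat p) - single (z k) (of_nat t - of_nat q))
       = (if pureW e then corr w ((modes e)(i := modes e i - 1 - of_nat (t + p), k := modes e k + of_nat t - of_nat q)) else 0)" for t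
    proof -
      have E: "e + single (z i) (1 + of_nat t + of_nat p) - single (z k) (of_nat t - of_nat q)
        = e + single (z i) (1 + of_nat t + of_nat p) + single (z k) (of_nat q - of_nat t)"
        by (simp only: diff_conv_add_uminus[of "e + _"] single_uminus minus_diff_eq)
      show ?thesis unfolding E
        using corr_series_shift2[OF assms(2) iN, of w e "1 + of_nat t + of_nat p" "of_nat q - of_nat t"] assms(1)
        by (simp add: algebra_simps)
    qed
    then have *: "(dderiv (z i) p (z k) q (inv_diff r (z i) (z k)) \<star> corr_series w) e
        = Sum_any (\<lambda>t. if pureW e then ?f t else 0)"
      unfolding I dderiv_geom_fmul[OF ne] by (intro Sum_any.cong) simp
    show "(dderiv (z i) p (z k) q (inv_diff r (z i) (z k)) \<star> corr_series w) e = (if pureW e then \<Sum>t<P. ?f t else 0)"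
    proof (cases "pureW e")
      case True
      have "?f t = 0" if "t \<ge> P" for t
        using T[of t "(modes e)(i := modes e i - 1 - of_nat (t + p), k := modes e k + of_nat t - of_nat q)"]
          that P assms(1) by simp
      then show ?thesis using True unfolding * by (simp add: Sum_any_lessThan[of P])
    qed (simp add: *)
  qed
qed

text \<open>
  Here the truncation takes place at slot \<open>i\<close>, the inner one of the two.
\<close>

lemma pole_at_outer:
  assumes "k < i" "i < N" "slots w"
  shows "eventually (\<lambda>P. (dderiv (z i) p (z k) q (inv_diff r (z i) (z k)) \<star> corr_series w) e
    = (if pureW e then \<Sum>t<P. outer_term p q i k w (modes e) t else 0))
    sequentially"
proof -
  have kN: "k < N" and ne: "z i \<noteq> z k" "z k \<noteq> z i" using assms z_eq[of i k] by auto
  have I: "inv_diff r (z i) (z k) = - geom (z k) (z i)"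
    using z_order[OF assms(1,2)] by (simp add: inv_diff_geom)
  obtain T where T: "\<And>t n'. t \<ge> T \<Longrightarrow> (\<forall>j>i. n' j = modes e j) \<Longrightarrow>
      n' i = modes e i + of_nat t \<Longrightarrow> corr w n' = 0"
    using corr_truncation[OF assms(2,3), of "modes e"] by fastforce
  show ?thesis
    unfolding eventually_sequentially outer_term_def
  proof (intro exI allI impI)
    fix P assume P: "T \<le> P"
    let ?n = "\<lambda>t. (modes e)(i := modes e i + of_nat t - of_nat p, k := modes e k - 1 - of_nat t - of_nat q)"
    let ?f = "\<lambda>t. of_nat (t choose p) * ((- 1 - of_nat t) gchoose q) * corr w (?n t)"
    have "corr_series w (e + single (z k) (1 + of_nat t + of_nat q) - single (z i) (of_nat t - of_nat p))
       = (if pureW e then corr w (?n t) else 0)" for t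
    proof -
      have E: "e + single (z k) (1 + of_nat t + of_nat q) - single (z i) (of_nat t - of_nat p)
        = e + single (z i) (of_nat p - of_nat t) + single (z k) (1 + of_nat t + of_nat q)"
        by (simp only: diff_conv_add_uminus[of "e + _"] single_uminus minus_diff_eq add_ac)
      show ?thesis unfolding E
        using corr_series_shift2[OF kN assms(2), of w e "of_nat p - of_nat t" "1 + of_nat t + of_nat q"] assms(1)
        by (simp add: algebra_simps)
    qed
    note * = this
    have **: "(dderiv (z i) p (z k) q (inv_diff r (z i) (z k)) \<star> corr_series w) e
        = - Sum_any (\<lambda>t. if pureW e then ?f t else 0)"
    proof -
      have "dderiv (z i) p (z k) q (inv_diff r (z i) (z k)) \<star> corr_series w = - (dderiv (z k) q (z i) p (geom (z k) (z i)) \<star> corr_series w)"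
        unfolding I dderiv_uminus[OF ne(1)] fmul_uminus_left dderiv_swap[OF ne(1), of p q] ..
      moreover have "(dderiv (z k) q (z i) p (geom (z k) (z i)) \<star> corr_series w) e = Sum_any (\<lambda>t. if pureW e then ?f t else 0)"
        unfolding dderiv_geom_fmul[OF ne(2)] * by (rule Sum_any.cong) (simp add: binomial_gbinomial)
      ultimately show ?thesis by simp
    qed
    show "(dderiv (z i) p (z k) q (inv_diff r (z i) (z k)) \<star> corr_series w) e
      = (if pureW e then \<Sum>t<P. - of_nat ((t + p) choose p) * ((- 1 - of_nat (t + p)) gchoose q)
         * corr w ((modes e)(i := modes e i + of_nat t, k := modes e k - 1 - of_nat (t + p) - of_nat q)) else 0)"
    proof (cases "pureW e")
      case True
      have "?f (t + p) = 0" if "t \<ge> P" for t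
        using T[of t "?n (t + p)"] that P assms(1) by simp
      then have "Sum_any ?f = (\<Sum>t<P. ?f (t + p))" by (intro Sum_any_nat_offset) (auto simp: binomial_eq_0)
      then show ?thesis using True unfolding ** by (simp add: sum_negf algebra_simps)
    qed (simp add: **)
  qed
qed

text \<open>
  In terms of generating series, a creation mode is a Taylor coefficient, at its own point, of
  the sum of the poles at the other points.
\<close>

lemma creation_series:
  assumes i: "i < N" and v: "slots v" "annih J v"
  shows "corr_series (vput i (- 1 - int p) v)
    = (\<Sum>k\<in>{..<N} - {i}. \<Sum>q<J. dderiv (z i) p (z k) q (inv_diff r (z i) (z k)) \<star> corr_series (vput k q v))"
proof
  fix e
  let ?D = "\<lambda>k q. (dderiv (z i) p (z k) q (inv_diff r (z i) (z k)) \<star> corr_series (vput k q v)) e"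
  define R where "R P k q = (if pureW e then if k < i
      then \<Sum>t<P. outer_term p q i k (vput k q v) (modes e) t
      else \<Sum>t<P. inner_term p q i k (vput k q v) (modes e) t else 0)"
    for P k and q :: nat
  have "eventually (\<lambda>P. ?D k q = R P k q) sequentially" if "k \<in> {..<N} - {i}" for k q
  proof (cases "k < i")
    case True
    show ?thesis unfolding R_def
      using pole_at_outer[OF True i slots_vput[OF v(1), of k "int q"], where p = p and q = q and e = e] by (simp only: True if_True)
  next
    case False
    then have "i < k" "k < N" using that by auto
    from pole_at_inner[OF this slots_vput[OF v(1), of k "int q"], where p = p and q = q and e = e] show ?thesis
      unfolding R_def by (simp only: False if_False)
  qed
  then have "eventually (\<lambda>P. \<forall>k\<in>{..<N} - {i}. \<forall>q\<in>{..<J}. ?D k q = R P k q) sequentially"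
    by (intro eventually_ball_finite ballI) auto
  moreover have "eventually (\<lambda>P. corr_series (vput i (- 1 - int p) v) e
      = (\<Sum>k<i. \<Sum>q<J. R P k q) + (\<Sum>k\<in>{Suc i..<N}. \<Sum>q<J. R P k q)) sequentially"
  proof -
    obtain P0 where "\<And>P. P \<ge> P0 \<Longrightarrow> corr (vput i (- 1 - int p) v) (modes e) =
      (\<Sum>k<i. \<Sum>q<J. \<Sum>t<P. outer_term p q i k (vput k q v) (modes e) t)
    + (\<Sum>k\<in>{Suc i..<N}. \<Sum>q<J. \<Sum>t<P. inner_term p q i k (vput k q v) (modes e) t)"
      using creation_insertion[OF i v, of p "modes e"] by blast
    then show ?thesis
      unfolding eventually_sequentially by (intro exI[of _ P0]) (auto simp: corr_series_def R_def)
  qed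
  ultimately have "eventually (\<lambda>P. corr_series (vput i (- 1 - int p) v) e
      = (\<Sum>k<i. \<Sum>q<J. ?D k q) + (\<Sum>k\<in>{Suc i..<N}. \<Sum>q<J. ?D k q)) sequentially"
  proof eventually_elim
    case (elim P)
    have "(\<Sum>k<i. \<Sum>q<J. R P k q) = (\<Sum>k<i. \<Sum>q<J. ?D k q)"
      using elim(1) i by (intro sum.cong refl) auto
    moreover have "(\<Sum>k\<in>{Suc i..<N}. \<Sum>q<J. R P k q) = (\<Sum>k\<in>{Suc i..<N}. \<Sum>q<J. ?D k q)"
      using elim(1) by (intro sum.cong refl) auto
    ultimately show ?case using elim(2) by simp
  qed
  then have "corr_series (vput i (- 1 - int p) v) e = (\<Sum>k<i. \<Sum>q<J. ?D k q) + (\<Sum>k\<in>{Suc i..<N}. \<Sum>q<J. ?D k q)"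
    by simp
  also have "\<dots> = (\<Sum>k\<in>{..<N} - {i}. \<Sum>q<J. ?D k q)"
  proof -
    have "{..<N} - {i} = {..<i} \<union> {Suc i..<N}" using i by auto
    moreover have ivl_disj: "{..<i} \<inter> {Suc i..<N} = {}" by auto
    ultimately show ?thesis by (simp only: sum.union_disjoint[of "{..<i}" "{Suc i..<N}"]
          finite_lessThan finite_atLeastLessThan ivl_disj)
  qed
  finally show "corr_series (vput i (- 1 - int p) v) e = (\<Sum>k\<in>{..<N} - {i}. \<Sum>q<J.
      dderiv (z i) p (z k) q (inv_diff r (z i) (z k)) \<star> corr_series (vput k q v)) e"
    by (simp add: sum_fun_app)
qed

text \<open>
  The coefficient of \<open>x^(-m-1)\<close> is \<open>corr_conf\<close> for \<open>m \<ge> 0\<close>; for all other exponents of \<open>x\<close> both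
  sides vanish, for negative \<open>m\<close> because of the vacuum on the left.
\<close>

lemma conf_series:
  assumes v: "slots v" "annih J v"
  shows "conf_corr_series v = (\<Sum>k<N. \<Sum>q<J. dderiv VX 0 (z k) q (inv_diff r VX (z k)) \<star> corr_series (vput k q v))"
proof
  fix e
  let ?D = "\<lambda>k q. (dderiv VX 0 (z k) q (inv_diff r VX (z k)) \<star> corr_series (vput k q v)) e"
  let ?e = "\<lambda>t. e + single VX (1 + of_nat t)"
  have G: "corr_series (vput k q v) (e + single VX (1 + of_nat t + of_nat 0) - single (z k) (of_nat t - of_nat q))
      = (if pureW (?e t) then corr (vput k q v) ((modes e)(k := modes e k + of_nat t - of_nat q)) else 0)"
    if "k < N" for k t and q :: nat
  proof -
    have E: "e + single VX (1 + of_nat t + of_nat 0) - single (z k) (of_nat t - of_nat q)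
        = ?e t + single (z k) (of_nat q - of_nat t)"
      by (simp only: diff_conv_add_uminus[of "e + _"] single_uminus minus_diff_eq of_nat_0 add_0_right)
    have "corr (vput k q v) ((modes (?e t))(k := modes (?e t) k - (of_nat q - of_nat t)))
        = corr (vput k q v) ((modes e)(k := modes e k + of_nat t - of_nat q))"
      by (rule corr_cong) (auto simp: modes_def z_neq)
    then show ?thesis unfolding E using corr_series_shift[OF that, of "vput k q v" "?e t" "of_nat q - of_nat t"] by simp
  qed
  have D: "?D k q = Sum_any (\<lambda>t. (of_nat t gchoose q)
      * (if pureW (?e t) then corr (vput k q v) ((modes e)(k := modes e k + of_nat t - of_nat q)) else 0))"
    if "k < N" for k q
  proof -
    have ne: "VX \<noteq> z k" using z_neq[OF that] by auto
    have I: "inv_diff r VX (z k) = geom VX (z k)" using z_VX[OF that] by (simp add: inv_diff_geom)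
    show ?thesis unfolding I dderiv_geom_fmul[OF ne] G[OF that] by simp
  qed
  have pure: "pureW (?e t) \<longleftrightarrow> (\<forall>u. u \<notin> insert VX (VW ` Iset g) \<longrightarrow> e u = 0) \<and> e VX = - 1 - of_nat t" for t
  proof -
    have 1: "(\<forall>u. u \<notin> VW ` Iset g \<longrightarrow> ?e t u = 0)
        \<longleftrightarrow> (\<forall>u. u \<notin> insert VX (VW ` Iset g) \<longrightarrow> ?e t u = 0) \<and> ?e t VX = 0"
    proof -
      have "VX \<notin> VW ` Iset g" by auto
      then show ?thesis by (metis insert_iff)
    qed
    have 2: "(\<forall>u. u \<notin> insert VX (VW ` Iset g) \<longrightarrow> ?e t u = 0)
        \<longleftrightarrow> (\<forall>u. u \<notin> insert VX (VW ` Iset g) \<longrightarrow> e u = 0)" by simp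
    have 3: "?e t VX = 0 \<longleftrightarrow> e VX = - (1 + of_nat t)" by (simp add: add_eq_0_iff2)
    have 4: "- (1 + of_nat t) = (- 1 - of_nat t :: complex)" by simp
    show ?thesis unfolding pureW_def 1 2 3 4 ..
  qed
  have rc: "run 0 N v (modes e) (vac V) \<in> vcarrier V"
    using run_carrier[OF order_refl _ v(1) vac_M, of 0] ends(1) by simp
  show "conf_corr_series v e = (\<Sum>k<N. \<Sum>q<J. dderiv VX 0 (z k) q (inv_diff r VX (z k)) \<star> corr_series (vput k q v)) e"
  proof (cases "\<exists>t. pureW (?e t)")
    case True
    then obtain t where t: "pureW (?e t)" by blast
    then have t': "pureW (?e t') \<longleftrightarrow> t' = t" for t' using pure[of t] pure[of t'] by auto
    have "?D k q = (of_nat t gchoose q) * corr (vput k q v) ((modes e)(k := modes e k + of_nat t - of_nat q))"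
      if "k < N" for k q
    proof -
      have "?D k q = (\<Sum>s\<in>{t}. (of_nat s gchoose q)
        * (if pureW (?e s) then corr (vput k q v) ((modes e)(k := modes e k + of_nat s - of_nat q)) else 0))"
        unfolding D[OF that] by (rule Sum_any.expand_superset) (auto simp: t')
      then show ?thesis using t by simp
    qed
    then have "(\<Sum>k<N. \<Sum>q<J. ?D k q) = (\<Sum>k<N. \<Sum>q<J. (of_int (int t) gchoose q)
        * corr (vput k q v) ((modes e)(k := of_int (int t) + modes e k - of_nat q)))"
      by (intro sum.cong refl) (simp add: add.commute)
    also have "\<dots> = fm (vac V) (vop V (conf V) (int t) (run 0 N v (modes e) (vac V)))"
      by (rule corr_conf[OF v, symmetric]) simp
    also have "\<dots> = conf_corr_series v e"
      using t unfolding pure by (simp add: conf_corr_series_def cmodes_def)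
    finally show ?thesis by (simp add: sum_fun_app)
  next
    case False
    then have "?D k q = 0" if "k < N" for k q using D[OF that] by simp
    moreover have "conf_corr_series v e = 0"
    proof (cases "(\<forall>u. u \<notin> insert VX (VW ` Iset g) \<longrightarrow> e u = 0) \<and> - e VX - 1 \<in> \<int>")
      case True
      from conjunct2[OF True] obtain m where m: "- e VX - 1 = of_int m" by (rule Ints_cases)
      have "m < 0"
      proof (rule ccontr)
        assume "\<not> m < 0"
        then have "of_nat (nat m) = (of_int m :: complex)" by simp
        then have "e VX = - 1 - of_nat (nat m)" by (simp add: m[symmetric])
        with True False pure show False by blast
      qed
      then show ?thesis using True m form_vac_conf[OF voa inv_form rc, of m] by (simp add: conf_corr_series_def cmodes_def)
    next
      case f: False
      have "fm (vac V) 0 = 0"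
        using lin_on_zero[OF form_lin] module_carrier(1)[OF voaD(1)] by simp
      then show ?thesis using f by (auto simp: conf_corr_series_def cmodes_def)
    qed
    ultimately show ?thesis by (simp add: sum_fun_app)
  qed
qed

lemma ward_series:
  assumes v: "slots v" "annih J v" and l: "l \<le> 2"
  shows "(\<Sum>k<N. \<Sum>q<J. fscale (of_nat (l choose q)) (vpow (z k) (of_nat l - of_nat q) \<star> corr_series (vput k q v))) = 0"
proof
  fix e
  have "fscale (of_nat (l choose q)) (vpow (z k) (of_nat l - of_nat q) \<star> corr_series (vput k q v)) e
     = (if pureW e then (of_int (int l) gchoose q) * corr (vput k q v) ((modes e)(k := of_int (int l) + modes e k - of_nat q)) else 0)"
    if "k < N" for k q
  proof -
    have E: "e - single (z k) (of_nat l - of_nat q) = e + single (z k) (of_nat q - of_nat l)"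
      by (simp only: diff_conv_add_uminus[of e] single_uminus minus_diff_eq)
    show ?thesis unfolding fscale_def vpow_single fmonom_fmul E
      using corr_series_shift[OF that, of "vput k q v" e "of_nat q - of_nat l"]
      by (simp add: binomial_gbinomial algebra_simps)
  qed
  then show "(\<Sum>k<N. \<Sum>q<J. fscale (of_nat (l choose q)) (vpow (z k) (of_nat l - of_nat q) \<star> corr_series (vput k q v))) e = 0 e"
    using ward[OF v, of "int l" "modes e"] l by (cases "pureW e") (simp_all add: sum_fun_app)
qed

end

context correlator
begin

definition quad_kernel :: "(nat \<Rightarrow> fseries) \<Rightarrow> var \<Rightarrow> nat \<Rightarrow> fseries" where
  "quad_kernel F y q = (\<Sum>l\<le>2. fscale (of_nat (l choose q)) (F l \<star> vpow y (of_nat l - of_nat q)))"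

lemma lf_quad_kernel: "(\<And>l. l \<le> 2 \<Longrightarrow> lf (F l)) \<Longrightarrow> lf (quad_kernel F y q)"
  unfolding quad_kernel_def by (auto intro!: lf_sum lf_fscale lf_fmul lf_vpow)

text \<open>
  The Ward identities with coefficients: \<open>\<Sum>\<^sub>l F\<^sub>l y\<^sup>l\<close> and its derivatives at the insertion
  points pair to zero.
\<close>

lemma ward_quad_kernel:
  assumes v: "slots v" "annih J v"
    and G: "\<And>k q. k < N \<Longrightarrow> lf (corr_series (vput k (int q) v))"
    and F: "\<And>l. l \<le> 2 \<Longrightarrow> lf (F l)"
  shows "(\<Sum>k<N. \<Sum>q<J. quad_kernel F (z k) q \<star> corr_series (vput k q v)) = 0"
proof -
  let ?W = "\<lambda>l k q. fscale (of_nat (l choose q)) (vpow (z k) (of_nat l - of_nat q) \<star> corr_series (vput k (int q) v))"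
  have W: "lf (?W l k q)" if "k < N" for l k q
    using G[OF that] by (intro lf_fscale lf_fmul lf_vpow)
  have "quad_kernel F (z k) q \<star> corr_series (vput k q v) = (\<Sum>l\<le>2. F l \<star> ?W l k q)" if "k < N" for k q
  proof -
    have "quad_kernel F (z k) q \<star> corr_series (vput k q v)
        = (\<Sum>l\<le>2. corr_series (vput k q v) \<star> fscale (of_nat (l choose q)) (F l \<star> vpow (z k) (of_nat l - of_nat q)))"
      unfolding quad_kernel_def fmul_commute[of _ "corr_series _"]
      by (rule fmul_sum_right) (auto intro!: G that lf_fscale lf_fmul lf_vpow F)
    also have "\<dots> = (\<Sum>l\<le>2. F l \<star> ?W l k q)"
    proof (rule sum.cong[OF refl])
      fix l :: nat assume "l \<in> {..2}"
      then show "corr_series (vput k q v) \<star> fscale (of_nat (l choose q)) (F l \<star> vpow (z k) (of_nat l - of_nat q)) = F l \<star> ?W l k q"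
        using fmul_assoc[OF F lf_vpow G[OF that], of l "z k" "of_nat l - of_nat q" q]
        by (simp only: fmul_fscale fmul_commute[of "corr_series _"] atMost_iff)
    qed
    finally show ?thesis .
  qed
  then have "(\<Sum>k<N. \<Sum>q<J. quad_kernel F (z k) q \<star> corr_series (vput k q v)) = (\<Sum>k<N. \<Sum>q<J. \<Sum>l\<le>2. F l \<star> ?W l k q)"
    by (intro sum.cong refl) simp
  also have "\<dots> = (\<Sum>k<N. \<Sum>l\<le>2. \<Sum>q<J. F l \<star> ?W l k q)"
    by (intro sum.cong refl sum.swap)
  also have "\<dots> = (\<Sum>l\<le>2. \<Sum>k<N. \<Sum>q<J. F l \<star> ?W l k q)"
    by (rule sum.swap)
  also have "\<dots> = (\<Sum>l\<le>2. F l \<star> (\<Sum>k<N. \<Sum>q<J. ?W l k q))"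
  proof (rule sum.cong[OF refl])
    fix l :: nat assume "l \<in> {..2}"
    then have Fl: "lf (F l)" by (simp add: F)
    have "F l \<star> (\<Sum>k<N. \<Sum>q<J. ?W l k q) = (\<Sum>k<N. F l \<star> (\<Sum>q<J. ?W l k q))"
      by (rule fmul_sum_right[OF Fl]) (auto intro!: lf_sum W)
    also have "\<dots> = (\<Sum>k<N. \<Sum>q<J. F l \<star> ?W l k q)"
      by (intro sum.cong refl fmul_sum_right[OF Fl] W) auto
    finally show "(\<Sum>k<N. \<Sum>q<J. F l \<star> ?W l k q) = F l \<star> (\<Sum>k<N. \<Sum>q<J. ?W l k q)" ..
  qed
  also have "\<dots> = 0"
    by (rule sum.neutral) (simp add: ward_series[OF v])
  finally show ?thesis .
qed

lemma dderiv_pi2_quad: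
  assumes "modvar x" "x \<noteq> VY" "k < N" "x \<noteq> z k"
  shows "dderiv x m (z k) q (pi2 r x (z k)) = dderiv x m (z k) q (inv_diff r x (z k))
    + quad_kernel (\<lambda>l. fscale (1 / fact m) ((fderiv x ^^ m) (fl r l x))) (z k) q"
  unfolding quad_kernel_def using assms by (intro dderiv_pi2) (auto simp: z_modvar z_neq)

lemma dderiv_pi2_corr_series:
  assumes "modvar x" "x \<noteq> VY" "k < N" "x \<noteq> z k" "lf (corr_series w)"
  shows "dderiv x m (z k) q (pi2 r x (z k)) \<star> corr_series w = dderiv x m (z k) q (inv_diff r x (z k)) \<star> corr_series w
    + quad_kernel (\<lambda>l. fscale (1 / fact m) ((fderiv x ^^ m) (fl r l x))) (z k) q \<star> corr_series w"
proof -
  have "lf (inv_diff r x (z k))"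
    using assms z_modvar[OF assms(3)] by (intro inv_diff_facts) (auto simp: modvar_def)
  then show ?thesis
    unfolding dderiv_pi2_quad[OF assms(1-4)] using assms
    by (intro fmul_add_left lf_dderiv lf_quad_kernel deriv_fl_facts) auto
qed

text \<open>
  By the Ward identities the kernel \<open>1/(x-y)\<close> may be replaced by \<open>\<pi>\<^sub>2(x,y)\<close>.
\<close>

lemma conf_pi2:
  assumes v: "slots v" "annih J v" and G: "\<And>k q. k < N \<Longrightarrow> lf (corr_series (vput k (int q) v))"
  shows "conf_corr_series v = (\<Sum>k<N. \<Sum>q<J. dderiv VX 0 (z k) q (pi2 r VX (z k)) \<star> corr_series (vput k q v))"
proof -
  let ?F = "\<lambda>l. fscale (1 / fact 0) ((fderiv VX ^^ 0) (fl r l VX))"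
  have "(\<Sum>k<N. \<Sum>q<J. dderiv VX 0 (z k) q (pi2 r VX (z k)) \<star> corr_series (vput k q v))
    = (\<Sum>k<N. \<Sum>q<J. dderiv VX 0 (z k) q (inv_diff r VX (z k)) \<star> corr_series (vput k q v)
       + quad_kernel ?F (z k) q \<star> corr_series (vput k q v))"
  proof (intro sum.cong refl dderiv_pi2_corr_series)
    fix k assume "k \<in> {..<N}"
    then show "VX \<noteq> z k" using z_neq(1)[of k] by auto
  qed (auto simp: G)
  also have "\<dots> = conf_corr_series v + (\<Sum>k<N. \<Sum>q<J. quad_kernel ?F (z k) q \<star> corr_series (vput k q v))"
    by (simp only: sum.distrib conf_series[OF v])
  also have "(\<Sum>k<N. \<Sum>q<J. quad_kernel ?F (z k) q \<star> corr_series (vput k q v)) = 0"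
    by (rule ward_quad_kernel[OF v G deriv_fl_facts(1)]) auto
  finally show ?thesis by simp
qed

text \<open>
  The slot \<open>i\<close> itself contributes no pole. Replacing the kernel at the other slots adds their
  share of a Ward identity, which is minus the share of slot \<open>i\<close>; this is the origin of the
  entries \<open>A\<^sub>a\<^sub>,\<^sub>-\<^sub>a\<close>.
\<close>

lemma creation_pi2:
  assumes i: "i < N" and v: "slots v" "annih J v" and G: "\<And>k q. k < N \<Longrightarrow> lf (corr_series (vput k (int q) v))"
  shows "corr_series (vput i (- 1 - int p) v)
    = (\<Sum>k<N. \<Sum>q<J. (if k = i then quad_kernel (\<lambda>l. fscale (1 / fact p) ((fderiv (z i) ^^ p) (fl r l (z i)))) (z i) q
        else dderiv (z i) p (z k) q (pi2 r (z i) (z k))) \<star> corr_series (vput k q v))"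
proof -
  let ?F = "\<lambda>l. fscale (1 / fact p) ((fderiv (z i) ^^ p) (fl r l (z i)))"
  let ?Q = "\<lambda>k. \<Sum>q<J. quad_kernel ?F (z k) q \<star> corr_series (vput k q v)"
  let ?I = "\<lambda>k. \<Sum>q<J. dderiv (z i) p (z k) q (inv_diff r (z i) (z k)) \<star> corr_series (vput k q v)"
  have "(\<Sum>k<N. \<Sum>q<J. (if k = i then quad_kernel ?F (z i) q else dderiv (z i) p (z k) q (pi2 r (z i) (z k))) \<star> corr_series (vput k q v))
     = (\<Sum>k<N. (if k = i then 0 else ?I k) + ?Q k)"
  proof (intro sum.cong refl)
    fix k assume k: "k \<in> {..<N}"
    show "(\<Sum>q<J. (if k = i then quad_kernel ?F (z i) q else dderiv (z i) p (z k) q (pi2 r (z i) (z k))) \<star> corr_series (vput k q v))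
       = (if k = i then 0 else ?I k) + ?Q k"
    proof (cases "k = i")
      case False
      have "dderiv (z i) p (z k) q (pi2 r (z i) (z k)) \<star> corr_series (vput k (int q) v)
          = dderiv (z i) p (z k) q (inv_diff r (z i) (z k)) \<star> corr_series (vput k (int q) v)
            + quad_kernel ?F (z k) q \<star> corr_series (vput k (int q) v)" for q
        using False k i by (intro dderiv_pi2_corr_series) (auto simp: z_modvar z_neq z_eq G)
      then show ?thesis using False by (simp only: if_False sum.distrib)
    qed simp
  qed
  also have "\<dots> = (\<Sum>k<N. if k = i then 0 else ?I k) + (\<Sum>k<N. ?Q k)" by (rule sum.distrib)
  also have "(\<Sum>k<N. ?Q k) = 0"
    using i by (intro ward_quad_kernel[OF v G deriv_fl_facts(1)]) (auto simp: z_modvar z_neq)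
  also have "(\<Sum>k<N. if k = i then 0 else ?I k) = (\<Sum>k\<in>{..<N} - {i}. ?I k)"
    by (rule sum.mono_neutral_cong_right) auto
  also have "\<dots> = corr_series (vput i (- 1 - int p) v)" by (rule creation_series[OF i v, symmetric])
  finally show ?thesis by simp
qed

end

section \<open>Resummation of the sewing recursion\<close>

lemma fsum_single:
  assumes "j \<in> J" "\<And>i. i \<in> J \<Longrightarrow> i \<noteq> j \<Longrightarrow> F i = 0" shows "fsum F J = F j"
  by (rule ext, subst fsum_finite_support[of "{j}"]) (use assms in auto)

context grading
begin

text \<open>
  Associativity for infinite matrices. It is enough that the lower bounds of the degrees of the
  triple products tend to infinity jointly in both indices.
\<close>

lemma fsum_assoc:
  assumes f: "\<And>i. i \<in> I \<Longrightarrow> lf (f i)" "\<And>i. i \<in> I \<Longrightarrow> order_ge (\<alpha> i) (f i)"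
    and M: "\<And>i j. i \<in> I \<Longrightarrow> j \<in> J \<Longrightarrow> lf (M i j)" "\<And>i j. i \<in> I \<Longrightarrow> j \<in> J \<Longrightarrow> order_ge (\<mu> i j) (M i j)"
    and h: "\<And>j. j \<in> J \<Longrightarrow> lf (h j)" "\<And>j. j \<in> J \<Longrightarrow> order_ge (\<eta> j) (h j)"
    and fin: "\<And>t. finite {(i, j). i \<in> I \<and> j \<in> J \<and> \<alpha> i + \<mu> i j + \<eta> j \<le> t}"
  shows "fsum (\<lambda>i. f i \<star> fsum (\<lambda>j. M i j \<star> h j) J) I = fsum (\<lambda>j. fsum (\<lambda>i. f i \<star> M i j) I \<star> h j) J"
proof -
  have sf3: "sf (\<lambda>p. f (fst p) \<star> (M (fst p) (snd p) \<star> h (snd p))) (I \<times> J)"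
  proof (rule sf_if_order)
    fix p assume "p \<in> I \<times> J"
    then show "lf (f (fst p) \<star> (M (fst p) (snd p) \<star> h (snd p)))"
      "order_ge (\<alpha> (fst p) + (\<mu> (fst p) (snd p) + \<eta> (snd p))) (f (fst p) \<star> (M (fst p) (snd p) \<star> h (snd p)))"
      using f M h by (auto intro!: lf_fmul order_ge_fmul)
  next
    fix t
    have "{j \<in> I \<times> J. \<alpha> (fst j) + (\<mu> (fst j) (snd j) + \<eta> (snd j)) \<le> t}
        = {(i, j). i \<in> I \<and> j \<in> J \<and> \<alpha> i + \<mu> i j + \<eta> j \<le> t}" by (auto simp: add.assoc)
    then show "finite {j \<in> I \<times> J. \<alpha> (fst j) + (\<mu> (fst j) (snd j) + \<eta> (snd j)) \<le> t}" using fin by simp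
  qed
  have row: "sf (\<lambda>j. M i j \<star> h j) J" if i: "i \<in> I" for i
  proof (rule sf_if_order)
    fix j assume "j \<in> J"
    then show "lf (M i j \<star> h j)" "order_ge (\<mu> i j + \<eta> j) (M i j \<star> h j)"
      using M h i by (auto intro!: lf_fmul order_ge_fmul)
  next
    fix t
    have "{j \<in> J. \<mu> i j + \<eta> j \<le> t} \<subseteq> snd ` {(i', j). i' \<in> I \<and> j \<in> J \<and> \<alpha> i' + \<mu> i' j + \<eta> j \<le> \<alpha> i + t}"
      using i by force
    then show "finite {j \<in> J. \<mu> i j + \<eta> j \<le> t}" by (rule finite_subset) (rule finite_imageI[OF fin])
  qed
  have col: "sf (\<lambda>i. f i \<star> M i j) I" if j: "j \<in> J" for j
  proof (rule sf_if_order)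
    fix i assume "i \<in> I"
    then show "lf (f i \<star> M i j)" "order_ge (\<alpha> i + \<mu> i j) (f i \<star> M i j)"
      using f M j by (auto intro!: lf_fmul order_ge_fmul)
  next
    fix t
    have "{i \<in> I. \<alpha> i + \<mu> i j \<le> t} \<subseteq> fst ` {(i, j'). i \<in> I \<and> j' \<in> J \<and> \<alpha> i + \<mu> i j' + \<eta> j' \<le> t + \<eta> j}"
      using j by force
    then show "finite {i \<in> I. \<alpha> i + \<mu> i j \<le> t}" by (rule finite_subset) (rule finite_imageI[OF fin])
  qed
  have "fsum (\<lambda>i. f i \<star> fsum (\<lambda>j. M i j \<star> h j) J) I = fsum (\<lambda>i. fsum (\<lambda>j. f i \<star> (M i j \<star> h j)) J) I"
    by (rule fsum_cong[OF refl]) (rule fmul_fsum[OF f(1) row])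
  also have "\<dots> = fsum (\<lambda>j. fsum (\<lambda>i. f i \<star> (M i j \<star> h j)) I) J"
    using fsum_swap[OF sf3] by simp
  also have "\<dots> = fsum (\<lambda>j. fsum (\<lambda>i. f i \<star> M i j) I \<star> h j) J"
  proof (rule fsum_cong[OF refl])
    fix j assume j: "j \<in> J"
    have "fsum (\<lambda>i. f i \<star> M i j) I \<star> h j = fsum (\<lambda>i. h j \<star> (f i \<star> M i j)) I"
      unfolding fmul_commute[of _ "h j"] by (rule fmul_fsum[OF h(1)[OF j] col[OF j]])
    also have "\<dots> = fsum (\<lambda>i. f i \<star> (M i j \<star> h j)) I"
      by (rule fsum_cong[OF refl]) (use f M h j in \<open>simp add: fmul_commute[of "h j"] fmul_assoc\<close>)
    finally show "fsum (\<lambda>i. f i \<star> (M i j \<star> h j)) I = fsum (\<lambda>i. f i \<star> M i j) I \<star> h j" ..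
  qed
  finally show ?thesis .
qed

end

context expansion
begin

text \<open>
  A matrix with two point and two order indices is handled as a matrix indexed by pairs: \<open>Am (a,
  m) (b, n)\<close> is \<open>A\<^sub>a\<^sub>b\<^sup>m\<^sup>n\<close>.
\<close>

definition K :: "(int \<times> nat) set" where
  "K = Iset g \<times> UNIV"

lemma finite_K: "a > 0 \<Longrightarrow> finite {p \<in> K. a * real (snd p) + c \<le> t}"
proof -
  assume a: "a > 0"
  have "{p \<in> K. a * real (snd p) + c \<le> t} \<subseteq> Iset g \<times> {..nat \<lceil>(t - c) / a\<rceil>}"
  proof
    fix p assume p: "p \<in> {p \<in> K. a * real (snd p) + c \<le> t}"
    then have "real (snd p) \<le> (t - c) / a" using a by (simp add: field_simps)
    then have "snd p \<le> nat \<lceil>(t - c) / a\<rceil>" by linarith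
    then show "p \<in> Iset g \<times> {..nat \<lceil>(t - c) / a\<rceil>}" using p by (cases p) (simp add: K_def)
  qed
  then show ?thesis by (rule finite_subset) (simp add: finite_Iset)
qed

lemma finite_K2: "finite {(i, j). i \<in> K \<and> j \<in> K \<and> real (snd i) + real (snd j) + c \<le> t}"
proof -
  have "{(i, j). i \<in> K \<and> j \<in> K \<and> real (snd i) + real (snd j) + c \<le> t}
      \<subseteq> {p \<in> K. 1 * real (snd p) + c \<le> t} \<times> {p \<in> K. 1 * real (snd p) + c \<le> t}" by auto
  then show ?thesis by (rule finite_subset) (intro finite_cartesian_product finite_K, auto)
qed

definition Am :: "int \<times> nat \<Rightarrow> int \<times> nat \<Rightarrow> fseries" where
  "Am i j = Amat r (fst i) (fst j) (snd i) (snd j)"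

text \<open>
  The matrix \<open>A\<Delta>\<close>; below, \<open>Lt\<close> is the row \<open>L\<Delta>\<close>.
\<close>

definition At :: "int \<times> nat \<Rightarrow> int \<times> nat \<Rightarrow> fseries" where
  "At i j = Atilde g r (fst i) (fst j) (snd i) (snd j)"

definition Lt :: "int \<times> nat \<Rightarrow> fseries" where
  "Lt j = Ltilde g r (fst j) (snd j)"

definition At_pow :: "nat \<Rightarrow> int \<times> nat \<Rightarrow> int \<times> nat \<Rightarrow> fseries" where
  "At_pow k i j = (mat_mul g (Atilde g r) ^^ k) mat_id (fst i) (fst j) (snd i) (snd j)"

definition At_neumann :: "int \<times> nat \<Rightarrow> int \<times> nat \<Rightarrow> fseries" where
  "At_neumann i j = neumann g (Atilde g r) (fst i) (fst j) (snd i) (snd j)"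

definition Lt_neumann :: "int \<times> nat \<Rightarrow> fseries" where
  "Lt_neumann j = row_mul g (Ltilde g r) (neumann g (Atilde g r)) (fst j) (snd j)"

lemma mat_mul_pairs:
  "mat_mul g A B a b m n = fsum (\<lambda>p. A a (fst p) m (snd p) \<star> B (fst p) b (snd p) n) K"
  unfolding mat_mul_def K_def by (rule fsum_cong) auto

lemma row_mul_pairs:
  "row_mul g R A b n = fsum (\<lambda>p. R (fst p) (snd p) \<star> A (fst p) b (snd p) n) K"
  unfolding row_mul_def K_def by (rule fsum_cong) auto

lemma At_eq: "i \<in> K \<Longrightarrow> j \<in> K \<Longrightarrow> At i j = Am i (fst j, snd j + 3)"
proof -
  assume "i \<in> K" "j \<in> K"
  then show ?thesis
    unfolding At_def Atilde_def mat_mul_def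
    by (subst fsum_single[of "(fst j, snd j + 3)"]) (auto simp: K_def Dmat_def Am_def)
qed

lemma Lt_eq: "j \<in> K \<Longrightarrow> Lt j = Lrow r (fst j) (snd j + 3)"
proof -
  assume "j \<in> K"
  then show ?thesis
    unfolding Lt_def Ltilde_def row_mul_def
    by (subst fsum_single[of "(fst j, snd j + 3)"]) (auto simp: K_def Dmat_def)
qed

lemma Am_facts:
  assumes "i \<in> K" "j \<in> K"
  shows "lf (Am i j)" "order_ge (real (snd i) + real (snd j)) (Am i j)"
  using Amat_facts[of "fst i" "fst j" "snd i" "snd j"] assms
  by (auto simp: Am_def K_def elim!: order_ge_mono)

lemma At_facts:
  assumes "i \<in> K" "j \<in> K"
  shows "lf (At i j)" "order_ge (real (snd i) + real (snd j) + 1) (At i j)"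
proof -
  have j': "(fst j, snd j + 3) \<in> K" using assms by (auto simp: K_def)
  show "lf (At i j)" unfolding At_eq[OF assms] by (rule Am_facts[OF assms(1) j'])
  show "order_ge (real (snd i) + real (snd j) + 1) (At i j)"
    unfolding At_eq[OF assms] by (rule order_ge_mono[OF Am_facts(2)[OF assms(1) j']]) simp
qed

lemma Lt_facts:
  assumes "j \<in> K" shows "lf (Lt j)" "order_ge (real (snd j)) (Lt j)"
proof -
  have j: "fst j \<in> Iset g" using assms by (auto simp: K_def)
  show "lf (Lt j)" unfolding Lt_eq[OF assms] by (rule Lrow_facts[OF j])
  show "order_ge (real (snd j)) (Lt j)"
    unfolding Lt_eq[OF assms] by (rule order_ge_mono[OF Lrow_facts(2)[OF j]]) simp
qed

lemma At_pow_0: "At_pow 0 i j = (if i = j then fmonom 0 else 0)"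
  by (auto simp: At_pow_def mat_id_def prod_eq_iff)

lemma At_pow_Suc: "At_pow (Suc k) i j = fsum (\<lambda>m. At i m \<star> At_pow k m j) K"
proof -
  have "At_pow (Suc k) i j = mat_mul g (Atilde g r) ((mat_mul g (Atilde g r) ^^ k) mat_id) (fst i) (fst j) (snd i) (snd j)"
    by (simp add: At_pow_def)
  then show ?thesis
    unfolding mat_mul_pairs At_def At_pow_def .
qed

lemma lf_one: "lf (if P then fmonom 0 else 0)"
  by (simp add: lf_fmonom lf_zero)

lemma order_ge_one: "order_ge 0 (if P then fmonom 0 else 0)"
  using order_ge_fmonom[of 0] by (simp add: lam_zero order_ge_def)

text \<open>
  Every factor \<open>A\<Delta>\<close> raises the degree by at least 1, so the Neumann series is summable.
\<close>

lemma At_pow_facts: "i \<in> K \<Longrightarrow> j \<in> K \<Longrightarrow> lf (At_pow k i j) \<and> order_ge (real k) (At_pow k i j)"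
proof (induction k arbitrary: i)
  case 0
  then show ?case using lf_one order_ge_one by (simp add: At_pow_0)
next
  case (Suc k)
  have t: "lf (At i m \<star> At_pow k m j)" "order_ge (real (snd m) + (real k + 1)) (At i m \<star> At_pow k m j)" if "m \<in> K" for m
  proof -
    show "lf (At i m \<star> At_pow k m j)" using At_facts[OF Suc.prems(1) that] Suc.IH[OF that Suc.prems(2)] by (simp add: lf_fmul)
    have "order_ge (real (snd i) + real (snd m) + 1 + real k) (At i m \<star> At_pow k m j)"
      using At_facts[OF Suc.prems(1) that] Suc.IH[OF that Suc.prems(2)] by (intro order_ge_fmul) auto
    then show "order_ge (real (snd m) + (real k + 1)) (At i m \<star> At_pow k m j)"
      by (rule order_ge_mono) simp
  qed
  have "sf (\<lambda>m. At i m \<star> At_pow k m j) K"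
    using finite_K[of 1 "real k + 1"] by (intro sf_if_order[OF t]) auto
  moreover have "order_ge (real (Suc k)) (At i m \<star> At_pow k m j)" if "m \<in> K" for m
    by (rule order_ge_mono[OF t(2)[OF that]]) simp
  ultimately show ?case unfolding At_pow_Suc by (auto intro: lf_fsum order_ge_fsum)
qed

text \<open>
  The powers are built by multiplication on the left; for the recursion of the Neumann series the
  new factor is needed on the right.
\<close>

lemma At_pow_Suc_right: "i \<in> K \<Longrightarrow> j \<in> K \<Longrightarrow> At_pow (Suc k) i j = fsum (\<lambda>m. At_pow k i m \<star> At m j) K"
proof (induction k arbitrary: i)
  case 0
  have "fsum (\<lambda>m. At i m \<star> At_pow 0 m j) K = At i j \<star> At_pow 0 j j"
    by (rule fsum_single) (use 0 in \<open>auto simp: At_pow_0\<close>)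
  moreover have "fsum (\<lambda>m. At_pow 0 i m \<star> At m j) K = At_pow 0 i i \<star> At i j"
    by (rule fsum_single) (use 0 in \<open>auto simp: At_pow_0\<close>)
  ultimately show ?case by (simp add: At_pow_Suc At_pow_0)
next
  case (Suc k)
  have "At_pow (Suc (Suc k)) i j = fsum (\<lambda>m. At i m \<star> fsum (\<lambda>l. At_pow k m l \<star> At l j) K) K"
    unfolding At_pow_Suc[of "Suc k"] using Suc by (intro fsum_cong refl) simp
  also have "\<dots> = fsum (\<lambda>l. fsum (\<lambda>m. At i m \<star> At_pow k m l) K \<star> At l j) K"
  proof (rule fsum_assoc[where \<alpha> = "\<lambda>m. real (snd m)" and \<mu> = "\<lambda>_ _. real k" and \<eta> = "\<lambda>l. real (snd l)"])
    fix t
    show "finite {(i, j). i \<in> K \<and> j \<in> K \<and> real (snd i) + real k + real (snd j) \<le> t}"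
      using finite_K2[of "real k" t] by (simp add: add_ac)
  next
    show "order_ge (real (snd m)) (At i m)" if "m \<in> K" for m
      by (rule order_ge_mono[OF At_facts(2)[OF Suc.prems(1) that]]) simp
    show "order_ge (real (snd m)) (At m j)" if "m \<in> K" for m
      by (rule order_ge_mono[OF At_facts(2)[OF that Suc.prems(2)]]) simp
  qed (use Suc.prems At_facts At_pow_facts in auto)
  finally show ?case by (simp only: At_pow_Suc)
qed

lemma sf_At_pow: "i \<in> K \<Longrightarrow> j \<in> K \<Longrightarrow> sf (\<lambda>k. At_pow k i j) UNIV"
proof (rule sf_if_order)
  fix t
  have "k \<le> nat \<lceil>t\<rceil>" if "real k \<le> t" for k using that by linarith
  then show "finite {k \<in> UNIV. real k \<le> t}"
    by (intro finite_subset[OF _ finite_atMost[of "nat \<lceil>t\<rceil>"]]) auto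
qed (use At_pow_facts in auto)

lemma At_neumann_pow: "At_neumann i j = fsum (\<lambda>k. At_pow k i j) UNIV"
  by (simp add: At_neumann_def neumann_def At_pow_def)

lemma At_neumann_facts:
  assumes ij: "i \<in> K" "j \<in> K" shows "lf (At_neumann i j)" "order_ge 0 (At_neumann i j)"
proof -
  show "lf (At_neumann i j)" unfolding At_neumann_pow by (rule lf_fsum[OF sf_At_pow[OF ij]])
  show "order_ge 0 (At_neumann i j)" unfolding At_neumann_pow
    by (rule order_ge_fsum, rule order_ge_mono[OF conjunct2[OF At_pow_facts[OF ij]]]) simp
qed

lemma neumann_recursion:
  assumes i: "i \<in> K" and j: "j \<in> K"
  shows "At_neumann i j = (if i = j then fmonom 0 else 0) + fsum (\<lambda>m. At_neumann i m \<star> At m j) K"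
proof -
  have U: "UNIV = insert 0 (range Suc)" using not0_implies_Suc by auto
  have "At_neumann i j = At_pow 0 i j + fsum (\<lambda>k. At_pow (Suc k) i j) UNIV"
    using fsum_insert[of "\<lambda>k. At_pow k i j" 0 "range Suc"] sf_At_pow[OF i j] fsum_reindex[of Suc UNIV "\<lambda>k. At_pow k i j"]
    unfolding At_neumann_pow U[symmetric] by simp
  also have "fsum (\<lambda>k. At_pow (Suc k) i j) UNIV = fsum (\<lambda>k. fsum (\<lambda>m. At_pow k i m \<star> At m j) K) UNIV"
    using i j by (intro fsum_cong refl) (rule At_pow_Suc_right)
  also have "\<dots> = fsum (\<lambda>m. fsum (\<lambda>k. At_pow k i m \<star> At m j) UNIV) K"
  proof -
    have "sf (\<lambda>p::nat \<times> int \<times> nat. At_pow (fst p) i (snd p) \<star> At (snd p) j) (UNIV \<times> K)"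
    proof (rule sf_if_order)
      fix p :: "nat \<times> int \<times> nat" assume p: "p \<in> UNIV \<times> K"
      then have pk: "snd p \<in> K" by auto
      show "lf (At_pow (fst p) i (snd p) \<star> At (snd p) j)"
        by (rule lf_fmul[OF conjunct1[OF At_pow_facts[OF i pk]] At_facts(1)[OF pk j]])
      have "order_ge (real (fst p) + (real (snd (snd p)) + real (snd j) + 1)) (At_pow (fst p) i (snd p) \<star> At (snd p) j)"
        by (rule order_ge_fmul[OF conjunct2[OF At_pow_facts[OF i pk]] At_facts(2)[OF pk j]])
      then show "order_ge (real (fst p) + real (snd (snd p))) (At_pow (fst p) i (snd p) \<star> At (snd p) j)"
        by (rule order_ge_mono) simp
    next
      fix t
      have "{p :: nat \<times> int \<times> nat. p \<in> UNIV \<times> K \<and> real (fst p) + real (snd (snd p)) \<le> t}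
         \<subseteq> {..nat \<lceil>t\<rceil>} \<times> {q \<in> K. 1 * real (snd q) + 0 \<le> t}"
        by (auto, linarith)
      then show "finite {p :: nat \<times> int \<times> nat. p \<in> UNIV \<times> K \<and> real (fst p) + real (snd (snd p)) \<le> t}"
        by (rule finite_subset) (intro finite_cartesian_product finite_K, auto)
    qed
    from fsum_swap[OF this] show ?thesis by simp
  qed
  also have "\<dots> = fsum (\<lambda>m. At_neumann i m \<star> At m j) K"
  proof (intro fsum_cong refl)
    fix m assume m: "m \<in> K"
    show "fsum (\<lambda>k. At_pow k i m \<star> At m j) UNIV = At_neumann i m \<star> At m j"
      unfolding At_neumann_pow fmul_commute[of _ "At m j"]
      by (rule fmul_fsum[symmetric, OF At_facts(1)[OF m j] sf_At_pow[OF i m]])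
  qed
  finally show ?thesis by (simp only: At_pow_0)
qed

lemma Lt_neumann_eq: "Lt_neumann j = fsum (\<lambda>i. Lt i \<star> At_neumann i j) K"
  by (simp add: Lt_neumann_def row_mul_pairs Lt_def At_neumann_def)

lemma Lt_At_neumann_facts:
  assumes "i \<in> K" "j \<in> K"
  shows "lf (Lt i \<star> At_neumann i j)" "order_ge (real (snd i)) (Lt i \<star> At_neumann i j)"
  using lf_fmul[OF Lt_facts(1)[OF assms(1)] At_neumann_facts(1)[OF assms]]
    order_ge_fmul[OF Lt_facts(2)[OF assms(1)] At_neumann_facts(2)[OF assms]] by auto

lemma Lt_neumann_facts: assumes "j \<in> K" shows "lf (Lt_neumann j)" "order_ge 0 (Lt_neumann j)"
proof -
  have "sf (\<lambda>i. Lt i \<star> At_neumann i j) K"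
    by (rule sf_if_order[where q = "\<lambda>i. real (snd i)"])
      (use Lt_At_neumann_facts assms finite_K[of 1 0] in auto)
  then show "lf (Lt_neumann j)" unfolding Lt_neumann_eq by (rule lf_fsum)
  show "order_ge 0 (Lt_neumann j)" unfolding Lt_neumann_eq
    by (rule order_ge_fsum, rule order_ge_mono[OF Lt_At_neumann_facts(2)]) (use assms in auto)
qed

lemma Lt_neumann_recursion:
  assumes j: "j \<in> K"
  shows "Lt_neumann j = Lt j + fsum (\<lambda>m. Lt_neumann m \<star> At m j) K"
proof -
  let ?one = "\<lambda>i. if i = j then fmonom 0 else 0 :: fseries"
  have NA: "sf (\<lambda>m. At_neumann i m \<star> At m j) K" if i: "i \<in> K" for i
  proof (rule sf_if_order)
    fix m assume m: "m \<in> K"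
    show "lf (At_neumann i m \<star> At m j)" using At_neumann_facts[OF i m] At_facts[OF m j] by (simp add: lf_fmul)
    have "order_ge (0 + (real (snd m) + real (snd j) + 1)) (At_neumann i m \<star> At m j)"
      by (rule order_ge_fmul[OF At_neumann_facts(2)[OF i m] At_facts(2)[OF m j]])
    then show "order_ge (1 * real (snd m) + 0) (At_neumann i m \<star> At m j)" by (rule order_ge_mono) simp
  qed (rule finite_K, simp)
  have NAo: "order_ge 0 (fsum (\<lambda>m. At_neumann i m \<star> At m j) K)" if i: "i \<in> K" for i
  proof (rule order_ge_fsum)
    fix m assume m: "m \<in> K"
    show "order_ge 0 (At_neumann i m \<star> At m j)"
      by (rule order_ge_mono[OF order_ge_fmul[OF At_neumann_facts(2)[OF i m] At_facts(2)[OF m j]]]) simp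
  qed
  have "Lt_neumann j = fsum (\<lambda>i. Lt i \<star> ?one i + Lt i \<star> fsum (\<lambda>m. At_neumann i m \<star> At m j) K) K"
    unfolding Lt_neumann_eq
  proof (rule fsum_cong[OF refl])
    fix i assume i: "i \<in> K"
    show "Lt i \<star> At_neumann i j = Lt i \<star> ?one i + Lt i \<star> fsum (\<lambda>m. At_neumann i m \<star> At m j) K"
      unfolding neumann_recursion[OF i j]
      by (rule fmul_add_right[OF Lt_facts(1)[OF i] lf_one lf_fsum[OF NA[OF i]]])
  qed
  also have "\<dots> = fsum (\<lambda>i. Lt i \<star> ?one i) K + fsum (\<lambda>i. Lt i \<star> fsum (\<lambda>m. At_neumann i m \<star> At m j) K) K"
  proof (rule fsum_add)
    have L: "sf (\<lambda>i. Lt i \<star> h i) K" if "\<And>i. i \<in> K \<Longrightarrow> lf (h i)" "\<And>i. i \<in> K \<Longrightarrow> order_ge 0 (h i)" for h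
    proof (rule sf_if_order)
      fix i assume i: "i \<in> K"
      show "lf (Lt i \<star> h i)" using that(1)[OF i] Lt_facts[OF i] by (simp add: lf_fmul)
      show "order_ge (1 * real (snd i) + 0) (Lt i \<star> h i)"
        using order_ge_fmul[OF Lt_facts(2)[OF i] that(2)[OF i]] by simp
    qed (rule finite_K, simp)
    show "sf (\<lambda>i. Lt i \<star> ?one i) K" by (rule L[OF lf_one order_ge_one])
    show "sf (\<lambda>i. Lt i \<star> fsum (\<lambda>m. At_neumann i m \<star> At m j) K) K"
      using NA NAo by (intro L lf_fsum)
  qed
  also have "fsum (\<lambda>i. Lt i \<star> ?one i) K = Lt j"
    using j by (subst fsum_single[of j]) auto
  also have "fsum (\<lambda>i. Lt i \<star> fsum (\<lambda>m. At_neumann i m \<star> At m j) K) K = fsum (\<lambda>m. fsum (\<lambda>i. Lt i \<star> At_neumann i m) K \<star> At m j) K"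
  proof (rule fsum_assoc[where \<alpha> = "\<lambda>m. real (snd m)" and \<mu> = "\<lambda>_ _. 0" and \<eta> = "\<lambda>l. real (snd l)"])
    fix t
    show "finite {(i, j). i \<in> K \<and> j \<in> K \<and> real (snd i) + 0 + real (snd j) \<le> t}"
      using finite_K2[of 0 t] by simp
  next
    show "order_ge (real (snd m)) (At m j)" if "m \<in> K" for m
      by (rule order_ge_mono[OF At_facts(2)[OF that j]]) simp
  qed (use j Lt_facts At_facts At_neumann_facts in auto)
  finally show ?thesis by (simp only: Lt_neumann_eq)
qed

lemma fsum_K_split:
  assumes "sf G K"
  shows "fsum G K = (\<Sum>p\<in>Iset g \<times> {..2}. G p) + fsum (\<lambda>i. G (fst i, snd i + 3)) K"
proof
  fix e
  let ?h = "\<lambda>i::int \<times> nat. (fst i, snd i + 3)"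
  let ?B = "{p \<in> ?h ` K. G p e \<noteq> 0}"
  have fB: "finite ?B"
    by (rule finite_subset[OF _ sf_finite_index[OF assms, of e]]) (auto simp: K_def)
  have 1: "fsum G K e = (\<Sum>p\<in>(Iset g \<times> {..2}) \<union> ?B. G p e)"
  proof (rule fsum_finite_support)
    fix p assume p: "p \<in> K - (Iset g \<times> {..2} \<union> ?B)"
    show "G p e = 0"
    proof (rule ccontr)
      assume G: "G p e \<noteq> 0"
      have "snd p > 2" "fst p \<in> Iset g" using p by (auto simp: K_def)
      then have "p = ?h (fst p, snd p - 3)" "(fst p, snd p - 3) \<in> K" by (auto simp: K_def prod_eq_iff)
      then have "p \<in> ?B" using G by (metis (mono_tags, lifting) image_eqI mem_Collect_eq)
      with p show False by blast
    qed
  qed (use fB finite_Iset in \<open>auto simp: K_def\<close>)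
  have 2: "fsum (\<lambda>i. G (?h i)) K e = (\<Sum>p\<in>?B. G p e)"
  proof -
    have "inj_on ?h K" by (auto simp: inj_on_def prod_eq_iff)
    then have "fsum (\<lambda>i. G (?h i)) K = fsum G (?h ` K)" by (rule fsum_reindex[symmetric])
    moreover have "fsum G (?h ` K) e = (\<Sum>p\<in>?B. G p e)"
      using fB by (intro fsum_finite_support) auto
    ultimately show ?thesis by simp
  qed
  have "(\<Sum>p\<in>(Iset g \<times> {..2}) \<union> ?B. G p e) = (\<Sum>p\<in>Iset g \<times> {..2}. G p e) + (\<Sum>p\<in>?B. G p e)"
    using fB finite_Iset by (intro sum.union_disjoint) auto
  then show "fsum G K e = ((\<Sum>p\<in>Iset g \<times> {..2}. G p) + fsum (\<lambda>i. G (?h i)) K) e"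
    using 1 2 by (simp add: sum_fun_app)
qed

lemma sf_Lt_neumann_Am: assumes p: "p \<in> K" shows "sf (\<lambda>j. Lt_neumann j \<star> Am j p) K"
proof (rule sf_if_order)
  fix m assume m: "m \<in> K"
  show "lf (Lt_neumann m \<star> Am m p)" by (rule lf_fmul[OF Lt_neumann_facts(1)[OF m] Am_facts(1)[OF m p]])
  show "order_ge (1 * real (snd m) + 0) (Lt_neumann m \<star> Am m p)"
    by (rule order_ge_mono[OF order_ge_fmul[OF Lt_neumann_facts(2)[OF m] Am_facts(2)[OF m p]]]) simp
qed (rule finite_K, simp)

definition T_kernel :: "int \<times> nat \<Rightarrow> fseries" where
  "T_kernel p = Lrow r (fst p) (snd p)
     + row_mul g (row_mul g (Ltilde g r) (neumann g (Atilde g r))) (Amat r) (fst p) (snd p)"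

lemma T_kernel_eq: "T_kernel p = Lrow r (fst p) (snd p) + fsum (\<lambda>j. Lt_neumann j \<star> Am j p) K"
  by (simp add: T_kernel_def row_mul_pairs[of "row_mul g (Ltilde g r) (neumann g (Atilde g r))"] Lt_neumann_def Am_def)

lemma lf_T_kernel: "p \<in> K \<Longrightarrow> lf (T_kernel p)"
  unfolding T_kernel_eq by (intro lf_add lf_fsum sf_Lt_neumann_Am Lrow_facts) (auto simp: K_def)

text \<open>
  Let \<open>T\<^sup>k = X\<^sup>k\<^sup>+\<^sup>3\<close> and \<open>R = L\<Delta>(I - A\<Delta>)\<^sup>-\<^sup>1\<close>, so that \<open>R = L\<Delta> + R A\<Delta>\<close>. Splitting \<open>A X\<close> after
  the first three orders gives \<open>T = Z + A\<Delta> T\<close> with \<open>Z\<close> depending on \<open>X\<^sup>0, X\<^sup>1, X\<^sup>2\<close> only.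
  Expanding \<open>R T\<close> in two ways gives \<open>L\<Delta> T + R A\<Delta> T = R Z + R A\<Delta> T\<close>, hence \<open>L\<Delta> T = R Z\<close>.
\<close>

theorem schottky_resummation:
  assumes X: "sf X K"
    and F: "F = fsum (\<lambda>p. Lrow r (fst p) (snd p) \<star> X p) K"
    and XA: "\<And>i. i \<in> K \<Longrightarrow> X (fst i, snd i + 3) = fsum (\<lambda>p. Am i p \<star> X p) K"
  shows "F = (\<Sum>p\<in>Iset g \<times> {..2}. T_kernel p \<star> X p)"
proof -
  define P where "P = Iset g \<times> {..2::nat}"
  define T where "T i = X (fst i, snd i + 3)" for i
  define Z where "Z i = (\<Sum>p\<in>P. Am i p \<star> X p)" for i
  have PK: "P \<subseteq> K" "finite P" using finite_Iset by (auto simp: P_def K_def)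
  obtain x0 where x0: "order_ge x0 (X p)" if "p \<in> K" for p using sf_bounded[OF X] by blast
  have Xl: "lf (X p)" if "p \<in> K" for p using sf_imp_lf[OF X that] .
  have shift: "(fst i, snd i + 3) \<in> K" if "i \<in> K" for i using that by (auto simp: K_def)
  have Tl: "lf (T i)" and To: "order_ge x0 (T i)" if "i \<in> K" for i
    using Xl x0 shift[OF that] by (auto simp: T_def)
  have TS: "sf T K"
    unfolding sf_def
  proof
    fix t
    have "(below T K t) \<subseteq> (\<lambda>((c, k), e). ((c, k - 3), e)) `
        (below X K t)"
    proof clarify
      fix c k e assume a: "(c, k) \<in> K" "T (c, k) e \<noteq> 0" "degree e \<le> t"
      then have "((c, k + 3), e) \<in> (below X K t)"
        using shift[of "(c, k)"] by (simp add: T_def)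
      then show "((c, k), e) \<in> (\<lambda>((c, k), e). ((c, k - 3), e)) ` (below X K t)"
        by (rule rev_image_eqI) simp
    qed
    then show "finite (below T K t)"
      by (rule finite_subset) (rule finite_imageI[OF sfD[OF X]])
  qed
  have AX: "sf (\<lambda>p. Am i p \<star> X p) K" if i: "i \<in> K" for i
  proof (rule sf_fmul[OF X Am_facts(1)[OF i]])
    show "order_ge 0 (Am i p)" if "p \<in> K" for p
      by (rule order_ge_mono[OF Am_facts(2)[OF i that]]) simp
  qed
  have Zl: "lf (Z i)" if "i \<in> K" for i
    unfolding Z_def using PK Xl Am_facts[OF that] by (intro lf_sum lf_fmul) auto
  have Zo: "order_ge (real (snd i) + x0) (Z i)" if "i \<in> K" for i
    unfolding Z_def
  proof (rule order_ge_sum)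
    fix p assume "p \<in> P"
    then have p: "p \<in> K" using PK by blast
    show "order_ge (real (snd i) + x0) (Am i p \<star> X p)"
      by (rule order_ge_mono[OF order_ge_fmul[OF Am_facts(2)[OF that p] x0[OF p]]]) simp
  qed
  have AT: "sf (\<lambda>m. At i m \<star> T m) K" if i: "i \<in> K" for i
  proof (rule sf_fmul[OF TS At_facts(1)[OF i]])
    show "order_ge 0 (At i p)" if "p \<in> K" for p
      by (rule order_ge_mono[OF At_facts(2)[OF i that]]) simp
  qed
  have T: "T i = Z i + fsum (\<lambda>m. At i m \<star> T m) K" if i: "i \<in> K" for i
  proof -
    have "T i = (\<Sum>p\<in>P. Am i p \<star> X p) + fsum (\<lambda>m. Am i (fst m, snd m + 3) \<star> X (fst m, snd m + 3)) K"
      unfolding T_def XA[OF i] P_def by (rule fsum_K_split[OF AX[OF i]])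
    also have "fsum (\<lambda>m. Am i (fst m, snd m + 3) \<star> X (fst m, snd m + 3)) K = fsum (\<lambda>m. At i m \<star> T m) K"
      by (rule fsum_cong) (auto simp: At_eq[OF i] T_def)
    finally show ?thesis by (simp only: Z_def)
  qed
  have ATo: "order_ge (real (snd i) + x0) (fsum (\<lambda>m. At i m \<star> T m) K)" if i: "i \<in> K" for i
  proof (rule order_ge_fsum)
    fix m assume m: "m \<in> K"
    show "order_ge (real (snd i) + x0) (At i m \<star> T m)"
      by (rule order_ge_mono[OF order_ge_fmul[OF At_facts(2)[OF i m] To[OF m]]]) simp
  qed
  have RA: "sf (\<lambda>m. Lt_neumann m \<star> At m j) K" if j: "j \<in> K" for j
  proof (rule sf_if_order)
    fix m assume m: "m \<in> K"
    show "lf (Lt_neumann m \<star> At m j)" by (rule lf_fmul[OF Lt_neumann_facts(1)[OF m] At_facts(1)[OF m j]])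
    show "order_ge (1 * real (snd m) + 0) (Lt_neumann m \<star> At m j)"
      by (rule order_ge_mono[OF order_ge_fmul[OF Lt_neumann_facts(2)[OF m] At_facts(2)[OF m j]]]) simp
  qed (rule finite_K, simp)
  have RAo: "order_ge 0 (fsum (\<lambda>m. Lt_neumann m \<star> At m j) K)" if j: "j \<in> K" for j
  proof (rule order_ge_fsum)
    fix m assume m: "m \<in> K"
    show "order_ge 0 (Lt_neumann m \<star> At m j)"
      by (rule order_ge_mono[OF order_ge_fmul[OF Lt_neumann_facts(2)[OF m] At_facts(2)[OF m j]]]) simp
  qed
  \<comment> \<open>first expansion of \<open>R T\<close>, from the recursion for \<open>R\<close>\<close>
  have R1: "fsum (\<lambda>j. Lt_neumann j \<star> T j) K = fsum (\<lambda>j. Lt j \<star> T j) K + fsum (\<lambda>j. fsum (\<lambda>m. Lt_neumann m \<star> At m j) K \<star> T j) K"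
  proof -
    have "fsum (\<lambda>j. Lt_neumann j \<star> T j) K = fsum (\<lambda>j. Lt j \<star> T j + fsum (\<lambda>m. Lt_neumann m \<star> At m j) K \<star> T j) K"
    proof (rule fsum_cong[OF refl])
      fix j assume j: "j \<in> K"
      show "Lt_neumann j \<star> T j = Lt j \<star> T j + fsum (\<lambda>m. Lt_neumann m \<star> At m j) K \<star> T j"
        unfolding Lt_neumann_recursion[OF j]
        by (rule fmul_add_left[OF Tl[OF j] Lt_facts(1)[OF j] lf_fsum[OF RA[OF j]]])
    qed
    also have "\<dots> = fsum (\<lambda>j. Lt j \<star> T j) K + fsum (\<lambda>j. fsum (\<lambda>m. Lt_neumann m \<star> At m j) K \<star> T j) K"
    proof (rule fsum_add)
      show "sf (\<lambda>j. Lt j \<star> T j) K"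
        by (rule sf_fmul[OF TS Lt_facts(1) order_ge_mono[OF Lt_facts(2), of _ 0]]) auto
      show "sf (\<lambda>j. fsum (\<lambda>m. Lt_neumann m \<star> At m j) K \<star> T j) K"
        by (rule sf_fmul[OF TS lf_fsum[OF RA] RAo])
    qed
    finally show ?thesis .
  qed
  \<comment> \<open>second expansion of \<open>R T\<close>, from the recursion for \<open>T\<close>\<close>
  have R2: "fsum (\<lambda>j. Lt_neumann j \<star> T j) K = fsum (\<lambda>j. Lt_neumann j \<star> Z j) K + fsum (\<lambda>j. Lt_neumann j \<star> fsum (\<lambda>m. At j m \<star> T m) K) K"
  proof -
    have "fsum (\<lambda>j. Lt_neumann j \<star> T j) K = fsum (\<lambda>j. Lt_neumann j \<star> Z j + Lt_neumann j \<star> fsum (\<lambda>m. At j m \<star> T m) K) K"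
    proof (rule fsum_cong[OF refl])
      fix j assume j: "j \<in> K"
      show "Lt_neumann j \<star> T j = Lt_neumann j \<star> Z j + Lt_neumann j \<star> fsum (\<lambda>m. At j m \<star> T m) K"
        by (subst T[OF j]) (rule fmul_add_right[OF Lt_neumann_facts(1)[OF j] Zl[OF j] lf_fsum[OF AT[OF j]]])
    qed
    also have "\<dots> = fsum (\<lambda>j. Lt_neumann j \<star> Z j) K + fsum (\<lambda>j. Lt_neumann j \<star> fsum (\<lambda>m. At j m \<star> T m) K) K"
    proof (rule fsum_add)
      have L: "sf (\<lambda>i. Lt_neumann i \<star> h i) K" if "\<And>i. i \<in> K \<Longrightarrow> lf (h i)"
        "\<And>i. i \<in> K \<Longrightarrow> order_ge (real (snd i) + x0) (h i)" for h
      proof (rule sf_if_order)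
        fix i assume i: "i \<in> K"
        show "lf (Lt_neumann i \<star> h i)" using that(1)[OF i] Lt_neumann_facts[OF i] by (simp add: lf_fmul)
        show "order_ge (1 * real (snd i) + x0) (Lt_neumann i \<star> h i)"
          using order_ge_fmul[OF Lt_neumann_facts(2)[OF i] that(2)[OF i]] by simp
      qed (rule finite_K, simp)
      show "sf (\<lambda>j. Lt_neumann j \<star> Z j) K" by (rule L[OF Zl Zo])
      show "sf (\<lambda>j. Lt_neumann j \<star> fsum (\<lambda>m. At j m \<star> T m) K) K" by (rule L[OF lf_fsum[OF AT] ATo])
    qed
    finally show ?thesis .
  qed
  have "fsum (\<lambda>j. Lt_neumann j \<star> fsum (\<lambda>m. At j m \<star> T m) K) K = fsum (\<lambda>m. fsum (\<lambda>j. Lt_neumann j \<star> At j m) K \<star> T m) K"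
  proof (rule fsum_assoc[where \<alpha> = "\<lambda>_. 0" and \<mu> = "\<lambda>i m. real (snd i) + real (snd m)" and \<eta> = "\<lambda>_. x0"])
    fix t
    show "finite {(i, j). i \<in> K \<and> j \<in> K \<and> 0 + (real (snd i) + real (snd j)) + x0 \<le> t}"
      using finite_K2[of x0 t] by simp
  next
    show "order_ge (real (snd i) + real (snd m)) (At i m)" if "i \<in> K" "m \<in> K" for i m
      by (rule order_ge_mono[OF At_facts(2)[OF that]]) simp
  qed (use Lt_neumann_facts At_facts Tl To in auto)
  with R1 R2 have LT: "fsum (\<lambda>j. Lt j \<star> T j) K = fsum (\<lambda>j. Lt_neumann j \<star> Z j) K" by simp
  have RAX: "fsum (\<lambda>j. Lt_neumann j \<star> Z j) K = (\<Sum>p\<in>P. fsum (\<lambda>j. Lt_neumann j \<star> Am j p) K \<star> X p)"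
  proof -
    have "fsum (\<lambda>j. Lt_neumann j \<star> Z j) K = fsum (\<lambda>j. Lt_neumann j \<star> fsum (\<lambda>p. Am j p \<star> X p) P) K"
      by (simp add: Z_def fsum_finite[OF PK(2)])
    also have "\<dots> = fsum (\<lambda>p. fsum (\<lambda>j. Lt_neumann j \<star> Am j p) K \<star> X p) P"
    proof (rule fsum_assoc[where \<alpha> = "\<lambda>_. 0" and \<mu> = "\<lambda>i m. real (snd i)" and \<eta> = "\<lambda>_. x0"])
      fix t
      have "{(i, j). i \<in> K \<and> j \<in> P \<and> 0 + real (snd i) + x0 \<le> t} \<subseteq> {p \<in> K. 1 * real (snd p) + x0 \<le> t} \<times> P"
        by auto
      then show "finite {(i, j). i \<in> K \<and> j \<in> P \<and> 0 + real (snd i) + x0 \<le> t}"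
        by (rule finite_subset) (intro finite_cartesian_product finite_K PK, simp)
    next
      show "order_ge (real (snd i)) (Am i m)" if "i \<in> K" "m \<in> P" for i m
        by (rule order_ge_mono[OF Am_facts(2)]) (use that PK in auto)
    qed (use Lt_neumann_facts Am_facts Xl x0 PK in auto)
    finally show ?thesis by (simp only: fsum_finite[OF PK(2)])
  qed
  have LX: "sf (\<lambda>p. Lrow r (fst p) (snd p) \<star> X p) K"
  proof (rule sf_fmul[OF X])
    fix p assume "p \<in> K"
    then have p: "fst p \<in> Iset g" by (auto simp: K_def)
    show "lf (Lrow r (fst p) (snd p))" by (rule Lrow_facts[OF p])
    show "order_ge (- 4) (Lrow r (fst p) (snd p))" by (rule order_ge_mono[OF Lrow_facts(2)[OF p]]) simp
  qed
  have "F = (\<Sum>p\<in>P. Lrow r (fst p) (snd p) \<star> X p) + fsum (\<lambda>i. Lrow r (fst i) (snd i + 3) \<star> X (fst i, snd i + 3)) K"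
    unfolding F P_def using fsum_K_split[OF LX] by simp
  also have "fsum (\<lambda>i. Lrow r (fst i) (snd i + 3) \<star> X (fst i, snd i + 3)) K = fsum (\<lambda>j. Lt j \<star> T j) K"
    by (rule fsum_cong) (auto simp: Lt_eq T_def)
  also have "\<dots> = (\<Sum>p\<in>P. fsum (\<lambda>j. Lt_neumann j \<star> Am j p) K \<star> X p)" using LT RAX by simp
  also have "(\<Sum>p\<in>P. Lrow r (fst p) (snd p) \<star> X p) + \<dots>
      = (\<Sum>p\<in>P. (Lrow r (fst p) (snd p) + fsum (\<lambda>j. Lt_neumann j \<star> Am j p) K) \<star> X p)"
  proof (subst sum.distrib[symmetric], rule sum.cong[OF refl])
    fix p assume "p \<in> P"
    then have p: "p \<in> K" "fst p \<in> Iset g" using PK by (auto simp: P_def)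
    have "sf (\<lambda>j. Lt_neumann j \<star> Am j p) K" by (rule sf_Lt_neumann_Am[OF p(1)])
    then show "Lrow r (fst p) (snd p) \<star> X p + fsum (\<lambda>j. Lt_neumann j \<star> Am j p) K \<star> X p
        = (Lrow r (fst p) (snd p) + fsum (\<lambda>j. Lt_neumann j \<star> Am j p) K) \<star> X p"
      by (intro fmul_add_left[symmetric] Xl p Lrow_facts lf_fsum)
  qed
  finally show ?thesis by (simp add: P_def T_kernel_eq)
qed

end

section \<open>Dual bases\<close>

locale rep =
  fixes D :: "('w::ab_group_add, 'i) rep_data"
  assumes rep: "rep_theory D"
begin

abbreviation V where "V \<equiv> alg D"
abbreviation W where "W \<equiv> irr D"
abbreviation \<tau> where "\<tau> \<equiv> to_dual D"
abbreviation om where "om X m x \<equiv> mop X (conf (alg D)) m x"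

lemma voa: "is_voa V" and inv_form: "invariant_form V (form D)"
  using rep by (auto simp: rep_theory_def voa_assms_def Let_def)

lemmas voaD = is_voaD[OF voa]

lemma irr_facts:
  shows "lab0 D \<in> labels D" "W (lab0 D) = adjoint_mod V"
    "\<mu> \<in> labels D \<Longrightarrow> ordinary_module V (W \<mu>)"
    "\<mu> \<in> labels D \<Longrightarrow> \<exists>h. mcarrier (W \<mu>) = module.span (msmult (W \<mu>)) (\<Union>n::nat. wt_space V (W \<mu>) (of_nat n + h))"
    "\<mu> \<in> labels D \<Longrightarrow> dual D \<mu> \<in> labels D"
    "\<mu> \<in> labels D \<Longrightarrow> module_iso V (W (dual D \<mu>)) (contragredient V (W \<mu>)) (\<tau> \<mu>)"
  using rep unfolding rep_theory_def irr_assms_def Let_def by blast+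

lemma intw_facts:
  assumes "\<alpha> \<in> labels D" "\<beta> \<in> labels D"
  shows "\<gamma> \<in> labels D \<Longrightarrow> intertwining V (W \<gamma>) (W \<alpha>) (W \<beta>) (intw D \<gamma> \<alpha> \<beta>)"
    "u \<in> vcarrier V \<Longrightarrow> w \<in> mcarrier (W \<beta>) \<Longrightarrow> intw D \<beta> (lab0 D) \<beta> u n w = cmodes (mop (W \<beta>)) u n w"
  using rep assms unfolding rep_theory_def intw_assms_def Let_def by blast+

lemma weak: "\<mu> \<in> labels D \<Longrightarrow> weak_module V (W \<mu>)"
  using irr_facts(3) by (simp add: ordinary_module_def)

text \<open>
  The action of the algebra on a module is itself one of the intertwining operators.
\<close>

lemma om_weight:
  assumes l: "\<mu> \<in> labels D" and x: "x \<in> wt_space V (W \<mu>) k"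
  shows "om (W \<mu>) q x \<in> wt_space V (W \<mu>) (k - of_int q + 1)"
proof -
  have xc: "x \<in> mcarrier (W \<mu>)" using x by (rule wt_space_carrier)
  have "intw D \<mu> (lab0 D) \<mu> (conf V) (of_int q) x \<in> wt_space V (W \<mu>) (2 + k - of_int q - 1)"
    using intertwining_weight[OF intw_facts(1)[OF irr_facts(1) l l] weak[OF irr_facts(1)] weak[OF l] weak[OF l] voaD(3) _ x,
        of "conf V" 2 "of_int q"] conf_weight(1)[OF voa] by (simp add: irr_facts(2))
  then show ?thesis
    using intw_facts(2)[OF l l voaD(3) xc, of "of_int q"] by (simp add: cmodes_def algebra_simps)
qed

text \<open>
  A number \<open>h\<close> such that all weights are in \<open>h + \<nat>\<close>.
\<close>

definition lowest_weight :: "'i \<Rightarrow> complex" where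
  "lowest_weight \<mu> = (SOME h. mcarrier (W \<mu>) = module.span (msmult (W \<mu>)) (\<Union>n::nat. wt_space V (W \<mu>) (of_nat n + h)))"

definition weights :: "'i \<Rightarrow> complex set" where
  "weights \<mu> = range (\<lambda>n::nat. of_nat n + lowest_weight \<mu>)"

lemma weights:
  assumes l: "\<mu> \<in> labels D" and x: "x \<in> wt_space V (W \<mu>) k" "x \<noteq> 0"
  shows "k \<in> weights \<mu>"
proof (rule ccontr)
  assume k: "k \<notin> weights \<mu>"
  have "mcarrier (W \<mu>) = module.span (msmult (W \<mu>)) (\<Union>n::nat. wt_space V (W \<mu>) (of_nat n + lowest_weight \<mu>))"
    unfolding lowest_weight_def by (rule someI_ex) (rule irr_facts(4)[OF l])
  also have "(\<Union>n::nat. wt_space V (W \<mu>) (of_nat n + lowest_weight \<mu>)) = (\<Union>k\<in>weights \<mu>. wt_space V (W \<mu>) k)"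
    by (auto simp: weights_def)
  finally have "x = 0"
    using wt_space_span_disjoint[OF weak[OF l] voaD(3) _ x(1) k] wt_space_carrier[OF x(1)] by simp
  with x show False by simp
qed

lemma wt_unique:
  assumes l: "\<mu> \<in> labels D" and x: "x \<in> wt_space V (W \<mu>) k" "x \<in> wt_space V (W \<mu>) k'" "x \<noteq> 0"
  shows "k = k'"
proof -
  have "msmult (W \<mu>) (k - k') x = 0"
    using x unfolding scale_simps(7)[OF weak[OF l]] by (simp add: wt_space_def)
  then show ?thesis using x(3) unfolding scale_simps(9)[OF weak[OF l]] by simp
qed

lemma wt_eq: "\<mu> \<in> labels D \<Longrightarrow> x \<in> wt_space V (W \<mu>) k \<Longrightarrow> x \<noteq> 0 \<Longrightarrow> wt V (W \<mu>) x = k"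
  unfolding wt_def by (rule the_equality) (auto intro: wt_unique)

lemma to_dual_facts:
  assumes l: "\<mu> \<in> labels D"
  shows "inj_on (\<tau> \<mu>) (mcarrier (W (dual D \<mu>)))"
    "y \<in> mcarrier (W (dual D \<mu>)) \<Longrightarrow> lin_on (msmult (W \<mu>)) (*) (mcarrier (W \<mu>)) (\<tau> \<mu> y)"
    "y \<in> mcarrier (W (dual D \<mu>)) \<Longrightarrow> w \<notin> mcarrier (W \<mu>) \<Longrightarrow> \<tau> \<mu> y w = 0"
    "y \<in> mcarrier (W (dual D \<mu>)) \<Longrightarrow> y' \<in> mcarrier (W (dual D \<mu>)) \<Longrightarrow> \<tau> \<mu> (y + y') w = \<tau> \<mu> y w + \<tau> \<mu> y' w"
    "y \<in> mcarrier (W (dual D \<mu>)) \<Longrightarrow> \<tau> \<mu> (msmult (W (dual D \<mu>)) c y) w = c * \<tau> \<mu> y w"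
    "y \<in> mcarrier (W (dual D \<mu>)) \<Longrightarrow> x \<in> mcarrier (W \<mu>) \<Longrightarrow> \<tau> \<mu> (om (W (dual D \<mu>)) n y) x = \<tau> \<mu> y (om (W \<mu>) (2 - n) x)"
proof -
  note iso = irr_facts(6)[OF l]
  have bij: "bij_betw (\<tau> \<mu>) (mcarrier (W (dual D \<mu>))) (mcarrier (contragredient V (W \<mu>)))"
    and lin: "lin_on (msmult (W (dual D \<mu>))) (msmult (contragredient V (W \<mu>))) (mcarrier (W (dual D \<mu>))) (\<tau> \<mu>)"
    and hom: "u \<in> vcarrier V \<Longrightarrow> w \<in> mcarrier (W (dual D \<mu>)) \<Longrightarrow>
        \<tau> \<mu> (mop (W (dual D \<mu>)) u n w) = mop (contragredient V (W \<mu>)) u n (\<tau> \<mu> w)" for u n w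
    using iso by (auto simp: module_iso_def)
  show "inj_on (\<tau> \<mu>) (mcarrier (W (dual D \<mu>)))" using bij by (simp add: bij_betw_def)
  have c: "\<tau> \<mu> y \<in> mcarrier (contragredient V (W \<mu>))" if "y \<in> mcarrier (W (dual D \<mu>))" for y
    using bij that by (auto simp: bij_betw_def)
  show "y \<in> mcarrier (W (dual D \<mu>)) \<Longrightarrow> lin_on (msmult (W \<mu>)) (*) (mcarrier (W \<mu>)) (\<tau> \<mu> y)"
    "y \<in> mcarrier (W (dual D \<mu>)) \<Longrightarrow> w \<notin> mcarrier (W \<mu>) \<Longrightarrow> \<tau> \<mu> y w = 0"
    using c[of y] by (auto simp: contragredient_def)
  show "y \<in> mcarrier (W (dual D \<mu>)) \<Longrightarrow> y' \<in> mcarrier (W (dual D \<mu>)) \<Longrightarrow> \<tau> \<mu> (y + y') w = \<tau> \<mu> y w + \<tau> \<mu> y' w"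
    using lin_on_add[OF lin, of y y'] by simp
  show "y \<in> mcarrier (W (dual D \<mu>)) \<Longrightarrow> \<tau> \<mu> (msmult (W (dual D \<mu>)) c y) w = c * \<tau> \<mu> y w"
    using lin_on_scale[OF lin, of y c] by (simp add: contragredient_def)
  show "y \<in> mcarrier (W (dual D \<mu>)) \<Longrightarrow> x \<in> mcarrier (W \<mu>) \<Longrightarrow> \<tau> \<mu> (om (W (dual D \<mu>)) n y) x = \<tau> \<mu> y (om (W \<mu>) (2 - n) x)"
    using hom[OF voaD(3), of y n] adj_mode_conf[OF voa weak[OF l], of x n] by (simp add: contragredient_def)
qed

end

text \<open>
  One handle: a homogeneous basis of the module at one end and the dual basis of the module at
  the other end.
\<close>

locale handle = rep D for D :: "('w::ab_group_add, 'i) rep_data" +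
  fixes \<mu> :: 'i and B :: "'w set" and d :: "'w \<Rightarrow> 'w"
  assumes lab: "\<mu> \<in> labels D" and basis: "hom_basis D \<mu> B" and dual: "dual_basis D \<mu> B d"
begin

abbreviation W' where "W' \<equiv> irr D (dual D \<mu>)"
abbreviation sc where "sc \<equiv> msmult (irr D \<mu>)"
abbreviation sc' where "sc' \<equiv> msmult (irr D (dual D \<mu>))"
abbreviation carr where "carr \<equiv> mcarrier (irr D \<mu>)"
abbreviation carr' where "carr' \<equiv> mcarrier (irr D (dual D \<mu>))"
abbreviation pair where "pair \<equiv> to_dual D \<mu>"

lemma lab': "dual D \<mu> \<in> labels D"
  by (rule irr_facts(5)[OF lab])

lemma basis_facts:
  shows "x \<in> B \<Longrightarrow> \<exists>l. x \<in> wt_space V (W \<mu>) l" "\<not> module.dependent (sc) B"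
    "module.span (sc) B = carr"
    "x \<in> B \<Longrightarrow> d x \<in> carr'"
    "x \<in> B \<Longrightarrow> c \<in> B \<Longrightarrow> pair (d x) c = (if c = x then 1 else 0)"
  using basis dual by (auto simp: hom_basis_def dual_basis_def Let_def)

lemma basis_nonzero: "x \<in> B \<Longrightarrow> x \<noteq> 0"
proof -
  assume x: "x \<in> B"
  interpret vector_space "sc" by (rule weak_moduleD(1)[OF weak[OF lab]])
  show ?thesis
  proof
    assume "x = 0"
    then have "dependent B" using x by (intro dependent_zero) simp
    with basis_facts(2) show False by simp
  qed
qed

abbreviation wB where "wB x \<equiv> wt (alg D) (irr D \<mu>) x"

lemma basis_weight: "x \<in> B \<Longrightarrow> x \<in> wt_space V (W \<mu>) (wB x)"
proof -
  assume x: "x \<in> B"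
  then obtain l where l: "x \<in> wt_space V (W \<mu>) l" using basis_facts(1) by blast
  with wt_eq[OF lab l basis_nonzero[OF x]] show ?thesis by simp
qed

lemma basis_carrier: "x \<in> B \<Longrightarrow> x \<in> carr"
  by (rule wt_space_carrier[OF basis_weight])

definition level :: "complex \<Rightarrow> 'w set" where
  "level l = {x \<in> B. wB x = l}"

lemma finite_level: "finite (level l)"
proof -
  interpret vector_space "sc" by (rule weak_moduleD(1)[OF weak[OF lab]])
  have "fin_dim (sc) (wt_space V (W \<mu>) l)"
    using irr_facts(3)[OF lab] by (simp add: ordinary_module_def)
  then obtain C where C: "finite C" "wt_space V (W \<mu>) l \<subseteq> span C" by (auto simp: fin_dim_def)
  have "independent (level l)"
    using basis_facts(2) by (rule independent_mono) (auto simp: level_def)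
  moreover have "level l \<subseteq> span C" using C(2) basis_weight by (auto simp: level_def)
  ultimately show ?thesis using independent_span_bound[OF C(1)] by blast
qed

text \<open>
  A combination of basis vectors is an eigenvector of \<open>L(0)\<close> only if it involves basis vectors of
  the same weight.
\<close>

lemma expand:
  assumes y: "y \<in> wt_space V (W \<mu>) l"
  shows "y = (\<Sum>c\<in>level l. sc (pair (d c) y) c)"
proof -
  interpret vector_space "sc" by (rule weak_moduleD(1)[OF weak[OF lab]])
  note M = weak[OF lab]
  have "y \<in> span B" using y by (simp add: basis_facts(3) wt_space_carrier)
  then obtain F q where F: "finite F" "F \<subseteq> B" "(\<Sum>a\<in>F. sc (q a) a) = y"
    by (auto simp: span_explicit)
  have Fc: "sc (q a) a \<in> carr" if "a \<in> F" for a
    using that F(2) by (intro module_carrier[OF M] basis_carrier) auto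
  have L: "lin_on (sc) (sc) (carr) (Lop V (W \<mu>) 0)"
    using weak_moduleD(4)[OF M voaD(3), of 1] by (simp add: Lop_def[abs_def])
  have "(\<Sum>a\<in>F. sc (q a * (wB a - l)) a) = 0"
  proof -
    have "sc l y = Lop V (W \<mu>) 0 y" using y by (simp add: wt_space_def)
    also have "\<dots> = (\<Sum>a\<in>F. Lop V (W \<mu>) 0 (sc (q a) a))"
      unfolding F(3)[symmetric] by (rule lin_on_sum[OF L M Fc])
    also have "\<dots> = (\<Sum>a\<in>F. sc (q a * wB a) a)"
    proof (rule sum.cong[OF refl])
      fix a assume "a \<in> F"
      then have a: "a \<in> B" using F(2) by blast
      show "Lop V (W \<mu>) 0 (sc (q a) a) = sc (q a * wB a) a"
        using lin_on_scale[OF L basis_carrier[OF a]] basis_weight[OF a]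
        by (simp add: wt_space_def)
    qed
    finally have "(\<Sum>a\<in>F. sc (q a * wB a) a) = (\<Sum>a\<in>F. sc (q a * l) a)"
      unfolding F(3)[symmetric] by (simp add: scale_sum_right mult.commute)
    then show ?thesis by (simp add: right_diff_distrib scale_left_diff_distrib sum_subtractf)
  qed
  then have "q a * (wB a - l) = 0" if "a \<in> F" for a
    using independentD[OF basis_facts(2) F(1,2), of "\<lambda>a. q a * (wB a - l)"] that by simp
  then have q0: "q a = 0" if "a \<in> F" "wB a \<noteq> l" for a using that by fastforce
  have coeff: "pair (d c) y = (if c \<in> F then q c else 0)" if c: "c \<in> B" for c
  proof -
    note lc = to_dual_facts(2)[OF lab basis_facts(4)[OF c]]
    have "pair (d c) y = (\<Sum>a\<in>F. pair (d c) (sc (q a) a))"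
      unfolding F(3)[symmetric] by (rule lin_on_sum[OF lc M Fc])
    also have "\<dots> = (\<Sum>a\<in>F. if a = c then q c else 0)"
      using F(2) c basis_carrier by (intro sum.cong refl) (auto simp: lin_on_scale[OF lc] basis_facts(5) subset_iff)
    finally show ?thesis using F(1) by simp
  qed
  have "y = (\<Sum>a\<in>{a\<in>F. wB a = l}. sc (q a) a)"
    unfolding F(3)[symmetric] using F(1) q0 by (intro sum.mono_neutral_right) auto
  also have "\<dots> = (\<Sum>c\<in>level l. sc (pair (d c) y) c)"
    using F(2) finite_level coeff by (intro sum.mono_neutral_cong_left) (auto simp: level_def)
  finally show ?thesis .
qed

lemma pairing_weight:
  assumes "c \<in> B" "y \<in> wt_space V (W \<mu>) l" "wB c \<noteq> l"
  shows "pair (d c) y = 0"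
proof -
  note M = weak[OF lab]
  note lc = to_dual_facts(2)[OF lab basis_facts(4)[OF assms(1)]]
  have "pair (d c) (\<Sum>x\<in>level l. sc (pair (d x) y) x)
      = (\<Sum>x\<in>level l. pair (d c) (sc (pair (d x) y) x))"
    by (rule lin_on_sum[OF lc M]) (intro module_carrier(4)[OF M] basis_carrier, simp add: level_def)
  also have "\<dots> = 0"
    using assms by (intro sum.neutral) (auto simp: level_def lin_on_scale[OF lc] basis_carrier basis_facts(5))
  finally show ?thesis using expand[OF assms(2)] by simp
qed

text \<open>
  The vectors at the dual end are functionals, which are determined by their values on the basis.
\<close>

lemma functional_eq:
  assumes y: "y \<in> carr'" "y' \<in> carr'"
    and eq: "\<And>x. x \<in> B \<Longrightarrow> pair y x = pair y' x"
  shows "y = y'"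
proof -
  interpret vector_space "sc" by (rule weak_moduleD(1)[OF weak[OF lab]])
  note M = weak[OF lab]
  have "pair y w = pair y' w" for w
  proof (cases "w \<in> carr")
    case True
    then have "w \<in> span B" by (simp add: basis_facts(3))
    then obtain F q where F: "finite F" "F \<subseteq> B" "(\<Sum>a\<in>F. sc (q a) a) = w"
      by (auto simp: span_explicit)
    have Fc: "sc (q a) a \<in> carr" if "a \<in> F" for a
      using that F(2) by (intro module_carrier[OF M] basis_carrier) auto
    have s: "pair u w = (\<Sum>a\<in>F. q a * pair u a)" if u: "u \<in> carr'" for u
    proof -
      note lc = to_dual_facts(2)[OF lab u]
      have "pair u w = (\<Sum>a\<in>F. pair u (sc (q a) a))"
        unfolding F(3)[symmetric] by (rule lin_on_sum[OF lc M Fc])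
      also have "\<dots> = (\<Sum>a\<in>F. q a * pair u a)"
        using F(2) basis_carrier by (intro sum.cong refl lin_on_scale[OF lc]) auto
      finally show ?thesis .
    qed
    show ?thesis using F(2) eq unfolding s[OF y(1)] s[OF y(2)] by (intro sum.cong refl) auto
  qed (simp add: to_dual_facts(3)[OF lab] y)
  then have "pair y = pair y'" by (rule ext)
  then show ?thesis using inj_onD[OF to_dual_facts(1)[OF lab] _ y] by blast
qed

lemma dual_weight:
  assumes x: "x \<in> B" shows "d x \<in> wt_space V W' (wB x)"
proof -
  note M' = weak[OF lab'] and dx = basis_facts(4)[OF x]
  have "om W' 1 (d x) = sc' (wB x) (d x)"
  proof (rule functional_eq)
    show "om W' 1 (d x) \<in> carr'"
      by (rule weak_moduleD(3)[OF M' voaD(3) dx])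
    show "sc' (wB x) (d x) \<in> carr'"
      by (rule module_carrier(4)[OF M' dx])
    fix c assume c: "c \<in> B"
    have "om (W \<mu>) 1 c = sc (wB c) c"
      using basis_weight[OF c] by (simp add: wt_space_def Lop_def)
    then show "pair (om W' 1 (d x)) c = pair (sc' (wB x) (d x)) c"
      using to_dual_facts(6)[OF lab dx basis_carrier[OF c], of 1] to_dual_facts(5)[OF lab dx]
        lin_on_scale[OF to_dual_facts(2)[OF lab dx] basis_carrier[OF c]] basis_facts(5)[OF x c] by auto
  qed
  then show ?thesis using dx by (simp add: wt_space_def Lop_def)
qed

lemma expand_dual:
  assumes y: "y \<in> carr'" and l: "\<And>x. x \<in> B \<Longrightarrow> wB x \<noteq> l \<Longrightarrow> pair y x = 0"
  shows "y = (\<Sum>c\<in>level l. sc' (pair y c) (d c))"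
proof (rule functional_eq[OF y])
  note M' = weak[OF lab']
  have c: "sc' (pair y c) (d c) \<in> carr'" if "c \<in> level l" for c
    using that by (intro module_carrier[OF M'] basis_facts(4)) (auto simp: level_def)
  show "(\<Sum>c\<in>level l. sc' (pair y c) (d c)) \<in> carr'"
    by (rule module_carrier(5)[OF M' c])
  fix x assume x: "x \<in> B"
  have lin: "lin_on (sc') (*) (carr') (\<lambda>y. pair y x)"
    using to_dual_facts(4,5)[OF lab] by (simp add: lin_on_def)
  have "pair (\<Sum>c\<in>level l. sc' (pair y c) (d c)) x
     = (\<Sum>c\<in>level l. pair (sc' (pair y c) (d c)) x)"
    by (rule lin_on_sum[OF lin M' c])
  also have "\<dots> = (\<Sum>c\<in>level l. if c = x then pair y x else 0)"
    using x by (intro sum.cong refl) (auto simp: level_def basis_facts to_dual_facts(5)[OF lab])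
  also have "\<dots> = pair y x" using finite_level[of l] l[OF x] x by (auto simp: level_def)
  finally show "pair y x = pair (\<Sum>c\<in>level l. sc' (pair y c) (d c)) x" ..
qed

text \<open>
  Both sides are the sum of \<open>\<langle>\<omega>(j) x, d c\<rangle> \<phi> c (d x)\<close> over the basis vectors \<open>x\<close> of weight \<open>s\<close>
  and \<open>c\<close> of weight \<open>s - j + 1\<close>: on the left \<open>\<omega>(j) x\<close> is expanded in the basis, on the right
  \<open>\<omega>(2-j) (d c)\<close> in the dual basis.
\<close>

lemma adjoint_exchange:
  assumes \<phi>1: "\<And>y. y \<in> carr' \<Longrightarrow> lin_on (sc) (*) (carr) (\<lambda>x. \<phi> x y)"
    and \<phi>2: "\<And>x. x \<in> carr \<Longrightarrow> lin_on (sc') (*) (carr') (\<phi> x)"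
  shows "(\<Sum>x\<in>level s. \<phi> (om (W \<mu>) j x) (d x)) = (\<Sum>c\<in>level (s - of_int j + 1). \<phi> c (om W' (2 - j) (d c)))"
proof -
  note M = weak[OF lab] and M' = weak[OF lab']
  let ?t = "s - of_int j + 1"
  have "\<phi> (om (W \<mu>) j x) (d x) = (\<Sum>c\<in>level ?t. pair (d c) (om (W \<mu>) j x) * \<phi> c (d x))" if "x \<in> level s" for x
  proof -
    have x: "x \<in> B" "wB x = s" using that by (auto simp: level_def)
    note lin = \<phi>1[OF basis_facts(4)[OF x(1)]]
    have e: "om (W \<mu>) j x = (\<Sum>c\<in>level ?t. sc (pair (d c) (om (W \<mu>) j x)) c)"
      using om_weight[OF lab basis_weight[OF x(1)], of j] x(2) by (intro expand) simp
    have "\<phi> (om (W \<mu>) j x) (d x) = (\<Sum>c\<in>level ?t. \<phi> (sc (pair (d c) (om (W \<mu>) j x)) c) (d x))"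
      by (subst e, rule lin_on_sum[OF lin M]) (intro module_carrier(4)[OF M] basis_carrier, simp add: level_def)
    also have "\<dots> = (\<Sum>c\<in>level ?t. pair (d c) (om (W \<mu>) j x) * \<phi> c (d x))"
      by (intro sum.cong refl lin_on_scale[OF lin] basis_carrier) (auto simp: level_def)
    finally show ?thesis .
  qed
  moreover have "\<phi> c (om W' (2 - j) (d c)) = (\<Sum>x\<in>level s. pair (d c) (om (W \<mu>) j x) * \<phi> c (d x))"
    if "c \<in> level ?t" for c
  proof -
    have c: "c \<in> B" "wB c = ?t" using that by (auto simp: level_def)
    note lin = \<phi>2[OF basis_carrier[OF c(1)]]
    let ?y = "om W' (2 - j) (d c)"
    have y: "?y \<in> carr'" by (rule weak_moduleD(3)[OF M' voaD(3) basis_facts(4)[OF c(1)]])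
    have t: "pair ?y x = pair (d c) (om (W \<mu>) j x)" if "x \<in> B" for x
      using to_dual_facts(6)[OF lab basis_facts(4)[OF c(1)] basis_carrier[OF that], of "2 - j"] by simp
    have e: "?y = (\<Sum>x\<in>level s. sc' (pair ?y x) (d x))"
    proof (rule expand_dual[OF y])
      fix x assume x: "x \<in> B" "wB x \<noteq> s"
      show "pair ?y x = 0"
        unfolding t[OF x(1)] by (rule pairing_weight[OF c(1) om_weight[OF lab basis_weight[OF x(1)]]])
          (use c(2) x(2) in auto)
    qed
    have "\<phi> c ?y = (\<Sum>x\<in>level s. \<phi> c (sc' (pair ?y x) (d x)))"
      by (subst e, rule lin_on_sum[OF lin M']) (intro module_carrier(4)[OF M'] basis_facts(4), simp add: level_def)
    also have "\<dots> = (\<Sum>x\<in>level s. pair (d c) (om (W \<mu>) j x) * \<phi> c (d x))"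
      by (intro sum.cong refl) (auto simp: level_def lin_on_scale[OF lin] basis_facts t)
    finally show ?thesis .
  qed
  ultimately show ?thesis
    by (simp add: sum.swap[of _ "level s"])
qed

end

section \<open>The chain attached to the sewing data\<close>

lemma fmonom_assoc: "(fmonom c \<star> f) \<star> k = fmonom c \<star> (f \<star> k)"
  by (metis fmonom_fmul_shift fmul_commute)

lemma fmonom_fmonom_fmul: "fmonom c \<star> (fmonom c' \<star> f) = fmonom (c + c') \<star> f"
  by (metis fmonom_add fmonom_assoc)

lemma fmonom_fsum: "fmonom c \<star> fsum F J = fsum (\<lambda>j. fmonom c \<star> F j) J"
  by (rule ext) (unfold fmonom_fmul fsum_def, rule refl)

lemma foldr_pairs:
  "foldr F [0..<2 * n] s = foldr (\<lambda>a s. F (2 * a - 2) (F (2 * a - 1) s)) [1..<Suc n] s"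
proof (induction n arbitrary: s)
  case (Suc n)
  have "[0..<2 * Suc n] = [0..<2 * n] @ [2 * n, Suc (2 * n)]" by simp
  then have "foldr F [0..<2 * Suc n] s = foldr F [0..<2 * n] (F (2 * n) (F (Suc (2 * n)) s))" by simp
  also have "\<dots> = foldr (\<lambda>a s. F (2 * a - 2) (F (2 * a - 1) s)) [1..<Suc n] (F (2 * n) (F (Suc (2 * n)) s))"
    by (rule Suc.IH)
  also have "\<dots> = foldr (\<lambda>a s. F (2 * a - 2) (F (2 * a - 1) s)) [1..<Suc (Suc n)] s" by simp
  finally show ?case .
qed simp

text \<open>
  Each term of the sum is bounded below, so all of them are bounded above, and below a bound each
  range is finite.
\<close>

lemma bounded_weights:
  fixes h :: "'k \<Rightarrow> complex" and p :: "'k \<Rightarrow> real"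
  assumes I: "finite I" and p: "\<And>i. i \<in> I \<Longrightarrow> 0 < p i"
  shows "\<exists>A. finite A \<and> (\<forall>x. (\<forall>i\<in>I. x i \<in> range (\<lambda>n::nat. of_nat n + h i)) \<and> (\<Sum>i\<in>I. p i * Re (x i)) \<le> t
    \<longrightarrow> (\<forall>i\<in>I. x i \<in> A))"
proof -
  define t' where "t' = t - (\<Sum>i\<in>I. p i * Re (h i))"
  define A where "A = (\<Union>i\<in>I. (\<lambda>n::nat. of_nat n + h i) ` {..nat \<lfloor>t' / p i\<rfloor>})"
  have "finite A" using I by (simp add: A_def)
  moreover have "x i \<in> A"
    if x: "\<forall>i\<in>I. x i \<in> range (\<lambda>n::nat. of_nat n + h i)" "(\<Sum>i\<in>I. p i * Re (x i)) \<le> t" and i: "i \<in> I" for x i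
  proof -
    from x(1) have "\<forall>i\<in>I. \<exists>n::nat. x i = of_nat n + h i" by auto
    then obtain n where n: "\<And>i. i \<in> I \<Longrightarrow> x i = of_nat (n i) + h i" by metis
    have "(\<Sum>i\<in>I. p i * Re (x i)) = (\<Sum>i\<in>I. p i * real (n i)) + (\<Sum>i\<in>I. p i * Re (h i))"
      unfolding sum.distrib[symmetric] by (intro sum.cong refl) (simp add: n distrib_left)
    then have "(\<Sum>i\<in>I. p i * real (n i)) \<le> t'" using x(2) by (simp add: t'_def)
    moreover have "p i * real (n i) \<le> (\<Sum>i\<in>I. p i * real (n i))"
      using I i p by (intro member_le_sum[of i I "\<lambda>i. p i * real (n i)"]) (auto simp: less_imp_le)
    ultimately have "real (n i) \<le> t' / p i" using p[OF i] by (simp add: field_simps)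
    then have "n i \<le> nat \<lfloor>t' / p i\<rfloor>" by linarith
    then show ?thesis using n[OF i] i by (auto simp: A_def)
  qed
  ultimately show ?thesis by blast
qed

lemma abel_sum:
  fixes c W :: "nat \<Rightarrow> real"
  shows "(\<Sum>k<n. c k * (W k - W (Suc k)))
    = (\<Sum>k<n. (if k = 0 then c 0 else c k - c (k - 1)) * W k) - (if n = 0 then 0 else c (n - 1) * W n)"
proof (induction n)
  case (Suc n)
  then show ?case by (cases n) (simp_all add: algebra_simps)
qed simp

locale setting = rep D + expansion g r
  for D :: "('w::ab_group_add, 'i) rep_data" and g r +
  fixes \<alpha> \<beta> :: "nat \<Rightarrow> 'i" and B :: "nat \<Rightarrow> 'w set" and d :: "nat \<Rightarrow> 'w \<Rightarrow> 'w"
  assumes g2: "2 \<le> g"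
    and adm: "admissible_labels D g \<alpha> \<beta>"
    and bases: "\<And>a. a \<in> {1..g} \<Longrightarrow> hom_basis D (\<alpha> a) (B a)"
    and duals: "\<And>a. a \<in> {1..g} \<Longrightarrow> dual_basis D (\<alpha> a) (B a) (d a)"
begin

text \<open>
  The slots \<open>2a-2\<close> and \<open>2a-1\<close> of the chain are the ends \<open>w\<^sub>a\<close> and \<open>w\<^sub>-\<^sub>a\<close> of the handle \<open>a\<close>.
\<close>

definition handle_of :: "nat \<Rightarrow> nat" where "handle_of k = k div 2 + 1"

text \<open>
  The modules of the inserted vectors; those of the intermediate states are \<open>chain_label\<close>.
\<close>

definition slot_label :: "nat \<Rightarrow> 'i" where
  "slot_label k = (if even k then \<alpha> (handle_of k) else dual D (\<alpha> (handle_of k)))"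

definition chain_label :: "nat \<Rightarrow> 'i" where "chain_label = ext_label D g \<beta>"

definition point_of :: "nat \<Rightarrow> int" where
  "point_of k = (if even k then int (handle_of k) else - int (handle_of k))"

definition slot_var :: "nat \<Rightarrow> var" where "slot_var k = VW (point_of k)"

definition slot_of :: "int \<Rightarrow> nat" where
  "slot_of c = (if c > 0 then 2 * (nat c - 1) else 2 * (nat (- c) - 1) + 1)"

lemma handle_of_range: "k < 2 * g \<Longrightarrow> handle_of k \<in> {1..g}"
  by (auto simp: handle_of_def)

lemma point_of_Iset: "k < 2 * g \<Longrightarrow> point_of k \<in> Iset g"
  using handle_of_range[of k] by (auto simp: point_of_def Iset_def)

lemma slot_of_point: "slot_of (point_of k) = k"
proof -
  have h: "0 < handle_of k" by (simp add: handle_of_def)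
  show ?thesis
  proof (cases "even k")
    case True
    then have "2 * (handle_of k - 1) = k" by (simp add: handle_of_def)
    then show ?thesis using True h by (simp add: point_of_def slot_of_def)
  next
    case False
    then have "2 * (handle_of k - 1) + 1 = k" by (simp add: handle_of_def)
    then show ?thesis using False h by (simp add: point_of_def slot_of_def)
  qed
qed

lemma point_of_slot: "c \<in> Iset g \<Longrightarrow> point_of (slot_of c) = c"
  by (auto simp: point_of_def slot_of_def handle_of_def Iset_def)

lemma slot_of_range: "c \<in> Iset g \<Longrightarrow> slot_of c < 2 * g"
  by (auto simp: slot_of_def Iset_def)

lemma slot_of_bij: "bij_betw slot_of (Iset g) {..<2 * g}"
  by (rule bij_betw_byWitness[where f' = point_of]) (auto simp: point_of_slot slot_of_point slot_of_range point_of_Iset)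

lemma slot_var_slot_of: "c \<in> Iset g \<Longrightarrow> slot_var (slot_of c) = VW c"
  by (simp add: slot_var_def point_of_slot)

lemma handle_of_slot: "c \<in> Iset g \<Longrightarrow> handle_of (slot_of c) = nat \<bar>c\<bar>"
  by (auto simp: slot_of_def handle_of_def Iset_def)

lemma slot_var_bij: "bij_betw slot_var {..<2 * g} (VW ` Iset g)"
  unfolding bij_betw_def
proof
  show "inj_on slot_var {..<2 * g}" using slot_of_point by (metis inj_onI var.inject(1) slot_var_def)
  show "slot_var ` {..<2 * g} = VW ` Iset g"
  proof
    show "VW ` Iset g \<subseteq> slot_var ` {..<2 * g}"
      using slot_of_range slot_var_slot_of by (metis (no_types, lifting) image_iff image_subsetI lessThan_iff)
  qed (auto simp: slot_var_def point_of_Iset)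
qed

lemma slot_var_step: "Suc k < 2 * g \<Longrightarrow> r (slot_var (Suc k)) < r (slot_var k)"
proof -
  assume k: "Suc k < 2 * g"
  show ?thesis
  proof (cases "even k")
    case True
    then have "handle_of (Suc k) = handle_of k" by (simp add: handle_of_def)
    moreover have "1 \<le> int (handle_of k)" "int (handle_of k) \<le> int g" using k by (auto simp: handle_of_def)
    ultimately show ?thesis using True order by (simp add: slot_var_def point_of_def expansion_order_def)
  next
    case False
    then have "handle_of (Suc k) = handle_of k + 1" by (simp add: handle_of_def)
    moreover have "1 \<le> int (handle_of k)" "int (handle_of k) < int g" using k False by (auto simp: handle_of_def elim: oddE)
    moreover from this have "r (VW (int (handle_of k) + 1)) < r (VW (- int (handle_of k)))"
      using order by (simp add: expansion_order_def)
    ultimately show ?thesis using False by (simp add: slot_var_def point_of_def add.commute)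
  qed
qed

lemma slot_var_order: "k < k' \<Longrightarrow> k' < 2 * g \<Longrightarrow> r (slot_var k') < r (slot_var k)"
proof (induction k')
  case (Suc k')
  show ?case
  proof (cases "k = k'")
    case False
    then show ?thesis using Suc slot_var_step[of k'] by simp
  qed (use slot_var_step Suc in simp)
qed simp

lemma slot_var_VX: "k < 2 * g \<Longrightarrow> r (slot_var k) < r VX"
proof -
  assume k: "k < 2 * g"
  have 0: "r (slot_var 0) < r VX" using order by (simp add: slot_var_def point_of_def handle_of_def expansion_order_def)
  show ?thesis
    using 0 slot_var_order[of 0 k] k by (cases "k = 0") auto
qed

lemma handles: "a \<in> {1..g} \<Longrightarrow> handle D (\<alpha> a) (B a) (d a)"
  using adm bases duals rep by (simp add: handle_def rep_def handle_axioms_def admissible_labels_def)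

lemma labels_\<alpha>: "a \<in> {1..g} \<Longrightarrow> \<alpha> a \<in> labels D"
  using adm by (simp add: admissible_labels_def)

lemma labels_slot: "k < 2 * g \<Longrightarrow> slot_label k \<in> labels D"
  using labels_\<alpha>[OF handle_of_range] irr_facts(5) by (simp add: slot_label_def)

lemma labels_chain: "k \<le> 2 * g \<Longrightarrow> chain_label k \<in> labels D"
  using adm irr_facts(1) by (auto simp: chain_label_def ext_label_def admissible_labels_def)

sublocale ch: correlator "alg D" "form D" "\<lambda>k. irr D (chain_label k)" "\<lambda>k. irr D (slot_label k)"
  "\<lambda>k. intw D (chain_label k) (slot_label k) (chain_label (Suc k))" "2 * g" g r slot_var
proof unfold_locales
  show "irr D (chain_label 0) = adjoint_mod (alg D)" "irr D (chain_label (2 * g)) = adjoint_mod (alg D)"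
    by (simp_all add: chain_label_def ext_label_def irr_facts(2))
qed (use voa inv_form weak labels_chain labels_slot intw_facts(1) slot_var_bij slot_var_order slot_var_VX in auto)

definition slot_vec :: "(nat \<Rightarrow> 'w) \<Rightarrow> nat \<Rightarrow> 'w" where
  "slot_vec b k = (if even k then b (handle_of k) else d (handle_of k) (b (handle_of k)))"

lemma intw_chain_run:
  "intw_chain D g \<alpha> \<beta> b (\<lambda>a. d a (b a)) e = ch.run 0 (2 * g) (slot_vec b) (ch.modes e) (vac (alg D))"
  unfolding intw_chain_def Let_def ch.run_def foldr_pairs
proof (rule foldr_cong[OF refl refl])
  fix a s assume "a \<in> set [1..<Suc g]"
  then have "1 \<le> a" by auto
  then obtain k where k: "a = Suc k" by (cases a) auto
  show "intw D (ext_label D g \<beta> (2 * a - 2)) (\<alpha> a) (ext_label D g \<beta> (2 * a - 1)) (b a) (- e (VW (int a)) - 1)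
           (intw D (ext_label D g \<beta> (2 * a - 1)) (dual D (\<alpha> a)) (ext_label D g \<beta> (2 * a)) (d a (b a)) (- e (VW (- int a)) - 1) s)
    = intw D (chain_label (2 * a - 2)) (slot_label (2 * a - 2)) (chain_label (Suc (2 * a - 2))) (slot_vec b (2 * a - 2)) (ch.modes e (2 * a - 2))
       (intw D (chain_label (2 * a - 1)) (slot_label (2 * a - 1)) (chain_label (Suc (2 * a - 1))) (slot_vec b (2 * a - 1)) (ch.modes e (2 * a - 1)) s)"
    by (simp add: k chain_label_def slot_label_def slot_vec_def ch.modes_def slot_var_def point_of_def handle_of_def add.commute)
qed

lemma corr0_series: "corr0 D g \<alpha> \<beta> b (\<lambda>a. d a (b a)) = ch.corr_series (slot_vec b)"
  unfolding corr0_def ch.corr_series_def[abs_def] ch.pureW_def ch.corr_def intw_chain_run ..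

lemma corr1_series: "corr1 D g \<alpha> \<beta> (conf (alg D)) b (\<lambda>a. d a (b a)) = ch.conf_corr_series (slot_vec b)"
  unfolding corr1_def ch.conf_corr_series_def[abs_def] intw_chain_run ..

text \<open>
  The choices of one basis vector for each handle.
\<close>

definition choices :: "(nat \<Rightarrow> 'w) set" where "choices = PiE {1..g} B"

definition basis_wt :: "(nat \<Rightarrow> 'w) \<Rightarrow> nat \<Rightarrow> complex" where
  "basis_wt b a = wt (alg D) (irr D (\<alpha> a)) (b a)"

definition rho_exp :: "(nat \<Rightarrow> 'w) \<Rightarrow> var \<Rightarrow> complex" where
  "rho_exp b v = (case v of VR a \<Rightarrow> if 1 \<le> a \<and> a \<le> int g then basis_wt b (nat a) else 0 | _ \<Rightarrow> 0)"

lemma rho_wt_rho_exp: "rho_wt D g \<alpha> b = fmonom (rho_exp b)"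
  unfolding rho_wt_def rho_exp_def[abs_def] basis_wt_def ..

definition slot_wt :: "(nat \<Rightarrow> 'w) \<Rightarrow> nat \<Rightarrow> complex" where "slot_wt b k = basis_wt b (handle_of k)"

lemma choices_mem: "b \<in> choices \<Longrightarrow> a \<in> {1..g} \<Longrightarrow> b a \<in> B a"
  by (auto simp: choices_def)

lemma slot_vec_weight:
  assumes "b \<in> choices" "k < 2 * g" shows "slot_vec b k \<in> wt_space V (W (slot_label k)) (slot_wt b k)"
proof -
  interpret handle D "\<alpha> (handle_of k)" "B (handle_of k)" "d (handle_of k)" by (rule handles[OF handle_of_range[OF assms(2)]])
  have "b (handle_of k) \<in> B (handle_of k)" using choices_mem[OF assms(1) handle_of_range[OF assms(2)]] .
  then show ?thesis using basis_weight dual_weight by (simp add: slot_vec_def slot_label_def slot_wt_def basis_wt_def)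
qed

lemma slots_slot_vec: "b \<in> choices \<Longrightarrow> ch.slots (slot_vec b)"
  unfolding ch.slots_def using wt_space_carrier[OF slot_vec_weight] by blast

lemma annih_slot_vec: assumes b: "b \<in> choices" shows "\<exists>J. ch.annih J (slot_vec b)"
proof -
  have "\<exists>N. \<forall>q\<ge>N. mop (W (slot_label k)) (conf V) q (slot_vec b k) = 0" if "k < 2 * g" for k
    using weak_moduleD(6)[OF weak[OF labels_slot[OF that]] voaD(3)] slots_slot_vec[OF b] that by (auto simp: ch.slots_def)
  then obtain T where T: "\<And>k q. k < 2 * g \<Longrightarrow> q \<ge> T k \<Longrightarrow> mop (W (slot_label k)) (conf V) q (slot_vec b k) = 0" by metis
  have TS: "T k \<le> int (\<Sum>k<2 * g. nat (T k))" if "k < 2 * g" for k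
  proof -
    have "nat (T k) \<le> (\<Sum>k<2 * g. nat (T k))"
      using member_le_sum[of k "{..<2 * g}" "\<lambda>k. nat (T k)"] that by simp
    then have "int (nat (T k)) \<le> int (\<Sum>k<2 * g. nat (T k))" by (simp only: of_nat_le_iff)
    then show ?thesis by linarith
  qed
  then have "ch.annih (\<Sum>k<2 * g. nat (T k)) (slot_vec b)"
    unfolding ch.annih_def
  proof (intro allI impI T)
    fix k q assume k: "k < 2 * g" and q: "(\<Sum>k<2 * g. nat (T k)) \<le> q"
    have "T k \<le> int (\<Sum>k<2 * g. nat (T k))" by (rule TS[OF k])
    also have "\<dots> \<le> int q" using q by (simp only: of_nat_le_iff)
    finally show "T k \<le> int q" .
  qed
  then show ?thesis ..
qed

text \<open>
  The weights of the inserted vectors after \<open>\<omega>(j)\<close> has acted at \<open>w\<^sub>c\<close>.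
\<close>

definition inserted_wt :: "(nat \<Rightarrow> 'w) \<Rightarrow> int \<Rightarrow> int \<Rightarrow> nat \<Rightarrow> complex" where
  "inserted_wt b c j k = slot_wt b k - (if k = slot_of c then of_int j - 1 else 0)"

lemma vput_weight:
  assumes "b \<in> choices" "k < 2 * g"
  shows "ch.vput (slot_of c) j (slot_vec b) k \<in> wt_space V (W (slot_label k)) (inserted_wt b c j k)"
  using slot_vec_weight[OF assms] om_weight[OF labels_slot[OF assms(2)] slot_vec_weight[OF assms], of j]
  by (auto simp: ch.vput_def inserted_wt_def algebra_simps)

lemma run_weight:
  assumes "\<And>k. k < 2 * g \<Longrightarrow> v k \<in> wt_space V (W (slot_label k)) (u k)"
  shows "i \<le> 2 * g \<Longrightarrow> ch.run i (2 * g) v n (vac V)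
    \<in> wt_space V (W (chain_label i)) (\<Sum>k\<in>{i..<2 * g}. u k - n k - 1)"
proof (induction rule: inc_induct)
  case base
  have "W (chain_label (2 * g)) = adjoint_mod V" by (rule ch.ends(2))
  moreover have "vop V (conf V) 1 (vac V) = 0" using voaD(5)[OF voaD(3)] by simp
  ultimately show ?case using voaD(2) scale_simps(2)[OF voaD(1)] by (simp add: wt_space_def Lop_def)
next
  case (step i)
  have "intw D (chain_label i) (slot_label i) (chain_label (Suc i)) (v i) (n i) (ch.run (Suc i) (2 * g) v n (vac V))
      \<in> wt_space V (W (chain_label i)) (u i + (\<Sum>k\<in>{Suc i..<2 * g}. u k - n k - 1) - n i - 1)"
    using step by (intro intertwining_weight[OF ch.Y_intw] weak labels_slot labels_chain voaD(3) assms) auto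
  moreover have "u i + (\<Sum>k\<in>{Suc i..<2 * g}. u k - n k - 1) - n i - 1 = (\<Sum>k\<in>{i..<2 * g}. u k - n k - 1)"
    using step by (subst sum.atLeast_Suc_lessThan) auto
  ultimately show ?case using step by (simp add: ch.run_Cons)
qed

text \<open>
  A non-zero correlator has non-zero intermediate states and non-zero inserted vectors, whose
  weights therefore occur in the modules.
\<close>

lemma corr_weights:
  assumes v: "\<And>k. k < 2 * g \<Longrightarrow> v k \<in> wt_space V (W (slot_label k)) (u k)" and nz: "ch.corr v n \<noteq> 0"
  shows "k < 2 * g \<Longrightarrow> (\<Sum>i\<in>{k..<2 * g}. u i - n i - 1) \<in> weights (chain_label k)"
    "k < 2 * g \<Longrightarrow> u k \<in> weights (slot_label k)"
proof -
  assume k: "k < 2 * g"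
  have sv: "ch.slots v" unfolding ch.slots_def using wt_space_carrier[OF v] by blast
  have nz': "ch.run k (2 * g) v n (vac V) \<noteq> 0"
  proof
    assume "ch.run k (2 * g) v n (vac V) = 0"
    then have "ch.corr v n = 0" using k ch.left_form_zero[OF _ sv] by (simp add: ch.corr_left_form[of k])
    with nz show False by simp
  qed
  then show "(\<Sum>i\<in>{k..<2 * g}. u i - n i - 1) \<in> weights (chain_label k)"
    using k by (intro weights[OF labels_chain run_weight[OF v]]) auto
  have s: "ch.run (Suc k) (2 * g) v n (vac V) \<in> mcarrier (W (chain_label (Suc k)))"
    using k by (intro ch.run_carrier ch.vac_M sv) auto
  have "v k \<noteq> 0"
  proof
    assume "v k = 0"
    then have "ch.run k (2 * g) v n (vac V) = 0"
      using lin_on_zero[OF intertwiningD(3)[OF ch.Y_intw[OF k] s] module_carrier(1)[OF weak[OF labels_slot[OF k]]], of "n k"] k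
      by (simp add: ch.run_Cons)
    with nz' show False by simp
  qed
  then show "u k \<in> weights (slot_label k)" by (rule weights[OF labels_slot[OF k] v[OF k]])
qed

end

section \<open>Summability over the bases\<close>

context setting
begin

text \<open>
  The contribution of the choice \<open>b\<close> to \<open>X\<^sub>c\<^sup>j\<close>, for \<open>p = (c, j)\<close>.
\<close>

definition ins_term :: "(nat \<Rightarrow> 'w) \<Rightarrow> int \<times> nat \<Rightarrow> fseries" where
  "ins_term b p = rho (fst p) (- of_nat (snd p) / 2)
     \<star> (fmonom (rho_exp b) \<star> ch.corr_series (ch.vput (slot_of (fst p)) (int (snd p)) (slot_vec b)))"

definition ins_exp :: "(nat \<Rightarrow> 'w) \<Rightarrow> int \<times> nat \<Rightarrow> var \<Rightarrow> complex" where
  "ins_exp b p = single (VR \<bar>fst p\<bar>) (- of_nat (snd p) / 2) + rho_exp b"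

lemma ins_term_coeff: "ins_term b p e = ch.corr_series (ch.vput (slot_of (fst p)) (int (snd p)) (slot_vec b)) (e - ins_exp b p)"
  by (simp add: ins_term_def ins_exp_def rho_single fmonom_fmonom_fmul fmonom_fmul)

lemma degree_pureW: "ch.pureW e \<Longrightarrow> degree e = (\<Sum>k<2 * g. wgt (slot_var k) * Re (e (slot_var k)))"
proof -
  assume e: "ch.pureW e"
  have "degree e = (\<Sum>v\<in>VW ` Iset g. wgt v * Re (e v))"
    unfolding degree_def
    by (rule sum.mono_neutral_right[OF finite_vars])
      (use e in \<open>auto simp: vars_def points_def ch.pureW_def\<close>)
  then show ?thesis by (simp add: sum.reindex_bij_betw[OF slot_var_bij, symmetric])
qed

lemma degree_rho_exp: "degree (rho_exp b) = 8 * (\<Sum>a\<in>{1..g}. Re (basis_wt b a))"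
proof -
  have "degree (rho_exp b) = (\<Sum>v\<in>VR ` {1..int g}. wgt v * Re (rho_exp b v))"
    unfolding degree_def
    by (rule sum.mono_neutral_right[OF finite_vars]) (auto simp: vars_def points_def rho_exp_def split: var.split)
  also have "\<dots> = (\<Sum>a\<in>{1..int g}. 8 * Re (basis_wt b (nat a)))"
    by (subst sum.reindex) (auto simp: inj_on_def wgt_VR rho_exp_def)
  also have "\<dots> = (\<Sum>a\<in>{1..g}. 8 * Re (basis_wt b a))"
    by (rule sum.reindex_bij_witness[where i = int and j = nat]) auto
  finally show ?thesis by (simp add: sum_distrib_left)
qed

lemma sum_slot_wt: "(\<Sum>k<2 * g. f (slot_wt b k)) = 2 * (\<Sum>a\<in>{1..g}. f (basis_wt b a) :: real)"
proof -
  have "(\<Sum>k<2 * n. f (slot_wt b k)) = 2 * (\<Sum>a\<in>{1..n}. f (basis_wt b a))" for n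
    by (induction n) (auto simp: slot_wt_def handle_of_def)
  then show ?thesis .
qed

text \<open>
  The exponent of the variable of a slot is the difference of the weights of the two neighbouring
  states minus the weight of the inserted vector, and partial summation turns this into a
  combination of the weights of the states, with positive coefficients because the variables gain
  weight along the chain. The factor \<open>8\<close> of \<open>\<rho>\<^sub>a\<close> is shared as \<open>4 + 4\<close> by the two slots of the
  handle. Applying \<open>\<omega>(j)\<close> lowers the weight of one slot by \<open>j - 1\<close>; this is compensated by \<open>\<rho>\<^sub>c\<close>
  to the power \<open>-j/2\<close>, up to the constant \<open>-4\<close>.
\<close>

lemma degree_total:
  assumes c: "c \<in> Iset g" and e: "ch.pureW e"
  shows "degree (e + ins_exp b (c, j)) = (\<Sum>k<2 * g. (if k = 0 then wgt (slot_var 0) else wgt (slot_var k) - wgt (slot_var (k - 1)))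
      * Re (\<Sum>i\<in>{k..<2 * g}. inserted_wt b c (int j) i + e (slot_var i)))
    + (\<Sum>k<2 * g. (4 - wgt (slot_var k)) * Re (inserted_wt b c (int j) k)) - 4"
proof -
  define u where "u = inserted_wt b c (int j)"
  define W where "W k = Re (\<Sum>i\<in>{k..<2 * g}. u i + e (slot_var i))" for k
  have W: "Re (e (slot_var k)) = W k - W (Suc k) - Re (u k)" if "k < 2 * g" for k
    using that by (simp add: W_def sum.atLeast_Suc_lessThan)
  have "degree e = (\<Sum>k<2 * g. wgt (slot_var k) * (W k - W (Suc k)) - wgt (slot_var k) * Re (u k))"
    unfolding degree_pureW[OF e] by (intro sum.cong refl) (simp add: W algebra_simps)
  also have "\<dots> = (\<Sum>k<2 * g. (if k = 0 then wgt (slot_var 0) else wgt (slot_var k) - wgt (slot_var (k - 1))) * W k)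
      - (\<Sum>k<2 * g. wgt (slot_var k) * Re (u k))"
    unfolding sum_subtractf abel_sum[of "\<lambda>k. wgt (slot_var k)"] by (simp add: W_def)
  finally have 1: "degree e = \<dots>" .
  have "(\<Sum>k<2 * g. Re (slot_wt b k)) = (\<Sum>k<2 * g. Re (u k) + (if k = slot_of c then real j - 1 else 0))"
    by (rule sum.cong) (auto simp: u_def inserted_wt_def)
  also have "\<dots> = (\<Sum>k<2 * g. Re (u k)) + (real j - 1)"
    using slot_of_range[OF c] by (simp add: sum.distrib)
  finally have "degree (rho_exp b) = 4 * (\<Sum>k<2 * g. Re (u k)) + 4 * (real j - 1)"
    using sum_slot_wt[of Re b] by (simp add: degree_rho_exp)
  then have 2: "degree (ins_exp b (c, j)) = 4 * (\<Sum>k<2 * g. Re (u k)) - 4"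
    by (simp add: ins_exp_def degree_add degree_single VR_vars[OF c] wgt_VR)
  show ?thesis
    unfolding degree_add 1 2 u_def[symmetric] W_def[symmetric]
    by (simp add: left_diff_distrib sum_subtractf sum_distrib_left)
qed

lemma wgt_slot_var: "k < 2 * g \<Longrightarrow> 0 < wgt (slot_var k)" "k < 2 * g \<Longrightarrow> wgt (slot_var k) < 1"
  using wgt_bounds[of "slot_var k"] point_of_Iset[of k] by (auto simp: slot_var_def)

lemma wgt_slot_var_step: "k < 2 * g \<Longrightarrow> 0 < (if k = 0 then wgt (slot_var 0) else wgt (slot_var k) - wgt (slot_var (k - 1)))"
proof -
  assume k: "k < 2 * g"
  show ?thesis
  proof (cases "k = 0")
    case False
    then have "k - 1 < k" "k - 1 < 2 * g" using k by auto
    then show ?thesis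
      using False wgt_antimono[of "slot_var (k - 1)" "slot_var k"] slot_var_order[of "k - 1" k] k point_of_Iset[of k] point_of_Iset[of "k - 1"]
      by (simp add: slot_var_def)
  qed (use wgt_slot_var(1) k in simp)
qed

lemma finite_choices: "finite A \<Longrightarrow> finite {b \<in> choices. \<forall>a\<in>{1..g}. basis_wt b a \<in> A}"
proof -
  assume A: "finite A"
  have "{b \<in> choices. \<forall>a\<in>{1..g}. basis_wt b a \<in> A} \<subseteq> PiE {1..g} (\<lambda>a. \<Union>l\<in>A. handle.level D (\<alpha> a) (B a) l)"
  proof
    fix b assume b: "b \<in> {b \<in> choices. \<forall>a\<in>{1..g}. basis_wt b a \<in> A}"
    show "b \<in> PiE {1..g} (\<lambda>a. \<Union>l\<in>A. handle.level D (\<alpha> a) (B a) l)"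
    proof (rule PiE_I)
      fix a assume a: "a \<in> {1..g}"
      have "b a \<in> B a" using choices_mem[OF _ a] b by blast
      moreover have "basis_wt b a \<in> A" using a b by blast
      ultimately show "b a \<in> (\<Union>l\<in>A. handle.level D (\<alpha> a) (B a) l)"
        unfolding handle.level_def[OF handles[OF a]] by (intro UN_I[of "basis_wt b a"]) (simp_all add: basis_wt_def)
    next
      fix a assume "a \<notin> {1..g}"
      then show "b a = undefined" using PiE_arb[of b "{1..g}" B a] b unfolding choices_def by blast
    qed
  qed
  moreover have "finite (PiE {1..g} (\<lambda>a. \<Union>l\<in>A. handle.level D (\<alpha> a) (B a) l))"
  proof (rule finite_PiE)
    fix a assume a: "a \<in> {1..g}"
    show "finite (\<Union>l\<in>A. handle.level D (\<alpha> a) (B a) l)"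
      by (rule finite_UN_I[OF A]) (rule handle.finite_level[OF handles[OF a]])
  qed simp
  ultimately show ?thesis by (rule finite_subset)
qed

text \<open>
  Below a given degree the weights in \<open>degree_total\<close> are confined to a finite set. They determine
  the exponents; they determine the weights of the basis vectors, as \<open>\<omega>(j)\<close> changes only one of
  the two slots of its handle; and they determine \<open>j\<close> as the difference between the two slots.
\<close>

lemma sf_ins_term: "sf (\<lambda>(p, b). ins_term b p) (K \<times> choices)"
  unfolding sf_def
proof
  fix t
  define I where "I = {..<2 * g} <+> {..<2 * g}"
  define cf where "cf i = (case i of Inl k \<Rightarrow> if k = 0 then wgt (slot_var 0) else wgt (slot_var k) - wgt (slot_var (k - 1))
     | Inr k \<Rightarrow> 4 - wgt (slot_var k))" for i
  define h where "h i = (case i of Inl k \<Rightarrow> lowest_weight (chain_label k) | Inr k \<Rightarrow> lowest_weight (slot_label k))" for i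
  have "finite I" by (simp add: I_def)
  moreover have "0 < cf i" if "i \<in> I" for i
    using that wgt_slot_var_step wgt_slot_var(2) by (force simp: I_def cf_def)
  ultimately obtain A where A: "finite A" "\<And>x. (\<forall>i\<in>I. x i \<in> range (\<lambda>n::nat. of_nat n + h i))
      \<Longrightarrow> (\<Sum>i\<in>I. cf i * Re (x i)) \<le> t + 4 \<Longrightarrow> (\<forall>i\<in>I. x i \<in> A)"
    using bounded_weights[of I cf h "t + 4"] by blast
  define JS where "JS = {j::nat. (of_nat j :: complex) \<in> (\<lambda>(x, y). x - y + 1) ` (A \<times> A)}"
  define BS where "BS = {b \<in> choices. \<forall>a\<in>{1..g}. basis_wt b a \<in> A}"
  define G where "G = (\<lambda>(x, y, u). x - y - u) ` (insert 0 A \<times> insert 0 A \<times> A)"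
  define ES where "ES = {e :: var \<Rightarrow> complex. \<forall>v. (v \<in> VW ` Iset g \<longrightarrow> e v \<in> G) \<and> (v \<notin> VW ` Iset g \<longrightarrow> e v = 0)}"
  have fin: "finite JS" "finite BS" "finite ES"
  proof -
    show "finite JS"
      using A(1) finite_vimageI[of "(\<lambda>(x, y). x - y + 1) ` (A \<times> A)" "of_nat :: nat \<Rightarrow> complex"]
      by (simp add: JS_def vimage_def inj_of_nat)
    show "finite BS" unfolding BS_def by (rule finite_choices[OF A(1)])
    show "finite ES" unfolding ES_def
      using A(1) finite_Iset by (intro finite_set_of_finite_funs) (auto simp: G_def)
  qed
  have "{(q, e). q \<in> K \<times> choices \<and> (case q of (p, b) \<Rightarrow> ins_term b p) e \<noteq> 0 \<and> degree e \<le> t}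
     \<subseteq> (\<lambda>(c, j, b, e). (((c, j), b), e + ins_exp b (c, j))) ` (Iset g \<times> JS \<times> BS \<times> ES)"
  proof clarify
    fix c j b e assume a: "(c, j) \<in> K" "b \<in> choices" "ins_term b (c, j) e \<noteq> 0" "degree e \<le> t"
    have c: "c \<in> Iset g" using a(1) by (simp add: K_def)
    define e' where "e' = e - ins_exp b (c, j)"
    define u where "u = inserted_wt b c (int j)"
    have nz: "ch.pureW e'" "ch.corr (ch.vput (slot_of c) (int j) (slot_vec b)) (ch.modes e') \<noteq> 0"
      using a(3) by (auto simp: ins_term_coeff e'_def ch.corr_series_def split: if_splits)
    have v: "ch.vput (slot_of c) (int j) (slot_vec b) k \<in> wt_space V (W (slot_label k)) (u k)" if "k < 2 * g" for k
      unfolding u_def by (rule vput_weight[OF a(2) that])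
    define Wt where "Wt k = (\<Sum>i\<in>{k..<2 * g}. u i + e' (slot_var i))" for k
    have Wt: "Wt k \<in> weights (chain_label k)" if "k < 2 * g" for k
      using corr_weights(1)[OF v nz(2) that] by (simp add: Wt_def ch.modes_def)
    have uw: "u k \<in> weights (slot_label k)" if "k < 2 * g" for k
      by (rule corr_weights(2)[OF v nz(2) that])
    define x where "x i = (case i of Inl k \<Rightarrow> Wt k | Inr k \<Rightarrow> u k)" for i
    have ee: "e = e' + ins_exp b (c, j)" by (simp add: e'_def)
    have "(\<Sum>i\<in>I. cf i * Re (x i)) = degree e + 4"
      unfolding ee degree_total[OF c nz(1)] I_def
      by (simp add: sum.Plus cf_def x_def Wt_def u_def)
    moreover have "\<forall>i\<in>I. x i \<in> range (\<lambda>n::nat. of_nat n + h i)"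
      using Wt uw by (auto simp: I_def x_def h_def weights_def)
    ultimately have xA: "\<forall>i\<in>I. x i \<in> A" using a(4) by (intro A(2)) auto
    have WA: "Wt k \<in> A" and uA: "u k \<in> A" if "k < 2 * g" for k
      using xA that by (force simp: I_def x_def)+
    have WA': "Wt k \<in> insert 0 A" if "k \<le> 2 * g" for k
      using WA[of k] that by (cases "k = 2 * g") (auto simp: Wt_def)
    \<comment> \<open>each handle has two slots, at most one of which carries the inserted mode\<close>
    have ubA: "basis_wt b a \<in> A" if a: "a \<in> {1..g}" for a
    proof -
      have s: "slot_of (int a) < 2 * g" "slot_of (- int a) < 2 * g" "handle_of (slot_of (int a)) = a" "handle_of (slot_of (- int a)) = a"
        "slot_of (int a) \<noteq> slot_of (- int a)"
        using slot_of_range[of "int a"] slot_of_range[of "- int a"] handle_of_slot[of "int a"] handle_of_slot[of "- int a"] a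
          point_of_slot[of "int a"] point_of_slot[of "- int a"] by (auto simp: Iset_def)
      show ?thesis
      proof (cases "slot_of (int a) = slot_of c")
        case True
        then show ?thesis using uA[OF s(2)] s by (simp add: u_def inserted_wt_def slot_wt_def)
      next
        case False
        then show ?thesis using uA[OF s(1)] s by (simp add: u_def inserted_wt_def slot_wt_def)
      qed
    qed
    have "of_nat j = basis_wt b (handle_of (slot_of c)) - u (slot_of c) + 1" by (simp add: u_def inserted_wt_def slot_wt_def)
    then have "j \<in> JS"
      using ubA[OF handle_of_range[OF slot_of_range[OF c]]] uA[OF slot_of_range[OF c]]
      by (auto simp: JS_def intro!: image_eqI[of _ _ "(basis_wt b (handle_of (slot_of c)), u (slot_of c))"])
    moreover have "b \<in> BS" using ubA a(2) by (simp add: BS_def)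
    moreover have "e' \<in> ES"
    proof -
      have "e' (slot_var k) \<in> G" if "k < 2 * g" for k
      proof -
        have "e' (slot_var k) = Wt k - Wt (Suc k) - u k" using that by (simp add: Wt_def sum.atLeast_Suc_lessThan)
        then show ?thesis
          using WA'[of k] WA'[of "Suc k"] uA[OF that] that
          by (auto simp: G_def intro!: image_eqI[of _ _ "(Wt k, Wt (Suc k), u k)"])
      qed
      then have "e' v \<in> G" if "v \<in> VW ` Iset g" for v
      proof -
        have "v \<in> slot_var ` {..<2 * g}" using that slot_var_bij by (simp add: bij_betw_def)
        then show ?thesis using \<open>\<And>k. k < 2 * g \<Longrightarrow> e' (slot_var k) \<in> G\<close> by blast
      qed
      then show ?thesis using nz(1) by (auto simp: ES_def ch.pureW_def)
    qed
    ultimately show "(((c, j), b), e) \<in> (\<lambda>(c, j, b, e). (((c, j), b), e + ins_exp b (c, j))) ` (Iset g \<times> JS \<times> BS \<times> ES)"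
      using c ee by (intro image_eqI[of _ _ "(c, j, b, e')"]) auto
  qed
  then show "finite {(q, e). q \<in> K \<times> choices \<and> (case q of (p, b) \<Rightarrow> ins_term b p) e \<noteq> 0 \<and> degree e \<le> t}"
    by (rule finite_subset) (intro finite_imageI finite_cartesian_product fin finite_Iset)
qed

lemma lf_ins_term: "p \<in> K \<Longrightarrow> b \<in> choices \<Longrightarrow> lf (ins_term b p)"
  using sf_imp_lf[OF sf_ins_term, of "(p, b)"] by simp

lemma lf_corr_series_vput:
  assumes b: "b \<in> choices" and k: "k < 2 * g" shows "lf (ch.corr_series (ch.vput k (int q) (slot_vec b)))"
proof -
  have p: "(point_of k, q) \<in> K" using point_of_Iset[OF k] by (simp add: K_def)
  have "ch.corr_series (ch.vput k (int q) (slot_vec b)) = fmonom (- ins_exp b (point_of k, q)) \<star> ins_term b (point_of k, q)"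
    by (rule ext) (simp add: fmonom_fmul ins_term_coeff slot_of_point)
  then show ?thesis using lf_ins_term[OF p b] by (simp add: lf_fmul lf_fmonom)
qed

definition ins_sum :: "int \<times> nat \<Rightarrow> fseries" where
  "ins_sum p = fsum (\<lambda>b. ins_term b p) choices"

lemma sf_ins_sum: "sf ins_sum K"
  using sf_fsum[OF sf_ins_term] by (simp add: ins_sum_def[abs_def])

text \<open>
  The sum over the bases of the correlators with \<open>\<omega>(j)\<close> applied at \<open>w\<^sub>c\<close>, for any integer \<open>j\<close>.
\<close>

definition handle_sum :: "int \<Rightarrow> int \<Rightarrow> fseries" where
  "handle_sum c j = fsum (\<lambda>b. fmonom (rho_exp b) \<star> ch.corr_series (ch.vput (slot_of c) j (slot_vec b))) choices"

lemma ins_sum_handle_sum: "ins_sum (c, j) = rho c (- of_nat j / 2) \<star> handle_sum c (int j)"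
  by (simp add: ins_sum_def handle_sum_def ins_term_def rho_single fmonom_fsum)

end

section \<open>Derivatives of the partition function and the exchange of handle ends\<close>

context intertwiner_chain
begin

lemma corr_lin:
  assumes k: "k < N" and v: "\<And>i. i < N \<Longrightarrow> i \<noteq> k \<Longrightarrow> v i \<in> mcarrier (S i)"
  shows "lin_on (msmult (S k)) (*) (mcarrier (S k)) (\<lambda>x. corr (v(k := x)) n)"
proof -
  have kN: "k \<le> N" "Suc k \<le> N" using k by simp_all
  define v0 where "v0 = v(k := 0)"
  have v0: "slots v0"
    using v module_carrier(1)[OF weak_S] by (auto simp: slots_def v0_def)
  let ?s = "run (Suc k) N v0 n (vac V)"
  have s: "?s \<in> mcarrier (M (Suc k))" by (intro run_carrier vac_M v0 kN) auto
  have c: "corr (v(k := x)) n = left_form k v0 n (Y k x (n k) ?s)" for x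
  proof -
    have "run (Suc k) N (v(k := x)) n (vac V) = ?s" by (rule run_cong) (auto simp: v0_def)
    moreover have "left_form k (v(k := x)) n y = left_form k v0 n y" for y by (rule left_form_cong) (auto simp: v0_def)
    ultimately show ?thesis by (simp add: corr_left_form[OF kN(1)] run_Cons[OF k])
  qed
  note l1 = left_form_lin[OF kN(1) v0, of n] and l2 = intertwiningD(3)[OF Y_intw[OF k] s, of "n k"]
  show ?thesis
    unfolding c lin_on_def
    by (simp add: lin_on_add[OF l2] lin_on_scale[OF l2] lin_on_add[OF l1] lin_on_scale[OF l1] Y_carrier[OF k _ s])
qed

lemma slot_carrier: "slots v \<Longrightarrow> i < N \<Longrightarrow> v i \<in> mcarrier (S i)"
  by (simp add: slots_def)

lemma corr_zero_slot: assumes v: "slots v" and k: "k < N" "v k = 0" shows "corr v n = 0"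
proof -
  have "corr (v(k := 0)) n = 0"
    using lin_on_zero[OF corr_lin[OF k(1) slot_carrier[OF v]] module_carrier(1)[OF weak_S[OF k(1)]]] by blast
  moreover have "v(k := 0) = v" using k(2) by auto
  ultimately show ?thesis by simp
qed

text \<open>
  This is the \<open>L(-1)\<close>-derivative property, as \<open>\<omega>(0) = L(-1)\<close>.
\<close>

lemma corr_translation:
  assumes v: "slots v" and k: "k < N"
  shows "corr (vput k 0 v) n = - n k * corr v (n(k := n k - 1))"
proof -
  have kN: "k \<le> N" "Suc k \<le> N" using k by simp_all
  let ?s = "run (Suc k) N v n (vac V)"
  have s: "?s \<in> mcarrier (M (Suc k))" by (intro run_carrier vac_M v kN) auto
  have vk: "v k \<in> mcarrier (S k)" by (rule slot_carrier[OF v k])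
  have "run (Suc k) N (vput k 0 v) n (vac V) = ?s" by (rule run_cong) (auto simp: vput_def)
  moreover have "left_form k (vput k 0 v) n y = left_form k v n y" for y by (rule left_form_cong) (auto simp: vput_def)
  moreover have "vput k 0 v k = Lop V (S k) (- 1) (v k)" by (simp add: vput_def Lop_def)
  ultimately have "corr (vput k 0 v) n = left_form k v n (Y k (Lop V (S k) (- 1) (v k)) (n k) ?s)"
    by (simp add: corr_left_form[OF kN(1)] run_Cons[OF k])
  also have "\<dots> = - n k * left_form k v n (Y k (v k) (n k - 1) ?s)"
    unfolding intertwiningD(6)[OF Y_intw[OF k] vk s]
    by (rule lin_on_scale[OF left_form_lin[OF kN(1) v] Y_carrier[OF k vk s]])
  also have "left_form k v n (Y k (v k) (n k - 1) ?s) = corr v (n(k := n k - 1))"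
  proof -
    have "run (Suc k) N v (n(k := n k - 1)) (vac V) = ?s" by (rule run_cong) auto
    moreover have "left_form k v (n(k := n k - 1)) y = left_form k v n y" for y by (rule left_form_cong) auto
    ultimately show ?thesis by (simp add: corr_left_form[OF kN(1)] run_Cons[OF k])
  qed
  finally show ?thesis .
qed

lemma corr_scaling:
  assumes v: "slots v" and k: "k < N" and u: "v k \<in> wt_space V (S k) u"
  shows "corr (vput k 1 v) n = u * corr v n"
proof -
  have "vput k 1 v = v(k := msmult (S k) u (v k))"
    using u by (simp add: vput_def wt_space_def Lop_def)
  then show ?thesis
    using lin_on_scale[OF corr_lin[OF k slot_carrier[OF v]] slot_carrier[OF v k]] by simp
qed

end

lemma (in grading) sf_section: "sf F (J \<times> K) \<Longrightarrow> j \<in> J \<Longrightarrow> sf (\<lambda>k. F (j, k)) K"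
  unfolding sf_def
proof
  fix t assume a: "\<forall>t. finite (below F (J \<times> K) t)" "j \<in> J"
  have "{(k, e). k \<in> K \<and> F (j, k) e \<noteq> 0 \<and> lam e \<le> t}
     \<subseteq> (\<lambda>((j, k), e). (k, e)) ` (below F (J \<times> K) t)"
  proof clarify
    fix k e assume "k \<in> K" "F (j, k) e \<noteq> 0" "lam e \<le> t"
    then have "((j, k), e) \<in> (below F (J \<times> K) t)" using a(2) by simp
    then show "(k, e) \<in> (\<lambda>((j, k), e). (k, e)) ` (below F (J \<times> K) t)"
      by (rule rev_image_eqI) simp
  qed
  then show "finite {(k, e). k \<in> K \<and> F (j, k) e \<noteq> 0 \<and> lam e \<le> t}"
    by (rule finite_subset) (rule finite_imageI[OF a(1)[rule_format]])
qed

lemma fmonom_fmul_fmonom: "(fmonom s \<star> f) \<star> (fmonom s' \<star> h) = fmonom (s + s') \<star> (f \<star> h)"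
  unfolding fmonom_assoc fmonom_fmul_shift[of f] fmonom_fmonom_fmul ..

context setting
begin

definition pure_exp :: "(var \<Rightarrow> complex) \<Rightarrow> bool" where
  "pure_exp e \<longleftrightarrow> (\<forall>u. u \<notin> VW ` Iset g \<union> VR ` {1..int g} \<longrightarrow> e u = 0)"

definition choices_at :: "(var \<Rightarrow> complex) \<Rightarrow> (nat \<Rightarrow> 'w) set" where
  "choices_at e = {b \<in> choices. \<forall>a\<in>{1..g}. basis_wt b a = e (VR (int a))}"

lemma finite_choices_at: "finite (choices_at e)"
proof -
  have "finite {b \<in> choices. \<forall>a\<in>{1..g}. basis_wt b a \<in> (\<lambda>a. e (VR (int a))) ` {1..g}}"
    by (rule finite_choices) simp
  then show ?thesis by (rule finite_subset[rotated]) (auto simp: choices_at_def)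
qed

lemma rho_exp_VR: "a \<in> {1..g} \<Longrightarrow> rho_exp b (VR (int a)) = basis_wt b a"
  by (auto simp: rho_exp_def)

lemma pureW_rho_exp: "ch.pureW (e - rho_exp b) \<longleftrightarrow> pure_exp e \<and> (\<forall>a\<in>{1..g}. basis_wt b a = e (VR (int a)))"
proof
  assume a: "ch.pureW (e - rho_exp b)"
  have eq: "e u = rho_exp b u" if "u \<notin> VW ` Iset g" for u
    using a that by (simp add: ch.pureW_def)
  have "e u = 0" if "u \<notin> VW ` Iset g \<union> VR ` {1..int g}" for u
    using eq[of u] that by (auto simp: rho_exp_def split: var.splits)
  moreover have "basis_wt b a = e (VR (int a))" if "a \<in> {1..g}" for a
  proof -
    have "VR (int a) \<notin> VW ` Iset g" by auto
    then show ?thesis using eq[of "VR (int a)"] rho_exp_VR[OF that] by simp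
  qed
  ultimately show "pure_exp e \<and> (\<forall>a\<in>{1..g}. basis_wt b a = e (VR (int a)))" by (simp add: pure_exp_def)
next
  assume a: "pure_exp e \<and> (\<forall>a\<in>{1..g}. basis_wt b a = e (VR (int a)))"
  show "ch.pureW (e - rho_exp b)"
    unfolding ch.pureW_def
  proof (intro allI impI)
    fix u assume u: "u \<notin> VW ` Iset g"
    show "(e - rho_exp b) u = 0"
    proof (cases "u \<in> VR ` {1..int g}")
      case True
      then obtain i where i: "u = VR i" "1 \<le> i" "i \<le> int g" by auto
      then have n: "nat i \<in> {1..g}" "int (nat i) = i" by auto
      then have "basis_wt b (nat i) = e u" using a i(1) by force
      then show ?thesis using rho_exp_VR[OF n(1)] n(2) i(1) by simp
    next
      case False
      then have "e u = 0" using a u by (auto simp: pure_exp_def)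
      moreover have "rho_exp b u = 0" using False by (auto simp: rho_exp_def split: var.splits)
      ultimately show ?thesis by simp
    qed
  qed
qed

lemma modes_rho_exp: "ch.modes (e - rho_exp b) = ch.modes e"
  by (rule ext) (simp add: ch.modes_def slot_var_def rho_exp_def)

text \<open>
  The exponents of the \<open>\<rho>\<^sub>a\<close> fix the weights of the basis vectors, so each coefficient is a
  finite sum.
\<close>

lemma basis_sum_coeff:
  "fsum (\<lambda>b. fmonom (rho_exp b) \<star> ch.corr_series (v b)) choices e
    = (if pure_exp e then \<Sum>b\<in>choices_at e. ch.corr (v b) (ch.modes e) else 0)"
proof -
  have t: "(fmonom (rho_exp b) \<star> ch.corr_series (v b)) e
      = (if pure_exp e \<and> (\<forall>a\<in>{1..g}. basis_wt b a = e (VR (int a))) then ch.corr (v b) (ch.modes e) else 0)" for b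
    unfolding fmonom_fmul ch.corr_series_def pureW_rho_exp modes_rho_exp ..
  have "fsum (\<lambda>b. fmonom (rho_exp b) \<star> ch.corr_series (v b)) choices e = (\<Sum>b\<in>choices_at e. (fmonom (rho_exp b) \<star> ch.corr_series (v b)) e)"
  proof (rule fsum_finite_support[OF finite_choices_at])
    fix b assume "b \<in> choices - choices_at e"
    then show "(fmonom (rho_exp b) \<star> ch.corr_series (v b)) e = 0" unfolding t choices_at_def by auto
  qed (simp add: choices_at_def)
  also have "\<dots> = (if pure_exp e then \<Sum>b\<in>choices_at e. ch.corr (v b) (ch.modes e) else 0)"
    unfolding t by (auto simp: choices_at_def intro!: sum.cong)
  finally show ?thesis .
qed

lemma handle_sum_coeff: "handle_sum c j e = (if pure_exp e then \<Sum>b\<in>choices_at e. ch.corr (ch.vput (slot_of c) j (slot_vec b)) (ch.modes e) else 0)"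
  unfolding handle_sum_def by (rule basis_sum_coeff)

definition Z_series :: fseries where
  "Z_series = fsum (\<lambda>b. fmonom (rho_exp b) \<star> ch.corr_series (slot_vec b)) choices"

lemma Z_series_coeff: "Z_series e = (if pure_exp e then \<Sum>b\<in>choices_at e. ch.corr (slot_vec b) (ch.modes e) else 0)"
  unfolding Z_series_def by (rule basis_sum_coeff)

lemma partition_fun_Z_series: "partition_fun D g \<alpha> \<beta> B d = Z_series"
  by (simp add: partition_fun_def Z_series_def choices_def rho_wt_rho_exp corr0_series)

text \<open>
  Separates the choice at the handle \<open>a\<close> from the others.
\<close>

lemma sum_choices_split:
  assumes a: "a \<in> {1..g}"
  shows "(\<Sum>b\<in>choices_at e. f b) = (\<Sum>b\<in>{b \<in> PiE ({1..g} - {a}) B. \<forall>a'\<in>{1..g} - {a}. basis_wt b a' = e (VR (int a'))}.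
     \<Sum>x\<in>handle.level D (\<alpha> a) (B a) (e (VR (int a))). f (b(a := x)))"
proof -
  let ?R = "{b \<in> PiE ({1..g} - {a}) B. \<forall>a'\<in>{1..g} - {a}. basis_wt b a' = e (VR (int a'))}"
  let ?L = "handle.level D (\<alpha> a) (B a) (e (VR (int a)))"
  have L: "?L = {x \<in> B a. wt V (W (\<alpha> a)) x = e (VR (int a))}"
    by (rule handle.level_def[OF handles[OF a]])
  have "(\<Sum>b\<in>choices_at e. f b) = (\<Sum>(b, x)\<in>?R \<times> ?L. f (b(a := x)))"
  proof (rule sum.reindex_bij_witness[where i = "\<lambda>(b, x). b(a := x)" and j = "\<lambda>b. (b(a := undefined), b a)"])
    fix b assume b: "b \<in> choices_at e"
    then have bB: "b \<in> PiE {1..g} B" and bw: "\<And>a. a \<in> {1..g} \<Longrightarrow> basis_wt b a = e (VR (int a))"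
      by (auto simp: choices_at_def choices_def)
    show "(b(a := undefined), b a) \<in> ?R \<times> ?L"
      using bB bw a unfolding L by (auto simp: PiE_iff extensional_def basis_wt_def)
    show "(case (b(a := undefined), b a) of (b, x) \<Rightarrow> b(a := x)) = b" by simp
    show "(case (b(a := undefined), b a) of (b, x) \<Rightarrow> f (b(a := x))) = f b" by simp
  next
    fix p assume p: "p \<in> ?R \<times> ?L"
    obtain b x where px: "p = (b, x)" by (cases p)
    have b: "b \<in> PiE ({1..g} - {a}) B" "\<And>a'. a' \<in> {1..g} \<Longrightarrow> a' \<noteq> a \<Longrightarrow> basis_wt b a' = e (VR (int a'))"
      and x: "x \<in> B a" "wt V (W (\<alpha> a)) x = e (VR (int a))" using p unfolding px L by auto
    have ba: "b a = undefined" using PiE_arb[OF b(1), of a] by simp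
    show "(\<lambda>b. (b(a := undefined), b a)) (case p of (b, x) \<Rightarrow> b(a := x)) = p"
      using ba by (auto simp: px fun_eq_iff)
    show "(case p of (b, x) \<Rightarrow> b(a := x)) \<in> choices_at e"
      using b x a by (auto simp: px choices_at_def choices_def PiE_iff extensional_def basis_wt_def)
  qed
  then show ?thesis by (simp add: sum.cartesian_product)
qed

lemma handle_of_eq_iff: "k < 2 * g \<Longrightarrow> a \<in> {1..g} \<Longrightarrow> handle_of k = a \<longleftrightarrow> k = slot_of (int a) \<or> k = slot_of (- int a)"
proof -
  assume "k < 2 * g" and a: "a \<in> {1..g}"
  then have "slot_of (int a) = 2 * (a - 1)" "slot_of (- int a) = 2 * (a - 1) + 1" "1 \<le> a" by (auto simp: slot_of_def)
  then show ?thesis unfolding handle_of_def by presburger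
qed

lemma slot_of_parity:
  assumes "a \<in> {1..g}"
  shows "even (slot_of (int a))" "odd (slot_of (- int a))" "slot_of (int a) < 2 * g" "slot_of (- int a) < 2 * g"
    "handle_of (slot_of (int a)) = a" "handle_of (slot_of (- int a)) = a" "slot_of (int a) \<noteq> slot_of (- int a)"
proof -
  have c: "int a \<in> Iset g" "- int a \<in> Iset g" using assms by (auto simp: Iset_def)
  show e: "even (slot_of (int a))" "odd (slot_of (- int a))" using assms by (auto simp: slot_of_def)
  show "slot_of (int a) < 2 * g" "slot_of (- int a) < 2 * g" "handle_of (slot_of (int a)) = a" "handle_of (slot_of (- int a)) = a"
    using slot_of_range[OF c(1)] slot_of_range[OF c(2)] handle_of_slot[OF c(1)] handle_of_slot[OF c(2)] by auto
  show "slot_of (int a) \<noteq> slot_of (- int a)" using e by metis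
qed

text \<open>
  Adjointness of \<open>\<omega>(j)\<close> and \<open>\<omega>(2-j)\<close> at a single handle, with the other handles fixed. The weight
  of the basis vectors changes by \<open>j - 1\<close>, which appears as a power of \<open>\<rho>\<^sub>a\<close>.
\<close>

lemma handle_exchange:
  assumes a: "a \<in> {1..g}"
  shows "handle_sum (int a) j = rho (int a) (of_int j - 1) \<star> handle_sum (- int a) (2 - j)"
proof
  fix e
  interpret handle D "\<alpha> a" "B a" "d a" by (rule handles[OF a])
  let ?e = "e - single (VR (int a)) (of_int j - 1)"
  let ?n = "ch.modes e"
  let ?R = "\<lambda>e. {b \<in> PiE ({1..g} - {a}) B. \<forall>a'\<in>{1..g} - {a}. basis_wt b a' = e (VR (int a'))}"
  have ai: "VR (int a) \<in> VR ` {1..int g}" using a by auto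
  have p: "pure_exp ?e \<longleftrightarrow> pure_exp e"
  proof -
    have "?e u = e u" if "u \<notin> VW ` Iset g \<union> VR ` {1..int g}" for u
    proof -
      have "u \<noteq> VR (int a)" using that ai by blast
      then show ?thesis by simp
    qed
    then show ?thesis by (simp add: pure_exp_def)
  qed
  have m: "ch.modes ?e = ?n" by (rule ext) (simp add: ch.modes_def slot_var_def)
  have R: "?R ?e = ?R e" by auto
  note sp = slot_of_parity[OF a]
  have slot_label: "slot_label (slot_of (int a)) = \<alpha> a" "slot_label (slot_of (- int a)) = dual D (\<alpha> a)"
    using sp by (simp_all add: slot_label_def)
  have E: "(\<Sum>x\<in>level (e (VR (int a))). ch.corr (ch.vput (slot_of (int a)) j (slot_vec (b(a := x)))) ?n)
      = (\<Sum>x\<in>level (?e (VR (int a))). ch.corr (ch.vput (slot_of (- int a)) (2 - j) (slot_vec (b(a := x)))) ?n)"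
    if b: "b \<in> ?R e" for b
  proof -
    define \<phi> where "\<phi> x y = ch.corr ((slot_vec b)(slot_of (int a) := x, slot_of (- int a) := y)) ?n" for x y
    have carr: "slot_vec b i \<in> mcarrier (W (slot_label i))" if i: "i < 2 * g" "i \<noteq> slot_of (int a)" "i \<noteq> slot_of (- int a)" for i
    proof -
      have h: "handle_of i \<in> {1..g}" "handle_of i \<noteq> a" using handle_of_range[OF i(1)] handle_of_eq_iff[OF i(1) a] i by auto
      then have bi: "b (handle_of i) \<in> B (handle_of i)" using b by (auto simp: PiE_iff)
      interpret h: handle D "\<alpha> (handle_of i)" "B (handle_of i)" "d (handle_of i)" by (rule handles[OF h(1)])
      show ?thesis using h.basis_carrier[OF bi] h.basis_facts(4)[OF bi] by (simp add: slot_vec_def slot_label_def)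
    qed
    have vva: "slot_vec (b(a := x)) k = (if k = slot_of (int a) then x else if k = slot_of (- int a) then d a x else slot_vec b k)"
      if "k < 2 * g" for x k
      using handle_of_eq_iff[OF that a] sp by (auto simp: slot_vec_def)
    have 1: "ch.corr (ch.vput (slot_of (int a)) j (slot_vec (b(a := x)))) ?n = \<phi> (om (W (\<alpha> a)) j x) (d a x)" for x
      unfolding \<phi>_def by (rule ch.corr_cong) (use sp slot_label in \<open>auto simp: ch.vput_def vva\<close>)
    have 2: "ch.corr (ch.vput (slot_of (- int a)) (2 - j) (slot_vec (b(a := x)))) ?n
        = \<phi> x (om (W (dual D (\<alpha> a))) (2 - j) (d a x))" for x
      unfolding \<phi>_def by (rule ch.corr_cong) (use sp slot_label in \<open>auto simp: ch.vput_def vva\<close>)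
    have l1: "lin_on (msmult (W (\<alpha> a))) (*) (mcarrier (W (\<alpha> a))) (\<lambda>x. \<phi> x y)"
      if "y \<in> mcarrier (W (dual D (\<alpha> a)))" for y
      using ch.corr_lin[OF sp(3), of "(slot_vec b)(slot_of (- int a) := y)" ?n] carr that sp slot_label
      unfolding \<phi>_def by (simp add: fun_upd_twist[of "slot_of (- int a)"])
    have l2: "lin_on (msmult (W (dual D (\<alpha> a)))) (*) (mcarrier (W (dual D (\<alpha> a)))) (\<phi> x)"
      if "x \<in> mcarrier (W (\<alpha> a))" for x
      using ch.corr_lin[OF sp(4), of "(slot_vec b)(slot_of (int a) := x)" ?n] carr that sp slot_label
      unfolding \<phi>_def by simp
    show ?thesis
      unfolding 1 2 using adjoint_exchange[where \<phi> = \<phi> and s = "e (VR (int a))" and j = j] l1 l2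
      by (simp add: algebra_simps)
  qed
  have "(\<Sum>b\<in>choices_at e. ch.corr (ch.vput (slot_of (int a)) j (slot_vec b)) ?n)
      = (\<Sum>b\<in>choices_at ?e. ch.corr (ch.vput (slot_of (- int a)) (2 - j) (slot_vec b)) ?n)"
    unfolding sum_choices_split[OF a] R by (rule sum.cong[OF refl]) (rule E)
  then show "handle_sum (int a) j e = (rho (int a) (of_int j - 1) \<star> handle_sum (- int a) (2 - j)) e"
    by (simp add: rho_single fmonom_fmul handle_sum_coeff p m)
qed

lemma handle_symmetry:
  assumes c: "c \<in> Iset g"
  shows "handle_sum c j = rho c (of_int j - 1) \<star> handle_sum (- c) (2 - j)"
proof (cases "c > 0")
  case True
  then have "nat c \<in> {1..g}" "int (nat c) = c" using c by (auto simp: Iset_def)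
  then show ?thesis using handle_exchange[of "nat c" j] by simp
next
  case False
  then have n: "nat (- c) \<in> {1..g}" "int (nat (- c)) = - c" using c by (auto simp: Iset_def)
  have "handle_sum (- c) (2 - j) = rho (- c) (of_int (2 - j) - 1) \<star> handle_sum c j"
    using handle_exchange[OF n(1), of "2 - j"] n(2) by simp
  moreover have "single (VR \<bar>c\<bar>) (of_int j - 1) + single (VR \<bar>c\<bar>) (1 - of_int j) = 0"
    by (simp add: single_add)
  ultimately show ?thesis by (simp add: rho_single fmonom_fmonom_fmul)
qed

lemma fderiv_Z_series:
  assumes c: "c \<in> Iset g" shows "fderiv (VW c) Z_series = handle_sum c 0"
proof
  fix e :: "var \<Rightarrow> complex"
  let ?e = "e(VW c := e (VW c) + 1)"
  have "pure_exp ?e \<longleftrightarrow> pure_exp e" using c by (auto simp: pure_exp_def)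
  moreover have "choices_at ?e = choices_at e" by (simp add: choices_at_def)
  moreover have "(e (VW c) + 1) * ch.corr (slot_vec b) (ch.modes ?e) = ch.corr (ch.vput (slot_of c) 0 (slot_vec b)) (ch.modes e)"
    if "b \<in> choices_at e" for b
  proof -
    have b: "b \<in> choices" using that by (simp add: choices_at_def)
    have "ch.corr (slot_vec b) (ch.modes ?e) = ch.corr (slot_vec b) ((ch.modes e)(slot_of c := ch.modes e (slot_of c) - 1))"
    proof (rule ch.corr_cong)
      fix k assume k: "k < 2 * g"
      have "slot_var k = VW c \<longleftrightarrow> k = slot_of c" using ch.z_eq[OF k slot_of_range[OF c]] slot_var_slot_of[OF c] by simp
      then show "slot_vec b k = slot_vec b k \<and> ch.modes ?e k = ((ch.modes e)(slot_of c := ch.modes e (slot_of c) - 1)) k"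
        by (auto simp: ch.modes_def)
    qed
    then show ?thesis
      using ch.corr_translation[OF slots_slot_vec[OF b] slot_of_range[OF c], of "ch.modes e"] slot_var_slot_of[OF c]
      by (simp add: ch.modes_def)
  qed
  ultimately show "fderiv (VW c) Z_series e = handle_sum c 0 e"
    by (simp add: fderiv_def Z_series_coeff handle_sum_coeff sum_distrib_left)
qed

text \<open>
  The operators \<open>\<partial>\<^sub>a\<^sup>0, \<partial>\<^sub>a\<^sup>1, \<partial>\<^sub>a\<^sup>2\<close> insert \<open>L(-1), L(0), L(1)\<close> at \<open>w\<^sub>a\<close>; the last one is
  \<open>L(-1)\<close> at \<open>w\<^sub>-\<^sub>a\<close> carried over to the other end.
\<close>

lemma dpar_Z_series:
  assumes a: "a \<in> {1..int g}" and l: "l \<le> 2" shows "dpar a l Z_series = handle_sum a (int l)"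
proof -
  have c: "a \<in> Iset g" "- a \<in> Iset g" using a by (auto simp: Iset_def)
  consider "l = 0" | "l = 1" | "l = 2" using l by linarith
  then show ?thesis
  proof cases
    case 1
    then show ?thesis using fderiv_Z_series[OF c(1)] by (simp add: dpar_def)
  next
    case 3
    then show ?thesis using fderiv_Z_series[OF c(2)] handle_symmetry[OF c(1), of 2] by (simp add: dpar_def)
  next
    case 2
    have aa: "nat a \<in> {1..g}" "int (nat a) = a" "\<bar>a\<bar> = a" using a by auto
    have "(rho a 1 \<star> fderiv (VR \<bar>a\<bar>) Z_series) e = handle_sum a 1 e" for e
    proof -
      have u: "(e - single (VR a) 1)(VR a := e (VR a)) = e" by (auto simp: fun_eq_iff single_def)
      have "(rho a 1 \<star> fderiv (VR \<bar>a\<bar>) Z_series) e = e (VR a) * Z_series e"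
        unfolding rho_single fmonom_fmul fderiv_def aa(3) using u by simp
      moreover have "e (VR a) * ch.corr (slot_vec b) n = ch.corr (ch.vput (slot_of a) 1 (slot_vec b)) n" if "b \<in> choices_at e" for b n
      proof -
        have b: "b \<in> choices" "basis_wt b (nat a) = e (VR a)" using that aa by (auto simp: choices_at_def)
        have "slot_wt b (slot_of a) = e (VR a)" using handle_of_slot[OF c(1)] b(2) a by (simp add: slot_wt_def)
        then show ?thesis
          using ch.corr_scaling[OF slots_slot_vec[OF b(1)] slot_of_range[OF c(1)] slot_vec_weight[OF b(1) slot_of_range[OF c(1)]]] by simp
      qed
      ultimately show ?thesis by (simp add: Z_series_coeff handle_sum_coeff sum_distrib_left)
    qed
    then show ?thesis using 2 by (simp add: dpar_def fun_eq_iff)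
  qed
qed

end

section \<open>The Virasoro one-point function\<close>

context setting
begin

lemma corr_series_beyond: "b \<in> choices \<Longrightarrow> ch.annih J (slot_vec b) \<Longrightarrow> k < 2 * g \<Longrightarrow> J \<le> q \<Longrightarrow> ch.corr_series (ch.vput k (int q) (slot_vec b)) = 0"
proof -
  assume a: "b \<in> choices" "ch.annih J (slot_vec b)" "k < 2 * g" "J \<le> q"
  have "ch.vput k (int q) (slot_vec b) k = 0" using a by (simp add: ch.vput_def ch.annih_def)
  then have "ch.corr (ch.vput k (int q) (slot_vec b)) n = 0" for n
    by (rule ch.corr_zero_slot[OF ch.slots_vput[OF slots_slot_vec[OF a(1)]] a(3)])
  then show ?thesis by (simp add: ch.corr_series_def fun_eq_iff)
qed

lemma fsum_K_slots:
  assumes "\<And>c q. c \<in> Iset g \<Longrightarrow> J \<le> q \<Longrightarrow> F (c, q) = 0"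
  shows "fsum F K = (\<Sum>k<2 * g. \<Sum>q<J. F (point_of k, q))"
proof -
  have "fsum F K = (\<Sum>p\<in>Iset g \<times> {..<J}. F p)"
  proof
    fix e
    have "fsum F K e = (\<Sum>p\<in>Iset g \<times> {..<J}. F p e)"
    proof (rule fsum_finite_support)
      fix p assume "p \<in> K - Iset g \<times> {..<J}"
      then have "fst p \<in> Iset g" "J \<le> snd p" by (auto simp: K_def)
      then show "F p e = 0" using assms[of "fst p" "snd p"] by simp
    qed (use finite_Iset in \<open>auto simp: K_def\<close>)
    then show "fsum F K e = (\<Sum>p\<in>Iset g \<times> {..<J}. F p) e" by (simp add: sum_fun_app)
  qed
  also have "\<dots> = (\<Sum>c\<in>Iset g. \<Sum>q<J. F (point_of (slot_of c), q))"
    by (simp add: sum.cartesian_product point_of_slot cong: sum.cong)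
  also have "\<dots> = (\<Sum>k<2 * g. \<Sum>q<J. F (point_of k, q))"
    by (rule sum.reindex_bij_betw[OF slot_of_bij])
  finally show ?thesis .
qed

lemma fmonom_sum: "fmonom s \<star> (\<Sum>i\<in>I. F i) = (\<Sum>i\<in>I. fmonom s \<star> F i)"
  by (rule ext) (simp add: fmonom_fmul sum_fun_app)

text \<open>
  Bookkeeping of the powers of \<open>\<rho>\<close>: the factor \<open>\<rho>\<close> to the power \<open>q/2\<close> in \<open>L\<close> and \<open>A\<close> cancels the
  factor in \<open>ins_term\<close>.
\<close>

lemma insertion_expansion:
  assumes b: "b \<in> choices" and J: "ch.annih J (slot_vec b)"
    and E: "E = (\<Sum>k<2 * g. \<Sum>q<J. Q k q \<star> ch.corr_series (ch.vput k (int q) (slot_vec b)))"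
    and F: "\<And>k q. k < 2 * g \<Longrightarrow> F (point_of k, q) = fmonom (s + single (VR \<bar>point_of k\<bar>) (of_nat q / 2)) \<star> Q k q"
  shows "fmonom s \<star> (fmonom (rho_exp b) \<star> E) = fsum (\<lambda>p. F p \<star> ins_term b p) K"
proof -
  have t: "F (point_of k, q) \<star> ins_term b (point_of k, q) = fmonom s \<star> (fmonom (rho_exp b) \<star> (Q k q \<star> ch.corr_series (ch.vput k (int q) (slot_vec b))))"
    if k: "k < 2 * g" for k q
  proof -
    have E: "s + single (VR \<bar>point_of k\<bar>) (of_nat q / 2) + single (VR \<bar>point_of k\<bar>) (- of_nat q / 2) = s"
      by (simp add: add.assoc single_add)
    show ?thesis
      unfolding F[OF k] ins_term_def rho_single fst_conv snd_conv fmonom_fmul_fmonom slot_of_point E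
        fmonom_fmul_shift[of "Q k q"] ..
  qed
  have "fsum (\<lambda>p. F p \<star> ins_term b p) K = (\<Sum>k<2 * g. \<Sum>q<J. F (point_of k, q) \<star> ins_term b (point_of k, q))"
  proof (rule fsum_K_slots)
    fix c q assume "c \<in> Iset g" "J \<le> q"
    then show "F (c, q) \<star> ins_term b (c, q) = 0"
      using corr_series_beyond[OF b J slot_of_range] by (simp add: ins_term_def)
  qed
  also have "\<dots> = (\<Sum>k<2 * g. \<Sum>q<J. fmonom s \<star> (fmonom (rho_exp b) \<star> (Q k q \<star> ch.corr_series (ch.vput k (int q) (slot_vec b)))))"
    by (intro sum.cong refl t) simp
  also have "\<dots> = fmonom s \<star> (fmonom (rho_exp b) \<star> E)"
    unfolding E fmonom_sum ..
  finally show ?thesis ..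
qed

lemma one_point_per_basis:
  assumes b: "b \<in> choices"
  shows "fmonom (rho_exp b) \<star> ch.conf_corr_series (slot_vec b) = fsum (\<lambda>p. Lrow r (fst p) (snd p) \<star> ins_term b p) K"
proof -
  obtain J where J: "ch.annih J (slot_vec b)" using annih_slot_vec[OF b] by blast
  have "ch.conf_corr_series (slot_vec b) = (\<Sum>k<2 * g. \<Sum>q<J. dderiv VX 0 (slot_var k) q (pi2 r VX (slot_var k)) \<star> ch.corr_series (ch.vput k (int q) (slot_vec b)))"
    by (rule ch.conf_pi2[OF slots_slot_vec[OF b] J lf_corr_series_vput[OF b]])
  from insertion_expansion[OF b J this, where s = 0 and F = "\<lambda>p. Lrow r (fst p) (snd p)"] show ?thesis
    by (simp add: Lrow_def rho_single slot_var_def)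
qed

lemma sf_kernel_ins_term:
  assumes "\<And>p. p \<in> K \<Longrightarrow> lf (F p)" "\<And>p. p \<in> K \<Longrightarrow> order_ge C (F p)"
  shows "sf (\<lambda>q. F (fst q) \<star> ins_term (snd q) (fst q)) (K \<times> choices)"
  using sf_fmul[OF sf_ins_term, of "\<lambda>q. F (fst q)" C] assms by (auto simp: case_prod_beta)

lemma sum_over_basis:
  assumes F: "\<And>p. p \<in> K \<Longrightarrow> lf (F p)" "\<And>p. p \<in> K \<Longrightarrow> order_ge C (F p)"
  shows "fsum (\<lambda>b. fsum (\<lambda>p. F p \<star> ins_term b p) K) choices = fsum (\<lambda>p. F p \<star> ins_sum p) K"
proof -
  have "fsum (\<lambda>b. fsum (\<lambda>p. F p \<star> ins_term b p) K) choices = fsum (\<lambda>p. fsum (\<lambda>b. F p \<star> ins_term b p) choices) K"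
    using fsum_swap[OF sf_kernel_ins_term[OF F]] by simp
  also have "\<dots> = fsum (\<lambda>p. F p \<star> ins_sum p) K"
  proof (rule fsum_cong[OF refl])
    fix p assume p: "p \<in> K"
    have "sf (\<lambda>b. ins_term b p) choices" using sf_section[OF sf_ins_term p] by simp
    then show "fsum (\<lambda>b. F p \<star> ins_term b p) choices = F p \<star> ins_sum p"
      unfolding ins_sum_def by (rule fmul_fsum[OF F(1)[OF p], symmetric])
  qed
  finally show ?thesis .
qed

lemma one_point_ins_sum:
  "one_point_fun D g \<alpha> \<beta> B d (conf V) = fsum (\<lambda>p. Lrow r (fst p) (snd p) \<star> ins_sum p) K"
proof -
  have "one_point_fun D g \<alpha> \<beta> B d (conf V) = fsum (\<lambda>b. fmonom (rho_exp b) \<star> ch.conf_corr_series (slot_vec b)) choices"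
    unfolding one_point_fun_def rho_wt_rho_exp corr1_series choices_def ..
  also have "\<dots> = fsum (\<lambda>b. fsum (\<lambda>p. Lrow r (fst p) (snd p) \<star> ins_term b p) K) choices"
    by (rule fsum_cong[OF refl]) (rule one_point_per_basis)
  also have "\<dots> = fsum (\<lambda>p. Lrow r (fst p) (snd p) \<star> ins_sum p) K"
  proof (rule sum_over_basis)
    fix p assume "p \<in> K"
    then have p: "fst p \<in> Iset g" by (auto simp: K_def)
    show "lf (Lrow r (fst p) (snd p))" by (rule Lrow_facts[OF p])
    show "order_ge (- 4) (Lrow r (fst p) (snd p))" by (rule order_ge_mono[OF Lrow_facts(2)[OF p]]) simp
  qed
  finally show ?thesis .
qed

lemma creation_per_basis:
  assumes b: "b \<in> choices" and c: "c \<in> Iset g"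
  shows "fmonom (single (VR \<bar>c\<bar>) ((of_nat m + 1) / 2)) \<star> (fmonom (rho_exp b) \<star> ch.corr_series (ch.vput (slot_of (- c)) (- 1 - int m) (slot_vec b)))
    = fsum (\<lambda>p. Am (c, m) p \<star> ins_term b p) K"
proof -
  obtain J where J: "ch.annih J (slot_vec b)" using annih_slot_vec[OF b] by blast
  have c': "- c \<in> Iset g" by (rule Iset_uminus[OF c])
  let ?i = "slot_of (- c)"
  have i: "?i < 2 * g" by (rule slot_of_range[OF c'])
  show ?thesis
  proof (rule insertion_expansion[OF b J ch.creation_pi2[OF i slots_slot_vec[OF b] J lf_corr_series_vput[OF b]]])
    fix k q assume k: "k < 2 * g"
    have z: "slot_var ?i = VW (- c)" by (rule slot_var_slot_of[OF c'])
    show "Am (c, m) (point_of k, q) = fmonom (single (VR \<bar>c\<bar>) ((of_nat m + 1) / 2) + single (VR \<bar>point_of k\<bar>) (of_nat q / 2))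
      \<star> (if k = ?i then ch.quad_kernel (\<lambda>l. fscale (1 / fact m) ((fderiv (slot_var ?i) ^^ m) (fl r l (slot_var ?i)))) (slot_var ?i) q
         else dderiv (slot_var ?i) m (slot_var k) q (pi2 r (slot_var ?i) (slot_var k)))"
    proof (cases "k = ?i")
      case True
      then have "point_of k = - c" by (simp add: point_of_slot[OF c'])
      then show ?thesis
        using True by (simp add: Am_def Amat_def rho_single single_add ch.quad_kernel_def z add_divide_distrib)
          (simp add: add_ac)
    next
      case False
      then have "point_of k \<noteq> - c" using slot_of_point[of k] by auto
      then show ?thesis
        using False by (simp add: Am_def Amat_def rho_single fmonom_add z) (simp add: slot_var_def)
    qed
  qed
qed

text \<open>
  An annihilation mode of order \<open>m + 3\<close> at \<open>w\<^sub>c\<close> is the creation mode \<open>\<omega>(-1-m)\<close> at the other end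
  of the handle, to which the genus zero recursion applies.
\<close>

lemma ins_sum_recursion:
  assumes i: "i \<in> K"
  shows "ins_sum (fst i, snd i + 3) = fsum (\<lambda>p. Am i p \<star> ins_sum p) K"
proof -
  obtain c m where cm: "i = (c, m)" by (cases i)
  have c: "c \<in> Iset g" using i by (simp add: cm K_def)
  let ?s = "single (VR \<bar>c\<bar>) ((of_nat m + 1) / 2)"
  have s: "single (VR \<bar>c\<bar>) (- of_nat (m + 3) / 2) + single (VR \<bar>c\<bar>) (of_int (int (m + 3)) - 1) = ?s"
    by (simp add: single_add field_simps)
  have "ins_sum (c, m + 3) = fmonom ?s \<star> handle_sum (- c) (- 1 - int m)"
    unfolding ins_sum_handle_sum handle_symmetry[OF c, of "int (m + 3)"] rho_single fmonom_fmonom_fmul s by (simp add: algebra_simps)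
  also have "\<dots> = fsum (\<lambda>b. fsum (\<lambda>p. Am i p \<star> ins_term b p) K) choices"
    unfolding handle_sum_def fmonom_fsum cm by (rule fsum_cong[OF refl]) (rule creation_per_basis[OF _ c])
  also have "\<dots> = fsum (\<lambda>p. Am i p \<star> ins_sum p) K"
  proof (rule sum_over_basis)
    fix p assume p: "p \<in> K"
    show "lf (Am i p)" by (rule Am_facts[OF i p])
    show "order_ge 0 (Am i p)" by (rule order_ge_mono[OF Am_facts(2)[OF i p]]) simp
  qed
  finally show ?thesis by (simp add: cm)
qed

lemma Tcoef_T_kernel: "Tcoef g r c l = rho c (- of_nat l / 2) \<star> T_kernel (c, l)"
  by (simp add: Tcoef_def T_kernel_def)

lemma lf_Tcoef: "c \<in> Iset g \<Longrightarrow> lf (Tcoef g r c l)"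
  unfolding Tcoef_T_kernel by (intro lf_fmul lf_rho lf_T_kernel) (simp add: K_def)

lemma lf_handle_sum: "c \<in> Iset g \<Longrightarrow> lf (handle_sum c (int l))"
proof -
  assume c: "c \<in> Iset g"
  have "handle_sum c (int l) = rho c (of_nat l / 2) \<star> ins_sum (c, l)"
    unfolding ins_sum_handle_sum rho_single fmonom_fmonom_fmul single_add by simp
  moreover have "lf (ins_sum (c, l))" using c by (intro sf_imp_lf[OF sf_ins_sum]) (simp add: K_def)
  ultimately show ?thesis by (simp add: lf_fmul lf_rho)
qed

lemma one_point_T:
  "one_point_fun D g \<alpha> \<beta> B d (conf V) = (\<Sum>c\<in>Iset g. \<Sum>l\<le>2. Tcoef g r c l \<star> handle_sum c (int l))"
proof -
  have "one_point_fun D g \<alpha> \<beta> B d (conf V) = (\<Sum>p\<in>Iset g \<times> {..2}. T_kernel p \<star> ins_sum p)"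
    by (rule schottky_resummation[OF sf_ins_sum one_point_ins_sum ins_sum_recursion])
  also have "\<dots> = (\<Sum>c\<in>Iset g. \<Sum>l\<le>2. T_kernel (c, l) \<star> ins_sum (c, l))"
    by (simp add: sum.cartesian_product)
  also have "\<dots> = (\<Sum>c\<in>Iset g. \<Sum>l\<le>2. Tcoef g r c l \<star> handle_sum c (int l))"
    unfolding Tcoef_T_kernel ins_sum_handle_sum rho_single fmonom_assoc fmonom_fmul_shift[of "T_kernel _"] ..
  finally show ?thesis .
qed

lemma sum_Iset: "(\<Sum>c\<in>Iset g. h c) = (\<Sum>a\<in>{1..int g}. h a + (h (- a) :: fseries))"
proof -
  have "Iset g = {1..int g} \<union> uminus ` {1..int g}" by (force simp: Iset_def image_iff)
  then have "(\<Sum>c\<in>Iset g. h c) = (\<Sum>c\<in>{1..int g}. h c) + (\<Sum>c\<in>uminus ` {1..int g}. h c)"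
    by (simp only:) (rule sum.union_disjoint, auto)
  also have "(\<Sum>c\<in>uminus ` {1..int g}. h c) = (\<Sum>c\<in>{1..int g}. h (- c))"
    by (subst sum.reindex) (auto simp: inj_on_def)
  finally show ?thesis by (simp only: sum.distrib)
qed

text \<open>
  The terms at \<open>w\<^sub>-\<^sub>a\<close> are carried over to \<open>w\<^sub>a\<close>, which reverses the order of the three modes;
  this explains the shape of \<open>\<Theta>\<close>.
\<close>

lemma nabla_partition: "one_point_fun D g \<alpha> \<beta> B d (conf V) = nabla g r (partition_fun D g \<alpha> \<beta> B d)"
proof -
  have "(\<Sum>l\<le>2. Tcoef g r a l \<star> handle_sum a (int l)) + (\<Sum>l\<le>2. Tcoef g r (- a) l \<star> handle_sum (- a) (int l))
      = (\<Sum>l\<le>2. Theta g r a l \<star> dpar a l Z_series)" if a: "a \<in> {1..int g}" for a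
  proof -
    have c: "a \<in> Iset g" "- a \<in> Iset g" using a by (auto simp: Iset_def)
    have "(\<Sum>l\<le>2. Tcoef g r (- a) l \<star> handle_sum (- a) (int l)) = (\<Sum>l\<le>2. Tcoef g r (- a) (2 - l) \<star> handle_sum (- a) (int (2 - l)))"
      by (rule sum.reindex_bij_witness[where i = "\<lambda>l. 2 - l" and j = "\<lambda>l. 2 - l"]) auto
    moreover have "Theta g r a l \<star> dpar a l Z_series
        = Tcoef g r a l \<star> handle_sum a (int l) + Tcoef g r (- a) (2 - l) \<star> handle_sum (- a) (int (2 - l))" if "l \<in> {..2}" for l
    proof -
      have l: "l \<le> 2" using that by simp
      have "handle_sum (- a) (int (2 - l)) = rho a (1 - of_nat l) \<star> handle_sum a (int l)"
        using handle_symmetry[OF c(2), of "int (2 - l)"] l by (simp add: rho_def of_nat_diff)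
      then have "Tcoef g r (- a) (2 - l) \<star> handle_sum (- a) (int (2 - l))
          = (rho a (1 - of_nat l) \<star> Tcoef g r (- a) (2 - l)) \<star> handle_sum a (int l)"
        unfolding rho_single by (simp only: fmonom_assoc fmonom_fmul_shift[of "Tcoef _ _ _ _"])
      then show ?thesis
        unfolding dpar_Z_series[OF a l] Theta_def using c
        by (simp add: fmul_add_left lf_handle_sum lf_Tcoef lf_fmul lf_rho)
    qed
    ultimately show ?thesis by (simp only: sum.distrib[symmetric]) (intro sum.cong refl, simp)
  qed
  then show ?thesis
    unfolding one_point_T sum_Iset partition_fun_Z_series nabla_def by (intro sum.cong refl)
qed

end

theorem proposition6p1:
  fixes D :: "('w::ab_group_add, 'i) rep_data"
    and g :: nat
    and \<alpha> \<beta> :: "nat \<Rightarrow> 'i"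
    and B :: "nat \<Rightarrow> 'w set"
    and d :: "nat \<Rightarrow> 'w \<Rightarrow> 'w"
    and r :: "var \<Rightarrow> real"
  assumes "rep_theory D"
    and "2 \<le> g"
    and "admissible_labels D g \<alpha> \<beta>"
    and "\<And>a. a \<in> {1..g} \<Longrightarrow> hom_basis D (\<alpha> a) (B a)"
    and "\<And>a. a \<in> {1..g} \<Longrightarrow> dual_basis D (\<alpha> a) (B a) (d a)"
    and "expansion_order g r"
  shows "one_point_fun D g \<alpha> \<beta> B d (conf (alg D)) = nabla g r (partition_fun D g \<alpha> \<beta> B d)"
proof -
  interpret setting D g r \<alpha> \<beta> B d
    using assms by unfold_locales auto
  show ?thesis by (rule nabla_partition)
qed

end
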